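(* There exists an absolute constant $C>0$ such that the following holds. Let $M$ be an $m\times n$ matrix of rank $r\geq1$ with non-negative integer entries, and suppose the average of the entries of $M$ is at most $t$ for some $t\geq1$. Then $M$ contains a constant submatrix (all entries equal) with at least $2^{-Ct\sqrt r}m$ rows and at least $2^{-Ct\sqrt r}n$ columns.
   Context: A submatrix is obtained by selecting an arbitrary (not necessarily consecutive) set of rows and set of columns. *)

theory Defs
  imports Complex_Main "Jordan_Normal_Form.DL_Rank" "Jordan_Normal_Form.DL_Submatrix"
begin

text \<open>The rank over the field of real numbers. The library's column rank
  \<^term>\<open>vec_space.rank\<close> takes the number of rows as a parameter and a matrix over a field.\<close>

definition real_rank :: "nat mat \<Rightarrow> nat" where
  "real_rank M = vec_space.rank (dim_row M) (map_mat real M)"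

definition mat_average :: "nat mat \<Rightarrow> real" where
  "mat_average M =
     (\<Sum>i<dim_row M. \<Sum>j<dim_col M. real (M $$ (i, j))) / (real (dim_row M) * real (dim_col M))"

definition constant_mat :: "'a mat \<Rightarrow> bool" where
  "constant_mat A \<longleftrightarrow> (\<exists>c. \<forall>i<dim_row A. \<forall>j<dim_col A. A $$ (i, j) = c)"

end

theory Submission
  imports Defs "HOL-Library.FuncSet"
begin

text \<open>
  Write \<open>M\<close> minus its mean as \<open>\<langle>u\<^sub>i, v\<^sub>j\<rangle>\<close>. An orthonormal basis of the row space balances the factors
  so that, apart from a small fraction of rows and columns, \<open>\<parallel>u\<^sub>i\<parallel>\<^sup>2\<close> and \<open>\<parallel>v\<^sub>j\<parallel>\<^sup>2\<close> are at most
  \<open>L = O(\<surd>(r V))\<close>, where \<open>V\<close> is the variance of the entries. By Grothendieck's inequality, any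
  weighting \<open>A\<close> of the entries admits a quadrant of a sign partition of rows and columns that
  carries at least a quarter of the mass of \<open>A (1 - (M - c) / (8 L))\<close>. After \<open>k\<close> such steps the
  distribution of the entries is tilted towards small values by the factor
  \<open>(1 - (M - c) / (8 L))\<^sup>k\<close>, at the price of a factor \<open>2 ^ O(k)\<close> in size.

  The potential is mean plus standard deviation. Under tilting, the mean falls at a rate equal to the
  variance, so if the potential did not decrease, the standard deviation would satisfy a Riccati
  inequality and blow up. Hence \<open>O(\<surd>r)\<close> bits of size suffice to lower the potential by a
  constant fraction of the standard deviation. Once the variance is a small constant, a single
  integer \<open>a\<close> dominates. Then the mean square distance to \<open>a\<close> is halved repeatedly, which costs
  only a geometric series summing to \<open>O(\<surd>r)\<close>, until it is below \<open>1 / (4 (r + 1))\<close> and a rank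
  argument produces a constant block; or else smaller entries take over on the way, and the
  potential drops by a constant.
  Since the potential is non-negative, \<open>O(t)\<close> rounds suffice once it is \<open>O(t)\<close>. To start, a
  submatrix with entries \<open>O(r t)\<close> is found from a basis of columns with coefficients at most
  \<open>1\<close>, and its second moment is brought down to \<open>O(t\<^sup>2)\<close> at a geometrically decreasing cost.
\<close>

section \<open>Grothendieck's inequality\<close>

lemma sum_lessThan_add:
  fixes f :: "nat \<Rightarrow> real"
  shows "(\<Sum>s<a+b. f s) = (\<Sum>s<a. f s) + (\<Sum>s<b. f (a+s))"
  by (induction b) auto

text \<open>A stand-in for independent random signs: a finite list of \<open>N\<close> vectors whose
  empirical second moments reproduce inner products exactly, with a fourth-moment bound of
  Khintchine type.\<close>

definition rademacher_sample :: "nat \<Rightarrow> nat \<Rightarrow> (nat \<Rightarrow> nat \<Rightarrow> real) \<Rightarrow> bool" where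
  "rademacher_sample d N w \<longleftrightarrow> N > 0 \<and>
    (\<forall>u v. (\<Sum>s<N. (\<Sum>k<d. u k * w s k) * (\<Sum>k<d. v k * w s k)) = real N * (\<Sum>k<d. u k * v k)) \<and>
    (\<forall>u. (\<Sum>s<N. (\<Sum>k<d. u k * w s k)^4) \<le> 3 * real N * (\<Sum>k<d. (u k)\<^sup>2)\<^sup>2)"

text \<open>Each new coordinate doubles the sample: one copy gets \<open>1\<close>, the other
  \<open>-1\<close>, so that the odd terms in \<open>u d\<close> cancel between the two
  copies.\<close>

lemma rademacher_sample_exists: "\<exists>N w. rademacher_sample d N w"
proof (induction d)
  case 0
  show ?case by (intro exI[of _ 1] exI[of _ "\<lambda>_ _. 0"]) (auto simp: rademacher_sample_def)
next
  case (Suc d)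
  then obtain N :: nat and w :: "nat \<Rightarrow> nat \<Rightarrow> real" where N: "N > 0"
    and w2: "\<And>u v. (\<Sum>s<N. (\<Sum>k<d. u k * w s k) * (\<Sum>k<d. v k * w s k)) = real N * (\<Sum>k<d. u k * v k)"
    and w4: "\<And>u. (\<Sum>s<N. (\<Sum>k<d. u k * w s k)^4) \<le> 3 * real N * (\<Sum>k<d. (u k)\<^sup>2)\<^sup>2"
    unfolding rademacher_sample_def by blast
  define w' where "w' s k = (if k = d then (if s < N then 1 else -1) else w (if s < N then s else s - N) k)" for s k
  define \<alpha> where "\<alpha> u s = (\<Sum>k<d. u k * w s k)" for u :: "nat \<Rightarrow> real" and s
  have lo: "(\<Sum>k<Suc d. u k * w' s k) = \<alpha> u s + u d" if "s < N" for u s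
    using that by (simp add: w'_def \<alpha>_def)
  have hi: "(\<Sum>k<Suc d. u k * w' (N + s) k) = \<alpha> u s - u d" for u s
    by (simp add: w'_def \<alpha>_def)
  show ?case unfolding rademacher_sample_def
  proof (intro exI[of _ "N + N"] exI[of _ w'] conjI allI)
    show "0 < N + N" using N by simp
  next
    fix u v :: "nat \<Rightarrow> real"
    have "(\<Sum>s<N+N. (\<Sum>k<Suc d. u k * w' s k) * (\<Sum>k<Suc d. v k * w' s k))
       = (\<Sum>s<N. (\<alpha> u s + u d) * (\<alpha> v s + v d)) + (\<Sum>s<N. (\<alpha> u s - u d) * (\<alpha> v s - v d))"
      unfolding sum_lessThan_add hi by (simp add: lo del: sum.lessThan_Suc)
    also have "\<dots> = (\<Sum>s<N. 2 * (\<alpha> u s * \<alpha> v s) + 2 * (u d * v d))"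
      unfolding sum.distrib[symmetric] by (intro sum.cong) (auto simp: algebra_simps)
    also have "\<dots> = 2 * (real N * (\<Sum>k<d. u k * v k)) + real N * (2 * (u d * v d))"
      using w2[of u v] by (simp add: sum.distrib sum_distrib_left[symmetric] \<alpha>_def)
    also have "\<dots> = real (N + N) * (\<Sum>k<Suc d. u k * v k)"
      by (simp add: algebra_simps)
    finally show "(\<Sum>s<N+N. (\<Sum>k<Suc d. u k * w' s k) * (\<Sum>k<Suc d. v k * w' s k))
       = real (N + N) * (\<Sum>k<Suc d. u k * v k)" .
  next
    fix u :: "nat \<Rightarrow> real"
    define q where "q = (\<Sum>k<d. (u k)\<^sup>2)"
    have a2: "(\<Sum>s<N. (\<alpha> u s)\<^sup>2) = real N * q"
      using w2[of u u] by (simp add: \<alpha>_def q_def power2_eq_square)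
    have a4: "(\<Sum>s<N. (\<alpha> u s)^4) \<le> 3 * real N * q\<^sup>2"
      using w4[of u] by (simp add: \<alpha>_def q_def)
    have "(\<Sum>s<N+N. (\<Sum>k<Suc d. u k * w' s k)^4)
       = (\<Sum>s<N. (\<alpha> u s + u d)^4) + (\<Sum>s<N. (\<alpha> u s - u d)^4)"
      unfolding sum_lessThan_add hi by (simp add: lo del: sum.lessThan_Suc)
    also have "\<dots> = (\<Sum>s<N. 2 * (\<alpha> u s)^4 + 12 * (u d)\<^sup>2 * (\<alpha> u s)\<^sup>2 + 2 * (u d)^4)"
      unfolding sum.distrib[symmetric] by (intro sum.cong) (auto simp: power4_eq_xxxx power2_eq_square algebra_simps)
    also have "\<dots> = 2 * (\<Sum>s<N. (\<alpha> u s)^4) + 12 * (u d)\<^sup>2 * (real N * q) + real N * (2 * (u d)^4)"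
      by (simp add: sum.distrib sum_distrib_left[symmetric] a2)
    \<comment> \<open>Raising the last coefficient from \<open>2\<close> to \<open>6\<close>
      completes the square of \<open>q + (u d)\<^sup>2\<close>.\<close>
    also have "\<dots> \<le> 6 * real N * q\<^sup>2 + 12 * (u d)\<^sup>2 * (real N * q) + real N * (6 * (u d)^4)"
      using a4 by (intro add_mono) auto
    also have "\<dots> = 3 * real (N + N) * (q + (u d)\<^sup>2)\<^sup>2"
      by (simp add: power4_eq_xxxx power2_eq_square algebra_simps)
    finally show "(\<Sum>s<N+N. (\<Sum>k<Suc d. u k * w' s k)^4) \<le> 3 * real (N + N) * (\<Sum>k<Suc d. (u k)\<^sup>2)\<^sup>2"
      by (simp add: q_def)
  qed
qed

lemma inner_bound:
  fixes u v :: "nat \<Rightarrow> real"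
  assumes "(\<Sum>k<d. (u k)\<^sup>2) \<le> L" "(\<Sum>k<d. (v k)\<^sup>2) \<le> L"
  shows "\<bar>\<Sum>k<d. u k * v k\<bar> \<le> L"
proof -
  have "\<bar>\<Sum>k<d. u k * v k\<bar> \<le> (\<Sum>k<d. \<bar>u k * v k\<bar>)" by (rule sum_abs)
  also have "\<dots> \<le> (\<Sum>k<d. ((u k)\<^sup>2 + (v k)\<^sup>2) / 2)"
  proof (rule sum_mono)
    fix k show "\<bar>u k * v k\<bar> \<le> ((u k)\<^sup>2 + (v k)\<^sup>2) / 2"
      using sum_squares_bound[of "\<bar>u k\<bar>" "\<bar>v k\<bar>"] by (simp add: abs_mult)
  qed
  also have "\<dots> \<le> L" using assms by (simp add: sum_divide_distrib[symmetric] sum.distrib)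
  finally show ?thesis .
qed

definition clip :: "real \<Rightarrow> real" where "clip x = max (-2) (min 2 x)"

lemma clip_bound: "\<bar>clip x\<bar> \<le> 2" "(clip x)\<^sup>2 \<le> x\<^sup>2"
  by (auto simp: clip_def max_def min_def abs_le_square_iff[symmetric])

text \<open>Beyond the clipping level the error is \<open>|x| - 2\<close>, and
  \<open>8 * (|x| - 2) \<le> x^2\<close> says that \<open>(|x| - 4)^2\<close> is
  nonnegative.\<close>

lemma clip_error: "64 * (x - clip x)\<^sup>2 \<le> x^4"
proof -
  have "8 * \<bar>x - clip x\<bar> \<le> x\<^sup>2"
  proof -
    have "0 \<le> (x - 4)\<^sup>2" "0 \<le> (x + 4)\<^sup>2" by auto
    then show ?thesis by (auto simp: clip_def max_def min_def power2_eq_square algebra_simps abs_if)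
  qed
  then have "(8 * \<bar>x - clip x\<bar>)\<^sup>2 \<le> (x\<^sup>2)\<^sup>2" by (intro power_mono) auto
  then show ?thesis by (simp add: power_mult_distrib)
qed

text \<open>Clipping the Rademacher sums at \<open>2\<close> leaves two error terms
  that are again inner products of vectors, of total size at most half of the best constant.\<close>

lemma grothendieck_inequality:
  fixes A :: "'a \<times> 'b \<Rightarrow> real" and u :: "'a \<Rightarrow> nat \<Rightarrow> real" and v :: "'b \<Rightarrow> nat \<Rightarrow> real"
  assumes fin: "finite X" "finite Y"
  assumes B: "\<And>x y. (\<And>i. \<bar>x i\<bar> \<le> 1) \<Longrightarrow> (\<And>j. \<bar>y j\<bar> \<le> 1) \<Longrightarrow>
      (\<Sum>(i,j)\<in>X\<times>Y. A (i,j) * (x i * y j)) \<le> B"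
  assumes u: "\<And>i. i \<in> X \<Longrightarrow> (\<Sum>k<d. (u i k)\<^sup>2) \<le> 1"
  assumes v: "\<And>j. j \<in> Y \<Longrightarrow> (\<Sum>k<d. (v j k)\<^sup>2) \<le> 1"
  shows "(\<Sum>(i,j)\<in>X\<times>Y. A (i,j) * (\<Sum>k<d. u i k * v j k)) \<le> 8 * B"
proof -
  define F where "F d u v = (\<Sum>(i,j)\<in>X\<times>Y. A (i,j) * (\<Sum>k<d. u i k * v j k))"
    for d and u :: "'a \<Rightarrow> nat \<Rightarrow> real" and v :: "'b \<Rightarrow> nat \<Rightarrow> real"
  define ok where "ok d u v \<longleftrightarrow> (\<forall>i\<in>X. (\<Sum>k<d. (u i k)\<^sup>2) \<le> 1) \<and> (\<forall>j\<in>Y. (\<Sum>k<d. (v j k)\<^sup>2) \<le> 1)"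
    for d and u :: "'a \<Rightarrow> nat \<Rightarrow> real" and v :: "'b \<Rightarrow> nat \<Rightarrow> real"
  define V where "V = {F d u v | d u v. ok d u v}"
  define G where "G = Sup V"
  have bdd: "bdd_above V"
  proof (rule bdd_aboveI)
    fix z assume "z \<in> V"
    then obtain d u v where z: "z = F d u v" and o: "ok d u v" by (auto simp: V_def)
    have "z \<le> (\<Sum>(i,j)\<in>X\<times>Y. \<bar>A (i,j)\<bar> * 1)"
      unfolding z F_def
    proof (rule sum_mono, clarify)
      fix i j assume ij: "i \<in> X" "j \<in> Y"
      have "A (i,j) * (\<Sum>k<d. u i k * v j k) \<le> \<bar>A (i,j)\<bar> * \<bar>\<Sum>k<d. u i k * v j k\<bar>"
        by (metis abs_ge_self abs_mult)
      also have "\<dots> \<le> \<bar>A (i,j)\<bar> * 1"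
        using o ij by (intro mult_left_mono inner_bound) (auto simp: ok_def)
      finally show "A (i,j) * (\<Sum>k<d. u i k * v j k) \<le> \<bar>A (i,j)\<bar> * 1" .
    qed
    then show "z \<le> (\<Sum>(i,j)\<in>X\<times>Y. \<bar>A (i,j)\<bar> * 1)" .
  qed
  have le_G: "F d u v \<le> G" if "ok d u v" for d u v
    unfolding G_def using that by (intro cSup_upper bdd) (auto simp: V_def)
  have main: "F d u v \<le> 4 * B + G / 2" if o: "ok d u v" for d u v
  proof -
    obtain N :: nat and w :: "nat \<Rightarrow> nat \<Rightarrow> real" where N: "N > 0"
      and w2: "\<And>u v. (\<Sum>s<N. (\<Sum>k<d. u k * w s k) * (\<Sum>k<d. v k * w s k)) = real N * (\<Sum>k<d. u k * v k)"
      and w4: "\<And>u. (\<Sum>s<N. (\<Sum>k<d. u k * w s k)^4) \<le> 3 * real N * (\<Sum>k<d. (u k)\<^sup>2)\<^sup>2"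
      using rademacher_sample_exists[of d] unfolding rademacher_sample_def by blast
    define n where "n = sqrt (real N)"
    have n: "n > 0" "n * n = real N" using N by (auto simp: n_def)
    define P where "P i s = (\<Sum>k<d. u i k * w s k)" for i s
    define Q where "Q j s = (\<Sum>k<d. v j k * w s k)" for j s
    have P2: "(\<Sum>s<N. (P i s)\<^sup>2) \<le> N" if "i \<in> X" for i
      using w2[of "u i" "u i"] o that N
      by (auto simp: P_def ok_def power2_eq_square mult_left_le)
    have Q2: "(\<Sum>s<N. (Q j s)\<^sup>2) \<le> N" if "j \<in> Y" for j
      using w2[of "v j" "v j"] o that N
      by (auto simp: Q_def ok_def power2_eq_square mult_left_le)
    \<comment> \<open>By the fourth-moment bound, clipping errors have mean square at most
      \<open>3/64\<close>. Scaled by \<open>4\<close> they are still vectors of norm at most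
      \<open>1\<close>, so each error term is a quarter of an admissible value of
      \<open>F\<close>.\<close>
    have err: "(\<Sum>s<N. (4 * (f s - clip (f s)) / n)\<^sup>2) \<le> 1" 
      if f: "(\<Sum>s<N. (f s)^4) \<le> 3 * real N" for f :: "nat \<Rightarrow> real"
    proof -
      have "(\<Sum>s<N. (4 * (f s - clip (f s)) / n)\<^sup>2) \<le> (\<Sum>s<N. (f s)^4 / (4 * real N))"
      proof (rule sum_mono)
        fix s
        have "(4 * (f s - clip (f s)) / n)\<^sup>2 = (64 * (f s - clip (f s))\<^sup>2) / (4 * real N)"
          by (simp add: power_divide power_mult_distrib flip: n(2)) (simp add: power2_eq_square algebra_simps)
        also have "\<dots> \<le> (f s)^4 / (4 * real N)"
          using clip_error by (intro divide_right_mono) auto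
        finally show "(4 * (f s - clip (f s)) / n)\<^sup>2 \<le> (f s)^4 / (4 * real N)" .
      qed
      also have "\<dots> \<le> 1" using f N by (simp add: sum_divide_distrib[symmetric] field_simps)
      finally show ?thesis .
    qed
    have cl: "(\<Sum>s<N. (f s / n)\<^sup>2) \<le> 1" if f: "(\<Sum>s<N. (g s)\<^sup>2) \<le> N" "\<And>s. (f s)\<^sup>2 \<le> (g s)\<^sup>2"
        for f g :: "nat \<Rightarrow> real"
    proof -
      have "(\<Sum>s<N. (f s / n)\<^sup>2) \<le> (\<Sum>s<N. (g s)\<^sup>2 / N)"
        using n f(2) by (intro sum_mono) (simp add: power_divide power2_eq_square divide_right_mono)
      also have "\<dots> \<le> 1" using f N by (simp add: sum_divide_distrib[symmetric])
      finally show ?thesis .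
    qed
    have P4: "(\<Sum>s<N. (P i s)^4) \<le> 3 * real N" if "i \<in> X" for i
    proof -
      have "((\<Sum>k<d. (u i k)\<^sup>2))\<^sup>2 \<le> 1" using o that
        by (auto simp: ok_def intro!: power_le_one sum_nonneg)
      then have "3 * real N * ((\<Sum>k<d. (u i k)\<^sup>2))\<^sup>2 \<le> 3 * real N * 1"
        by (intro mult_left_mono) auto
      with w4[of "u i"] show ?thesis by (simp add: P_def)
    qed
    have Q4: "(\<Sum>s<N. (Q i s)^4) \<le> 3 * real N" if "i \<in> Y" for i
    proof -
      have "((\<Sum>k<d. (v i k)\<^sup>2))\<^sup>2 \<le> 1" using o that
        by (auto simp: ok_def intro!: power_le_one sum_nonneg)
      then have "3 * real N * ((\<Sum>k<d. (v i k)\<^sup>2))\<^sup>2 \<le> 3 * real N * 1"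
        by (intro mult_left_mono) auto
      with w4[of "v i"] show ?thesis by (simp add: Q_def)
    qed
    have o1: "ok N (\<lambda>i s. clip (P i s) / n) (\<lambda>j s. 4 * (Q j s - clip (Q j s)) / n)"
      unfolding ok_def using cl[OF P2 clip_bound(2)] err[OF Q4] by blast
    have o2: "ok N (\<lambda>i s. 4 * (P i s - clip (P i s)) / n) (\<lambda>j s. Q j s / n)"
      unfolding ok_def using cl[OF Q2 order_refl] err[OF P4] by blast
    \<comment> \<open>This is \<open>P * Q = clip P * clip Q + clip P * (Q - clip Q) + (P - clip P)
      * Q\<close>, averaged over the sample.\<close>
    have split: "(\<Sum>k<d. u i k * v j k) = (\<Sum>s<N. clip (P i s) * clip (Q j s)) / N
       + (\<Sum>s<N. clip (P i s) / n * (4 * (Q j s - clip (Q j s)) / n)) / 4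
       + (\<Sum>s<N. (4 * (P i s - clip (P i s)) / n) * (Q j s / n)) / 4" for i j
    proof -
      have "(\<Sum>k<d. u i k * v j k) = (\<Sum>s<N. P i s * Q j s / N)"
        using w2[of "u i" "v j"] N by (simp add: P_def Q_def sum_divide_distrib[symmetric])
      also have "\<dots> = (\<Sum>s<N. clip (P i s) * clip (Q j s) / N
         + clip (P i s) / n * (4 * (Q j s - clip (Q j s)) / n) / 4
         + (4 * (P i s - clip (P i s)) / n) * (Q j s / n) / 4)"
        using n N by (intro sum.cong refl) (simp add: field_simps flip: n(2))
      finally show ?thesis by (simp add: sum.distrib sum_divide_distrib)
    qed
    have lin: "(\<Sum>(i,j)\<in>X\<times>Y. A (i,j) * (e1 i j + e2 i j / 4 + e3 i j / 4)) =
        (\<Sum>(i,j)\<in>X\<times>Y. A (i,j) * e1 i j) + (\<Sum>(i,j)\<in>X\<times>Y. A (i,j) * e2 i j) / 4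
        + (\<Sum>(i,j)\<in>X\<times>Y. A (i,j) * e3 i j) / 4" for e1 e2 e3
      unfolding sum_divide_distrib sum.distrib[symmetric]
      by (intro sum.cong refl) (auto simp: algebra_simps)
    have "F d u v = (\<Sum>(i,j)\<in>X\<times>Y. A (i,j) * ((\<Sum>s<N. clip (P i s) * clip (Q j s)) / N))
       + F N (\<lambda>i s. clip (P i s) / n) (\<lambda>j s. 4 * (Q j s - clip (Q j s)) / n) / 4
       + F N (\<lambda>i s. 4 * (P i s - clip (P i s)) / n) (\<lambda>j s. Q j s / n) / 4"
      unfolding F_def split by (rule lin)
    \<comment> \<open>Halving the clipped sums brings them into \<open>[-1, 1]\<close>, where the
      hypothesis on \<open>B\<close> applies sample by sample; hence the factor
      \<open>4\<close>.\<close>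
    moreover have "(\<Sum>(i,j)\<in>X\<times>Y. A (i,j) * ((\<Sum>s<N. clip (P i s) * clip (Q j s)) / N)) \<le> 4 * B"
    proof -
      have "(\<Sum>(i,j)\<in>X\<times>Y. A (i,j) * ((\<Sum>s<N. clip (P i s) * clip (Q j s)) / N))
        = (\<Sum>s<N. 4 * (\<Sum>(i,j)\<in>X\<times>Y. A (i,j) * ((clip (P i s) / 2) * (clip (Q j s) / 2)))) / N"
        by (simp add: case_prod_unfold sum_distrib_left sum_divide_distrib) (rule sum.swap)
      also have "\<dots> \<le> (\<Sum>s<N. 4 * B) / N"
        using clip_bound(1) by (intro divide_right_mono sum_mono mult_left_mono B) auto
      also have "\<dots> = 4 * B" using N by simp
      finally show ?thesis .
    qed
    ultimately show ?thesis using le_G[OF o1] le_G[OF o2] by linarith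
  qed
  have "ok d u v" using u v by (auto simp: ok_def)
  then have "V \<noteq> {}" by (auto simp: V_def)
  \<comment> \<open>Passing to the supremum absorbs both error terms and leaves
    \<open>G \<le> 8 * B\<close>.\<close>
  then have "G \<le> 4 * B + G / 2" unfolding G_def
    by (rule cSup_least) (use main in \<open>auto simp: V_def G_def\<close>)
  with main[OF \<open>ok d u v\<close>] show ?thesis by (simp add: F_def)
qed

section \<open>From Grothendieck's inequality to tilting by quadrants\<close>

lemma sum_le_sum_signs:
  fixes a x :: "'a \<Rightarrow> real"
  assumes "\<And>i. \<bar>x i\<bar> \<le> 1"
  shows "(\<Sum>i\<in>X. a i * x i) \<le> (\<Sum>i\<in>X. a i * (if a i \<ge> 0 then 1 else -1))"
proof (rule sum_mono)
  fix i
  have "a i * x i \<le> \<bar>a i\<bar> * \<bar>x i\<bar>" by (metis abs_ge_self abs_mult)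
  also have "\<dots> \<le> \<bar>a i\<bar> * 1" using assms by (intro mult_left_mono) auto
  finally show "a i * x i \<le> a i * (if a i \<ge> 0 then 1 else -1)" by (auto split: if_splits)
qed

text \<open>Let \<open>b\<close> be the largest sum of \<open>A\<close> over a subblock. Bounding
  the quadrants of sign partitions by \<open>b\<close> bounds the bilinear form of \<open>-A\<close>
  on signs by \<open>4 * b - sum A (X \<times> Y)\<close>. Grothendieck's inequality carries this
  over to \<open>B / L\<close> with a factor \<open>8\<close>, which is the \<open>8\<close> in the
  weight.\<close>

lemma quarter_step:
  fixes A B :: "'a \<times> 'b \<Rightarrow> real" and u :: "'a \<Rightarrow> nat \<Rightarrow> real" and v :: "'b \<Rightarrow> nat \<Rightarrow> real"
  assumes fin: "finite X" "finite Y" and L: "L > 0"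
  assumes B: "\<And>i j. i \<in> X \<Longrightarrow> j \<in> Y \<Longrightarrow> B (i,j) = (\<Sum>k<d. u i k * v j k)"
  assumes u: "\<And>i. i \<in> X \<Longrightarrow> (\<Sum>k<d. (u i k)\<^sup>2) \<le> L"
  assumes v: "\<And>j. j \<in> Y \<Longrightarrow> (\<Sum>k<d. (v j k)\<^sup>2) \<le> L"
  shows "\<exists>X'\<subseteq>X. \<exists>Y'\<subseteq>Y. (\<Sum>p\<in>X\<times>Y. A p * (1 - B p / (8 * L))) / 4 \<le> sum A (X' \<times> Y')"
proof -
  define Z where "Z = (\<lambda>(X',Y'). sum A (X' \<times> Y')) ` (Pow X \<times> Pow Y)"
  define b where "b = Max Z"
  have Z: "finite Z" "Z \<noteq> {}" using fin by (auto simp: Z_def)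
  have le_b: "sum A (X' \<times> Y') \<le> b" if "X' \<subseteq> X" "Y' \<subseteq> Y" for X' Y'
    unfolding b_def using Z that by (intro Max_ge) (force simp: Z_def)+
  have "b \<in> Z" unfolding b_def using Z by (rule Max_in)
  then obtain X' Y' where XY: "X' \<subseteq> X" "Y' \<subseteq> Y" "b = sum A (X' \<times> Y')"
    by (auto simp: Z_def)
  \<comment> \<open>The positions where the signs differ form two opposite quadrants, each of sum at
    most \<open>b\<close>.\<close>
  have signs: "(\<Sum>(i,j)\<in>X\<times>Y. - A (i,j) * (x i * y j)) \<le> 4 * b - sum A (X \<times> Y)"
    if x: "\<And>i. x i = 1 \<or> x i = -1" and y: "\<And>j. y j = 1 \<or> y j = -1" for x :: "'a \<Rightarrow> real" and y :: "'b \<Rightarrow> real"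
  proof -
    have part: "sum A ({i\<in>X. x i = s} \<times> {j\<in>Y. y j = t}) = 
        (\<Sum>p\<in>X\<times>Y. if x (fst p) = s \<and> y (snd p) = t then A p else 0)" for s t
    proof -
      have "{i\<in>X. x i = s} \<times> {j\<in>Y. y j = t} = {p\<in>X\<times>Y. x (fst p) = s \<and> y (snd p) = t}" by auto
      then show ?thesis using fin by (simp add: sum.inter_filter)
    qed
    have "(\<Sum>p\<in>X\<times>Y. A p * (1 - x (fst p) * y (snd p)) / 2)
      = sum A ({i\<in>X. x i = 1} \<times> {j\<in>Y. y j = -1}) + sum A ({i\<in>X. x i = -1} \<times> {j\<in>Y. y j = 1})"
      unfolding part sum.distrib[symmetric]
    proof (rule sum.cong[OF refl])
      fix p
      show "A p * (1 - x (fst p) * y (snd p)) / 2 =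
         (if x (fst p) = 1 \<and> y (snd p) = - 1 then A p else 0) +
         (if x (fst p) = - 1 \<and> y (snd p) = 1 then A p else 0)"
        using x[of "fst p"] y[of "snd p"] by auto
    qed
    also have "\<dots> \<le> b + b" by (intro add_mono le_b) auto
    finally have "(\<Sum>p\<in>X\<times>Y. A p * (1 - x (fst p) * y (snd p))) \<le> 4 * b"
      by (simp add: sum_divide_distrib[symmetric])
    then show ?thesis
      by (simp add: case_prod_unfold algebra_simps sum_subtractf sum_negf)
  qed
  \<comment> \<open>A bilinear form on cubes is maximal at vertices: round \<open>x\<close> to signs
    with \<open>y\<close> fixed, then \<open>y\<close>.\<close>
  have bnd: "(\<Sum>(i,j)\<in>X\<times>Y. - A (i,j) * (x i * y j)) \<le> 4 * b - sum A (X \<times> Y)"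
    if x: "\<And>i. \<bar>x i\<bar> \<le> 1" and y: "\<And>j. \<bar>y j\<bar> \<le> 1" for x :: "'a \<Rightarrow> real" and y :: "'b \<Rightarrow> real"
  proof -
    define a where "a i = (\<Sum>j\<in>Y. - A (i,j) * y j)" for i
    define x' where "x' i = (if a i \<ge> 0 then 1 else -1 :: real)" for i
    define c where "c j = (\<Sum>i\<in>X. - A (i,j) * x' i)" for j
    define y' where "y' j = (if c j \<ge> 0 then 1 else -1 :: real)" for j
    have rows: "(\<Sum>(i,j)\<in>X\<times>Y. - A (i,j) * (x i * y j)) = (\<Sum>i\<in>X. (\<Sum>j\<in>Y. - A (i,j) * y j) * x i)" for x y
      by (simp add: sum.cartesian_product[symmetric] sum_distrib_left sum_distrib_right algebra_simps)
    have cols: "(\<Sum>i\<in>X. (\<Sum>j\<in>Y. - A (i,j) * y j) * x i) = (\<Sum>j\<in>Y. (\<Sum>i\<in>X. - A (i,j) * x i) * y j)" for x y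
      unfolding sum_distrib_right by (subst sum.swap) (simp add: algebra_simps)
    have "(\<Sum>(i,j)\<in>X\<times>Y. - A (i,j) * (x i * y j)) \<le> (\<Sum>i\<in>X. a i * x' i)"
      unfolding rows a_def[symmetric] x'_def by (rule sum_le_sum_signs[OF x])
    also have "\<dots> \<le> (\<Sum>j\<in>Y. c j * y' j)"
      unfolding a_def cols c_def[symmetric] y'_def by (rule sum_le_sum_signs[OF y])
    also have "\<dots> = (\<Sum>(i,j)\<in>X\<times>Y. - A (i,j) * (x' i * y' j))"
      unfolding c_def rows cols ..
    also have "\<dots> \<le> 4 * b - sum A (X \<times> Y)"
      by (rule signs) (auto simp: x'_def y'_def)
    finally show ?thesis .
  qed
  have sc: "(\<Sum>k<d. (f k / sqrt L)\<^sup>2) \<le> 1" if "(\<Sum>k<d. (f k)\<^sup>2) \<le> L" for f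
    using that L by (simp add: power_divide sum_divide_distrib[symmetric])
  have "(\<Sum>(i,j)\<in>X\<times>Y. - A (i,j) * (\<Sum>k<d. u i k / sqrt L * (v j k / sqrt L))) \<le> 8 * (4 * b - sum A (X \<times> Y))"
    by (rule grothendieck_inequality[where A = "\<lambda>p. - A p"]) (use fin bnd u v sc in auto)
  also have "(\<Sum>(i,j)\<in>X\<times>Y. - A (i,j) * (\<Sum>k<d. u i k / sqrt L * (v j k / sqrt L))) = (\<Sum>p\<in>X\<times>Y. - A p * (B p / L))"
    using L by (intro sum.cong refl) (auto simp: B sum_divide_distrib[symmetric])
  finally have "(\<Sum>p\<in>X\<times>Y. - A p * (B p / L)) / 8 + sum A (X \<times> Y) \<le> 4 * b" by simp
  moreover have "(\<Sum>p\<in>X\<times>Y. - A p * (B p / L)) / 8 + sum A (X \<times> Y) = (\<Sum>p\<in>X\<times>Y. A p * (1 - B p / (8 * L)))"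
    unfolding sum_divide_distrib sum.distrib[symmetric] by (intro sum.cong refl) (simp add: algebra_simps)
  ultimately show ?thesis using XY by (intro exI[of _ X'] exI[of _ Y'] conjI) auto
qed

text \<open>The last clause is the form in which the probabilistic method is used: in place of a random
  block there is, for every functional \<open>A\<close> of the entries, a block that is good for \<open>A\<close>.\<close>

definition tiltable :: "'a set \<Rightarrow> 'b set \<Rightarrow> ('a \<times> 'b \<Rightarrow> real) \<Rightarrow> real \<Rightarrow> bool" where
  "tiltable X Y B L \<longleftrightarrow> L > 0 \<and> (\<forall>p\<in>X\<times>Y. \<bar>B p\<bar> \<le> L) \<and>
     (\<forall>A k. \<exists>X'\<subseteq>X. \<exists>Y'\<subseteq>Y. (\<Sum>p\<in>X\<times>Y. A p * (1 - B p / (8 * L)) ^ k) / 4 ^ k \<le> sum A (X' \<times> Y'))"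

text \<open>Bounds on the factors survive passing to subblocks, so \<open>quarter_step\<close> can
  be iterated. It is applied to \<open>A\<close> times the remaining power of the weight, and the
  induction hypothesis continues inside the quadrant found.\<close>

lemma tiltable_if_bounded_factors:
  fixes B :: "'a \<times> 'b \<Rightarrow> real" and u :: "'a \<Rightarrow> nat \<Rightarrow> real" and v :: "'b \<Rightarrow> nat \<Rightarrow> real"
  assumes fin: "finite X" "finite Y" and L: "L > 0"
  assumes B: "\<And>i j. i \<in> X \<Longrightarrow> j \<in> Y \<Longrightarrow> B (i,j) = (\<Sum>k<d. u i k * v j k)"
  assumes u: "\<And>i. i \<in> X \<Longrightarrow> (\<Sum>k<d. (u i k)\<^sup>2) \<le> L"
  assumes v: "\<And>j. j \<in> Y \<Longrightarrow> (\<Sum>k<d. (v j k)\<^sup>2) \<le> L"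
  shows "tiltable X Y B L"
proof -
  have "\<exists>X'\<subseteq>X. \<exists>Y'\<subseteq>Y. (\<Sum>p\<in>X\<times>Y. A p * (1 - B p / (8 * L)) ^ k) / 4 ^ k \<le> sum A (X' \<times> Y')" for A k
    using fin B u v
  proof (induction k arbitrary: X Y)
    case 0
    show ?case by (intro exI[of _ X] exI[of _ Y]) auto
  next
    case (Suc k)
    obtain X1 Y1 where 1: "X1 \<subseteq> X" "Y1 \<subseteq> Y" 
      "(\<Sum>p\<in>X\<times>Y. (A p * (1 - B p / (8 * L)) ^ k) * (1 - B p / (8 * L))) / 4 
        \<le> (\<Sum>p\<in>X1\<times>Y1. A p * (1 - B p / (8 * L)) ^ k)"
      using quarter_step[where B = B and u = u and v = v and d = d and A = "\<lambda>p. A p * (1 - B p / (8 * L)) ^ k",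
          OF Suc.prems(1,2) L Suc.prems(3,4,5)] by blast
    have f1: "finite X1" and f2: "finite Y1"
      using finite_subset[OF 1(1) Suc.prems(1)] finite_subset[OF 1(2) Suc.prems(2)] .
    have B1: "B (i,j) = (\<Sum>k<d. u i k * v j k)" if "i \<in> X1" "j \<in> Y1" for i j
      by (rule Suc.prems(3)) (use that 1 in auto)
    have u1: "(\<Sum>k<d. (u i k)\<^sup>2) \<le> L" if "i \<in> X1" for i
      by (rule Suc.prems(4)) (use that 1 in auto)
    have v1: "(\<Sum>k<d. (v i k)\<^sup>2) \<le> L" if "i \<in> Y1" for i
      by (rule Suc.prems(5)) (use that 1 in auto)
    from Suc.IH[OF f1 f2 B1 u1 v1] obtain X2 Y2 where 2: "X2 \<subseteq> X1" "Y2 \<subseteq> Y1"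
      "(\<Sum>p\<in>X1\<times>Y1. A p * (1 - B p / (8 * L)) ^ k) / 4 ^ k \<le> sum A (X2 \<times> Y2)"
      by blast
    have "(\<Sum>p\<in>X\<times>Y. A p * (1 - B p / (8 * L)) ^ Suc k) / 4 ^ Suc k
       = ((\<Sum>p\<in>X\<times>Y. (A p * (1 - B p / (8 * L)) ^ k) * (1 - B p / (8 * L))) / 4) / 4 ^ k"
      by (simp add: mult_ac)
    also have "\<dots> \<le> (\<Sum>p\<in>X1\<times>Y1. A p * (1 - B p / (8 * L)) ^ k) / 4 ^ k"
      using 1 by (intro divide_right_mono) auto
    also note 2(3)
    finally have "(\<Sum>p\<in>X\<times>Y. A p * (1 - B p / (8 * L)) ^ Suc k) / 4 ^ Suc k \<le> sum A (X2 \<times> Y2)" .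
    moreover have "X2 \<subseteq> X" "Y2 \<subseteq> Y" using 1 2 by auto
    ultimately show ?case by (intro exI[of _ X2] exI[of _ Y2] conjI)
  qed
  moreover have "\<bar>B p\<bar> \<le> L" if "p \<in> X \<times> Y" for p
    using that by (auto simp: B intro!: inner_bound u v)
  ultimately show ?thesis using L unfolding tiltable_def by blast
qed

section \<open>Factorizations and bases of low-rank matrices\<close>

text \<open>Rank at most \<open>r\<close> on a block, expressed by a factorization: this form passes
  directly to subblocks, and subtracting a constant adds one term.\<close>

definition lowrank :: "nat \<Rightarrow> 'a set \<Rightarrow> 'b set \<Rightarrow> ('a \<times> 'b \<Rightarrow> real) \<Rightarrow> bool" where
  "lowrank r X Y B \<longleftrightarrow> (\<exists>a b. \<forall>i\<in>X. \<forall>j\<in>Y. B (i,j) = (\<Sum>k<r. a i k * b k j))"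

lemma lowrank_subset: "lowrank r X Y B \<Longrightarrow> X' \<subseteq> X \<Longrightarrow> Y' \<subseteq> Y \<Longrightarrow> lowrank r X' Y' B"
  unfolding lowrank_def by blast

lemma lowrank_transpose: "lowrank r X Y B \<Longrightarrow> lowrank r Y X (\<lambda>(j,i). B (i,j))"
proof -
  assume "lowrank r X Y B"
  then obtain a b where ab: "\<And>i j. i\<in>X \<Longrightarrow> j\<in>Y \<Longrightarrow> B (i,j) = (\<Sum>k<r. a i k * b k j)"
    unfolding lowrank_def by blast
  show ?thesis unfolding lowrank_def
    by (rule exI[of _ "\<lambda>j k. b k j"], rule exI[of _ "\<lambda>k i. a i k"]) (auto simp: ab mult.commute)
qed

lemma lowrank_minus_const: 
  assumes "lowrank r X Y B" shows "lowrank (Suc r) X Y (\<lambda>p. B p - c)"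
proof -
  obtain a b where ab: "\<And>i j. i\<in>X \<Longrightarrow> j\<in>Y \<Longrightarrow> B (i,j) = (\<Sum>k<r. a i k * b k j)"
    using assms unfolding lowrank_def by blast
  show ?thesis unfolding lowrank_def
    by (rule exI[of _ "\<lambda>i k. if k = r then - c else a i k"], rule exI[of _ "\<lambda>k j. if k = r then 1 else b k j"]) 
      (auto simp: ab)
qed

definition orthonormal_or_zero :: "'b set \<Rightarrow> nat \<Rightarrow> (nat \<Rightarrow> 'b \<Rightarrow> real) \<Rightarrow> bool" where
  "orthonormal_or_zero Y r q \<longleftrightarrow>
     (\<forall>k<r. \<forall>l<r. k \<noteq> l \<longrightarrow> (\<Sum>j\<in>Y. q k j * q l j) = 0) \<and>
     (\<forall>k<r. (\<Sum>j\<in>Y. q k j * q k j) = 0 \<or> (\<Sum>j\<in>Y. q k j * q k j) = 1)"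

lemma gram_schmidt_functions:
  fixes b :: "nat \<Rightarrow> 'b \<Rightarrow> real"
  assumes fin: "finite Y"
  shows "\<exists>q c. orthonormal_or_zero Y r q \<and> (\<forall>l<r. \<forall>j\<in>Y. b l j = (\<Sum>k<r. c l k * q k j))"
proof (induction r)
  case 0 show ?case by (auto simp: orthonormal_or_zero_def)
next
  case (Suc r)
  then obtain q :: "nat \<Rightarrow> 'b \<Rightarrow> real" and c :: "nat \<Rightarrow> nat \<Rightarrow> real" where q: "orthonormal_or_zero Y r q"
    and rep: "\<And>l j. l < r \<Longrightarrow> j \<in> Y \<Longrightarrow> b l j = (\<Sum>k<r. c l k * q k j)"
    by blast
  have orth: "(\<Sum>j\<in>Y. q k j * q l j) = 0" if "k < r" "l < r" "k \<noteq> l" for k l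
    using q that unfolding orthonormal_or_zero_def by simp
  have nrm: "(\<Sum>j\<in>Y. q k j * q k j) = 0 \<or> (\<Sum>j\<in>Y. q k j * q k j) = 1" if "k < r" for k
    using q that unfolding orthonormal_or_zero_def by simp
  define \<alpha> where "\<alpha> k = (\<Sum>j\<in>Y. b r j * q k j)" for k
  define R where "R j = b r j - (\<Sum>k<r. \<alpha> k * q k j)" for j
  define s where "s = sqrt (\<Sum>j\<in>Y. R j * R j)"
  have s2: "s * s = (\<Sum>j\<in>Y. R j * R j)" unfolding s_def by (simp add: sum_nonneg)
  have s0: "R j = 0" if "s = 0" "j \<in> Y" for j
  proof -
    have "(\<Sum>j\<in>Y. R j * R j) = 0" using s2 that by simp
    then show ?thesis using that fin by (simp add: sum_nonneg_eq_0_iff)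
  qed
  have Rq: "(\<Sum>j\<in>Y. R j * q l j) = 0" if l: "l < r" for l
  proof -
    have "(\<Sum>j\<in>Y. R j * q l j) = \<alpha> l - (\<Sum>j\<in>Y. \<Sum>k<r. \<alpha> k * (q k j * q l j))"
      by (simp add: R_def \<alpha>_def algebra_simps sum_subtractf sum_distrib_left)
    also have "(\<Sum>j\<in>Y. \<Sum>k<r. \<alpha> k * (q k j * q l j)) = (\<Sum>k<r. \<alpha> k * (\<Sum>j\<in>Y. q k j * q l j))"
      by (subst sum.swap) (simp add: sum_distrib_left)
    also have "\<dots> = (\<Sum>k<r. if k = l then \<alpha> l * (\<Sum>j\<in>Y. q l j * q l j) else 0)"
      by (intro sum.cong) (auto simp: orth l)
    also have "\<dots> = \<alpha> l * (\<Sum>j\<in>Y. q l j * q l j)" using l by simp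
    finally have eq: "(\<Sum>j\<in>Y. R j * q l j) = \<alpha> l - \<alpha> l * (\<Sum>j\<in>Y. q l j * q l j)" .
    from nrm[OF l] show ?thesis
    proof
      assume z: "(\<Sum>j\<in>Y. q l j * q l j) = 0"
      then have "\<And>j. j \<in> Y \<Longrightarrow> q l j = 0" using fin by (simp add: sum_nonneg_eq_0_iff)
      then have "\<alpha> l = 0" unfolding \<alpha>_def by simp
      then show ?thesis using eq by simp
    qed (use eq in simp)
  qed
  \<comment> \<open>If the residual \<open>R\<close> vanishes on \<open>Y\<close>, then
    \<open>s = 0\<close> and division by zero yields the zero function, as intended.\<close>
  define q' where "q' k = (if k = r then (\<lambda>j. R j / s) else q k)" for k
  define c' where "c' l k = (if l = r then (if k = r then s else \<alpha> k) else if k = r then 0 else c l k)" for l k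
  show ?case unfolding orthonormal_or_zero_def
  proof (intro exI[of _ q'] exI[of _ c'] conjI allI impI ballI)
    fix k l assume kl: "k < Suc r" "l < Suc r" "k \<noteq> l"
    have *: "(\<Sum>j\<in>Y. R j / s * q l j) = 0" if "l < r" for l
      using Rq[OF that] by (simp add: sum_divide_distrib[symmetric])
    have **: "(\<Sum>j\<in>Y. q l j * (R j / s)) = 0" if "l < r" for l
      using *[OF that] by (simp add: mult.commute)
    show "(\<Sum>j\<in>Y. q' k j * q' l j) = 0"
      using kl * ** orth by (auto simp: q'_def less_Suc_eq)
  next
    fix k assume "k < Suc r"
    show "(\<Sum>j\<in>Y. q' k j * q' k j) = 0 \<or> (\<Sum>j\<in>Y. q' k j * q' k j) = 1"
    proof (cases "k = r")
      case True
      have "(\<Sum>j\<in>Y. q' k j * q' k j) = (s * s) / (s * s)"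
        by (simp add: True q'_def s2[symmetric] sum_divide_distrib[symmetric])
      then show ?thesis by (cases "s = 0") auto
    next
      case False then show ?thesis using \<open>k < Suc r\<close> nrm by (auto simp: q'_def)
    qed
  next
    fix l j assume l: "l < Suc r" and j: "j \<in> Y"
    show "b l j = (\<Sum>k<Suc r. c' l k * q' k j)"
    proof (cases "l = r")
      case True
      then show ?thesis using s0[OF _ j] by (auto simp: c'_def q'_def R_def)
    next
      case False
      then show ?thesis using l rep[OF _ j] by (auto simp: c'_def q'_def)
    qed
  qed
qed

text \<open>With the right factor orthonormal, the left factor has the same squared norm as
  \<open>B\<close>, at most \<open>W * card X * card Y\<close>, and the right one at most
  \<open>r\<close>. Moving a scalar \<open>m\<close> between them equalizes the average squared
  norms of rows and columns at \<open>sqrt (r * W)\<close>.\<close>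

lemma lowrank_factorization:
  fixes B :: "'a \<times> 'b \<Rightarrow> real" and W :: real
  assumes fin: "finite X" "finite Y" "X \<noteq> {}" "Y \<noteq> {}" and lr: "lowrank r X Y B" and r: "r \<ge> 1"
  assumes W: "W > 0" "(\<Sum>p\<in>X\<times>Y. (B p)\<^sup>2) \<le> W * (card X * card Y)"
  obtains u v where "\<And>i j. i \<in> X \<Longrightarrow> j \<in> Y \<Longrightarrow> B (i,j) = (\<Sum>k<r. u i k * v j k)"
    "(\<Sum>i\<in>X. \<Sum>k<r. (u i k)\<^sup>2) \<le> card X * sqrt (r * W)"
    "(\<Sum>j\<in>Y. \<Sum>k<r. (v j k)\<^sup>2) \<le> card Y * sqrt (r * W)"
proof -
  obtain a b where ab: "\<And>i j. i\<in>X \<Longrightarrow> j\<in>Y \<Longrightarrow> B (i,j) = (\<Sum>k<r. a i k * b k j)"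
    using lr unfolding lowrank_def by blast
  obtain q :: "nat \<Rightarrow> 'b \<Rightarrow> real" and c :: "nat \<Rightarrow> nat \<Rightarrow> real" where q: "orthonormal_or_zero Y r q"
    and rep: "\<And>l j. l < r \<Longrightarrow> j \<in> Y \<Longrightarrow> b l j = (\<Sum>k<r. c l k * q k j)"
    using gram_schmidt_functions[OF fin(2), of r b] by blast
  have orth: "(\<Sum>j\<in>Y. q k j * q l j) = 0" if "k < r" "l < r" "k \<noteq> l" for k l
    using q that unfolding orthonormal_or_zero_def by simp
  have nrm: "(\<Sum>j\<in>Y. q k j * q k j) = 0 \<or> (\<Sum>j\<in>Y. q k j * q k j) = 1" if "k < r" for k
    using q that unfolding orthonormal_or_zero_def by simp
  define N where "N k = (\<Sum>j\<in>Y. q k j * q k j)" for k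
  \<comment> \<open>The factor \<open>N k\<close>, which is \<open>0\<close> or \<open>1\<close>,
    removes coefficients on zero members of the family; otherwise the row norms of \<open>p\<close>
    could exceed those of \<open>B\<close>.\<close>
  define p where "p i k = (\<Sum>l<r. a i l * c l k) * N k" for i k
  have q0: "q k j = 0" if "N k = 0" "j \<in> Y" for k j
    using that fin(2) by (simp add: N_def sum_nonneg_eq_0_iff)
  have N: "N k = 0 \<or> N k = 1" if "k < r" for k using nrm[OF that] by (simp add: N_def)
  have Bpq: "B (i,j) = (\<Sum>k<r. p i k * q k j)" if "i \<in> X" "j \<in> Y" for i j
  proof -
    have "B (i,j) = (\<Sum>l<r. \<Sum>k<r. a i l * (c l k * q k j))"
      using that by (simp add: ab rep sum_distrib_left)
    also have "\<dots> = (\<Sum>k<r. \<Sum>l<r. a i l * (c l k * q k j))" by (rule sum.swap)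
    also have "\<dots> = (\<Sum>k<r. p i k * q k j)"
    proof (rule sum.cong[OF refl])
      fix k assume "k \<in> {..<r}"
      then show "(\<Sum>l<r. a i l * (c l k * q k j)) = p i k * q k j"
        using N[of k] q0[of k j] that by (auto simp: p_def sum_distrib_right mult.assoc)
    qed
    finally show ?thesis .
  qed
  have row: "(\<Sum>j\<in>Y. (B (i,j))\<^sup>2) = (\<Sum>k<r. (p i k)\<^sup>2)" if i: "i \<in> X" for i
  proof -
    have "(\<Sum>j\<in>Y. (B (i,j))\<^sup>2) = (\<Sum>j\<in>Y. \<Sum>k<r. \<Sum>l<r. (p i k * p i l) * (q k j * q l j))"
      using i by (intro sum.cong refl) (simp add: Bpq power2_eq_square sum_product mult_ac)
    also have "\<dots> = (\<Sum>k<r. \<Sum>l<r. (p i k * p i l) * (\<Sum>j\<in>Y. q k j * q l j))"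
      by (subst sum.swap, subst sum.swap) (simp add: sum_distrib_left)
    also have "\<dots> = (\<Sum>k<r. \<Sum>l<r. if l = k then p i k * p i k * N k else 0)"
      using orth by (intro sum.cong refl) (auto simp: N_def)
    also have "\<dots> = (\<Sum>k<r. (p i k)\<^sup>2)"
      by (intro sum.cong refl) (use N in \<open>auto simp: power2_eq_square p_def\<close>)
    finally show ?thesis .
  qed
  have sump: "(\<Sum>i\<in>X. \<Sum>k<r. (p i k)\<^sup>2) \<le> W * (card X * card Y)"
  proof -
    have "(\<Sum>p\<in>X\<times>Y. (B p)\<^sup>2) = (\<Sum>i\<in>X. \<Sum>j\<in>Y. (B (i,j))\<^sup>2)"
      by (simp add: sum.cartesian_product case_prod_unfold)
    then show ?thesis using W(2) row by simp
  qed
  have sumq: "(\<Sum>j\<in>Y. \<Sum>k<r. (q k j)\<^sup>2) \<le> r"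
  proof -
    have "(\<Sum>j\<in>Y. \<Sum>k<r. (q k j)\<^sup>2) = (\<Sum>k<r. N k)"
      by (subst sum.swap) (simp add: N_def power2_eq_square)
    also have "\<dots> \<le> (\<Sum>k<r. 1)" using N by (intro sum_mono) force
    finally show ?thesis by simp
  qed
  define s where "s = sqrt (r * W)"
  have s: "s > 0" "s * s = r * W" using r W by (auto simp: s_def)
  have cX: "real (card X) > 0" "real (card Y) > 0" using fin by (auto simp: card_gt_0_iff)
  \<comment> \<open>The solution of \<open>m^2 * W * card X * card Y = card X * s\<close>, which
    also gives \<open>r / m^2 = card Y * s\<close>.\<close>
  define m where "m = sqrt (s / (W * card Y))"
  have m: "m > 0" "m\<^sup>2 = s / (W * card Y)" using s cX W by (auto simp: m_def)
  show thesis
  proof (rule that[of "\<lambda>i k. m * p i k" "\<lambda>j k. q k j / m"])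
    show "B (i, j) = (\<Sum>k<r. m * p i k * (q k j / m))" if "i \<in> X" "j \<in> Y" for i j
      using m Bpq[OF that] by simp
    have "(\<Sum>i\<in>X. \<Sum>k<r. (m * p i k)\<^sup>2) = m\<^sup>2 * (\<Sum>i\<in>X. \<Sum>k<r. (p i k)\<^sup>2)"
      by (simp add: power_mult_distrib sum_distrib_left)
    also have "\<dots> \<le> m\<^sup>2 * (W * (card X * card Y))" by (intro mult_left_mono sump) auto
    also have "\<dots> = card X * s" using cX W by (simp add: m)
    finally show "(\<Sum>i\<in>X. \<Sum>k<r. (m * p i k)\<^sup>2) \<le> card X * sqrt (r * W)" by (simp add: s_def)
    have "(\<Sum>j\<in>Y. \<Sum>k<r. (q k j / m)\<^sup>2) = (\<Sum>j\<in>Y. \<Sum>k<r. (q k j)\<^sup>2) / m\<^sup>2"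
      by (simp add: power_divide sum_divide_distrib)
    also have "\<dots> \<le> r / m\<^sup>2" by (intro divide_right_mono sumq) auto
    also have "\<dots> = card Y * s" using s cX W by (simp add: m field_simps)
    finally show "(\<Sum>j\<in>Y. \<Sum>k<r. (q k j / m)\<^sup>2) \<le> card Y * sqrt (r * W)" by (simp add: s_def)
  qed
qed

section \<open>Markov's inequality and restriction to bounded factors\<close>

lemma card_le_markov:
  fixes f :: "'a \<Rightarrow> real" and s \<delta> :: real
  assumes fin: "finite X" and f: "\<And>i. i \<in> X \<Longrightarrow> f i \<ge> 0" and s: "sum f X \<le> card X * s" "s > 0" "\<delta> > 0"
  shows "(1 - \<delta>) * card X \<le> card {i\<in>X. f i \<le> s / \<delta>}"
proof -
  let ?b = "{i\<in>X. \<not> f i \<le> s / \<delta>}"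
  have "card ?b * (s / \<delta>) = (\<Sum>i\<in>?b. s / \<delta>)" by simp
  also have "\<dots> \<le> sum f ?b" by (intro sum_mono) auto
  also have "\<dots> \<le> sum f X" using fin f by (intro sum_mono2) auto
  finally have "card ?b * (s / \<delta>) \<le> card X * s" using s by linarith
  then have "s * card ?b \<le> s * (\<delta> * card X)" using s by (simp add: field_simps)
  then have "card ?b \<le> \<delta> * card X" using s by (simp add: mult_le_cancel_left)
  moreover have "card X = card {i\<in>X. f i \<le> s / \<delta>} + card ?b"
    using fin by (subst card_Un_disjoint[symmetric]) (auto intro: arg_cong[where f=card])
  ultimately show ?thesis by (simp add: algebra_simps)
qed

text \<open>The factorization bounds squared norms only on average. By Markov's inequality, those
  above \<open>sqrt (r * W) / \<delta>\<close> belong to at most a share \<open>\<delta>\<close> of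
  the rows and of the columns; these are discarded.\<close>

lemma tiltable_restriction:
  fixes B :: "'a \<times> 'b \<Rightarrow> real" and W \<delta> :: real
  assumes fin: "finite X" "finite Y" "X \<noteq> {}" "Y \<noteq> {}" and lr: "lowrank r X Y B" and r: "r \<ge> 1"
  assumes W: "W > 0" "(\<Sum>p\<in>X\<times>Y. (B p)\<^sup>2) \<le> W * (card X * card Y)"
  assumes \<delta>: "\<delta> > 0"
  obtains X1 Y1 where "X1 \<subseteq> X" "Y1 \<subseteq> Y" "(1 - \<delta>) * card X \<le> card X1" "(1 - \<delta>) * card Y \<le> card Y1"
    "tiltable X1 Y1 B (sqrt (r * W) / \<delta>)"
proof -
  show thesis
  proof (rule lowrank_factorization[OF fin lr r W])
    fix u v
    assume uv: "\<And>i j. i \<in> X \<Longrightarrow> j \<in> Y \<Longrightarrow> B (i,j) = (\<Sum>k<r. u i k * v j k)"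
      and u: "(\<Sum>i\<in>X. \<Sum>k<r. (u i k)\<^sup>2) \<le> card X * sqrt (r * W)"
      and v: "(\<Sum>j\<in>Y. \<Sum>k<r. (v j k)\<^sup>2) \<le> card Y * sqrt (r * W)"
  define L where "L = sqrt (r * W) / \<delta>"
  have s: "sqrt (r * W) > 0" using r W by simp
  show thesis
  proof (rule that)
    show "{i\<in>X. (\<Sum>k<r. (u i k)\<^sup>2) \<le> L} \<subseteq> X" "{j\<in>Y. (\<Sum>k<r. (v j k)\<^sup>2) \<le> L} \<subseteq> Y" by auto
    show "(1 - \<delta>) * card X \<le> card {i\<in>X. (\<Sum>k<r. (u i k)\<^sup>2) \<le> L}"
      unfolding L_def by (rule card_le_markov[OF fin(1) _ u s \<delta>]) (auto intro: sum_nonneg)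
    show "(1 - \<delta>) * card Y \<le> card {j\<in>Y. (\<Sum>k<r. (v j k)\<^sup>2) \<le> L}"
      unfolding L_def by (rule card_le_markov[OF fin(2) _ v s \<delta>]) (auto intro: sum_nonneg)
    show "tiltable {i\<in>X. (\<Sum>k<r. (u i k)\<^sup>2) \<le> L} {j\<in>Y. (\<Sum>k<r. (v j k)\<^sup>2) \<le> L} B (sqrt (r * W) / \<delta>)"
      unfolding L_def[symmetric]
      by (rule tiltable_if_bounded_factors[where u = u and v = v and d = r]) (use fin uv s \<delta> in \<open>auto simp: L_def\<close>)
  qed
  qed
qed

section \<open>Minors, bounded bases and zero blocks\<close>

lemma lowrank_minor_zero:
  fixes B :: "'a \<times> 'b \<Rightarrow> real"
  assumes lr: "lowrank r X Y B" and s: "r < s" and f: "\<And>p. p < s \<Longrightarrow> f p \<in> X" and g: "\<And>p. p < s \<Longrightarrow> g p \<in> Y"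
  shows "det (mat s s (\<lambda>(p,q). B (f p, g q))) = 0"
proof -
  obtain a b where ab: "\<And>i j. i\<in>X \<Longrightarrow> j\<in>Y \<Longrightarrow> B (i,j) = (\<Sum>k<r. a i k * b k j)"
    using lr unfolding lowrank_def by blast
  \<comment> \<open>Both factors are padded with zeros to size \<open>s\<close>. Since
    \<open>r < s\<close>, column \<open>r\<close> of \<open>A1\<close> is zero.\<close>
  define A1 where "A1 = mat s s (\<lambda>(p,k). if k < r then a (f p) k else 0)"
  define A2 where "A2 = mat s s (\<lambda>(k,q). if k < r then b k (g q) else 0)"
  have "mat s s (\<lambda>(p,q). B (f p, g q)) = A1 * A2"
  proof (rule eq_matI)
    fix p q assume "p < dim_row (A1 * A2)" "q < dim_col (A1 * A2)"
    then have pq: "p < s" "q < s" by (auto simp: A1_def A2_def)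
    have "(A1 * A2) $$ (p,q) = (\<Sum>k\<in>{0..<s}. (if k < r then a (f p) k else 0) * (if k < r then b k (g q) else 0))"
      using pq by (simp add: A1_def A2_def times_mat_def scalar_prod_def)
    also have "\<dots> = (\<Sum>k<r. a (f p) k * b k (g q))"
      using s by (intro sum.mono_neutral_cong_right) auto
    finally show "mat s s (\<lambda>(p,q). B (f p, g q)) $$ (p,q) = (A1 * A2) $$ (p,q)"
      using pq f g by (simp add: ab)
  qed (auto simp: A1_def A2_def)
  then have "det (mat s s (\<lambda>(p,q). B (f p, g q))) = det A1 * det A2"
    by (simp add: det_mult[of _ s] A1_def A2_def)
  also have "det A1 = (\<Sum>i<s. A1 $$ (i,r) * cofactor A1 i r)"
    by (rule laplace_expansion_column) (auto simp: A1_def s)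
  also have "\<dots> = 0" using s by (simp add: A1_def)
  finally show ?thesis by simp
qed

text \<open>The basis columns are those of a nonsingular minor of maximal order and, for its row set,
  maximal absolute determinant; the coefficients are the ratios given by expanding the bordered
  minor, which vanishes.\<close>

lemma lowrank_bounded_basis:
  fixes B :: "'a \<times> 'b \<Rightarrow> real"
  assumes fin: "finite Y" and lr: "lowrank r X Y B"
  obtains s and g :: "nat \<Rightarrow> 'b" and c where "s \<le> r" "\<And>q. q < s \<Longrightarrow> g q \<in> Y"
    "\<And>j q. j \<in> Y \<Longrightarrow> q < s \<Longrightarrow> \<bar>c j q\<bar> \<le> 1"
    "\<And>i j. i \<in> X \<Longrightarrow> j \<in> Y \<Longrightarrow> B (i,j) = (\<Sum>q<s. c j q * B (i, g q))"
proof -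
  define D where "D s f g = det (mat s s (\<lambda>(p,q). B (f p, g q)))" for s and f :: "nat \<Rightarrow> 'a" and g :: "nat \<Rightarrow> 'b"
  define good where "good s \<longleftrightarrow> (\<exists>f g. (\<forall>p<s. f p \<in> X) \<and> (\<forall>p<s. g p \<in> Y) \<and> D s f g \<noteq> 0)" for s
  have le: "s \<le> r" if "good s" for s
    using that lowrank_minor_zero[OF lr, of s] unfolding good_def D_def by (meson not_le)
  have "good 0" unfolding good_def D_def by simp
  define s where "s = Greatest good"
  have s: "good s" unfolding s_def by (rule GreatestI_nat[where P = good, OF \<open>good 0\<close> le])
  have ns: "\<not> good (Suc s)"
    using Greatest_le_nat[of good "Suc s" r] le by (auto simp: s_def)
  from s obtain f g1 where f: "\<And>p. p < s \<Longrightarrow> f p \<in> X" and g1: "\<And>p. p < s \<Longrightarrow> g1 p \<in> Y" and D1: "D s f g1 \<noteq> 0"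
    unfolding good_def by blast
  have Dcong: "D s f g = D s f g'" if "\<And>q. q < s \<Longrightarrow> g q = g' q" for g g'
    unfolding D_def by (rule arg_cong[where f = det]) (auto simp: that)
  define Z where "Z = (\<lambda>g. \<bar>D s f g\<bar>) ` ({..<s} \<rightarrow>\<^sub>E Y)"
  have Z: "finite Z" unfolding Z_def using fin by (intro finite_imageI finite_PiE) auto
  have inZ: "\<bar>D s f g\<bar> \<in> Z" if "\<And>q. q < s \<Longrightarrow> g q \<in> Y" for g
    unfolding Z_def using that Dcong[of g "restrict g {..<s}"] by (intro image_eqI[of _ _ "restrict g {..<s}"]) auto
  have "Z \<noteq> {}" using inZ[OF g1] by auto
  then have "Max Z \<in> Z" using Z by (intro Max_in)
  then obtain g0 where g0: "\<And>q. q < s \<Longrightarrow> g0 q \<in> Y" "\<bar>D s f g0\<bar> = Max Z"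
    unfolding Z_def by (fastforce simp: PiE_iff)
  have Dmax: "\<bar>D s f g\<bar> \<le> \<bar>D s f g0\<bar>" if "\<And>q. q < s \<Longrightarrow> g q \<in> Y" for g
    unfolding g0 using Z inZ[OF that] by (intro Max_ge)
  have D0: "D s f g0 \<noteq> 0" using Dmax[OF g1] D1 by auto
  \<comment> \<open>The column list \<open>g0\<close> with \<open>j\<close> appended and position
    \<open>q\<close> deleted: the columns left in the cofactor of the last row of the bordered
    minor.\<close>
  define h where "h j q = (\<lambda>q'. (g0(s := j)) (if q' < q then q' else Suc q'))" for j q
  define c where "c j q = - ((-1)^(s+q) * D s f (h j q)) / D s f g0" for j q
  show thesis
  proof (rule that[of s g0 c])
    show "s \<le> r" by (rule le[OF s])
    show "g0 q \<in> Y" if "q < s" for q by (rule g0(1)[OF that])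
    show "\<bar>c j q\<bar> \<le> 1" if j: "j \<in> Y" and q: "q < s" for j q
    proof -
      have "\<bar>D s f (h j q)\<bar> \<le> \<bar>D s f g0\<bar>"
        by (rule Dmax) (use j q g0(1) in \<open>auto simp: h_def\<close>)
      then show ?thesis using D0 by (simp add: c_def abs_mult power_abs)
    qed
    show "B (i,j) = (\<Sum>q<s. c j q * B (i, g0 q))" if i: "i \<in> X" and j: "j \<in> Y" for i j
    proof -
      define A where "A = mat (Suc s) (Suc s) (\<lambda>(p,q). B ((f(s := i)) p, (g0(s := j)) q))"
      have A: "A \<in> carrier_mat (Suc s) (Suc s)" by (simp add: A_def)
      have "det A = 0"
      proof (rule ccontr)
        assume "det A \<noteq> 0"
        then have "good (Suc s)" unfolding good_def
          by (intro exI[of _ "f(s := i)"] exI[of _ "g0(s := j)"]) (use i j f g0(1) in \<open>auto simp: D_def A_def less_Suc_eq\<close>)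
        with ns show False by simp
      qed
      moreover have "det A = (\<Sum>q<Suc s. A $$ (s,q) * cofactor A s q)"
        by (rule laplace_expansion_row[OF A]) simp
      moreover have "cofactor A s q = (-1)^(s+q) * D s f (h j q)" if q: "q < Suc s" for q
      proof -
        have "mat_delete A s q = mat s s (\<lambda>(p,q'). B (f p, h j q q'))"
          unfolding mat_delete_def A_def by (rule eq_matI) (auto simp: h_def)
        then show ?thesis by (simp add: cofactor_def D_def)
      qed
      moreover have "A $$ (s,q) = B (i, (g0(s := j)) q)" if "q < Suc s" for q
        using that by (simp add: A_def)
      ultimately have "0 = (\<Sum>q<s. B (i, g0 q) * ((-1)^(s+q) * D s f (h j q))) + B (i,j) * ((-1)^(s+s) * D s f (h j s))"
        by (simp cong: sum.cong_simp)
      \<comment> \<open>Deleting the appended column gives back the nonsingular minor, so the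
        expansion can be solved for \<open>B (i,j)\<close>.\<close>
      moreover have "D s f (h j s) = D s f g0" by (rule Dcong) (auto simp: h_def)
      moreover have "(-1::real)^(s+s) = 1" by (simp flip: mult_2)
      ultimately have "B (i,j) * D s f g0 = - (\<Sum>q<s. B (i, g0 q) * ((-1)^(s+q) * D s f (h j q)))"
        by simp
      then have "B (i,j) = - (\<Sum>q<s. B (i, g0 q) * ((-1)^(s+q) * D s f (h j q))) / D s f g0"
        using D0 by (simp add: field_simps)
      also have "\<dots> = (\<Sum>q<s. c j q * B (i, g0 q))"
        unfolding c_def by (simp add: sum_negf[symmetric] sum_divide_distrib mult_ac)
      finally show ?thesis .
    qed
  qed
qed

text \<open>Keep the rows with at most \<open>card Y / (2 * r)\<close> nonzero entries, at least
  half of all. At most \<open>r\<close> of them span the others, and these have nonzero entries in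
  at most half of the columns. Outside those columns every kept row vanishes.\<close>

lemma lowrank_sparse_zero_block:
  fixes B :: "'a \<times> 'b \<Rightarrow> real"
  assumes fin: "finite X" "finite Y" "Y \<noteq> {}" and lr: "lowrank r X Y B" and r: "r \<ge> 1"
  assumes few: "4 * real r * card {p\<in>X\<times>Y. B p \<noteq> 0} \<le> card X * card Y"
  obtains X' Y' where "X' \<subseteq> X" "Y' \<subseteq> Y" "card X \<le> 2 * card X'" "card Y \<le> 2 * card Y'"
    "\<And>p. p \<in> X' \<times> Y' \<Longrightarrow> B p = 0"
proof -
  define z where "z i = card {j\<in>Y. B (i,j) \<noteq> 0}" for i
  have "card {p\<in>X\<times>Y. B p \<noteq> 0} = card (SIGMA i:X. {j\<in>Y. B (i,j) \<noteq> 0})"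
    by (rule arg_cong[where f=card]) auto
  also have "\<dots> = (\<Sum>i\<in>X. z i)" using fin by (simp add: z_def card_SigmaI)
  finally have Z: "card {p\<in>X\<times>Y. B p \<noteq> 0} = (\<Sum>i\<in>X. z i)" .
  define s where "s = card Y / (4 * real r)"
  have cY: "card Y > 0" using fin by (simp add: card_gt_0_iff)
  have s: "s > 0" using cY r by (simp add: s_def)
  have "(\<Sum>i\<in>X. real (z i)) \<le> card X * s"
    using few r by (simp add: s_def Z field_simps)
  then have mk: "(1 - 1/2) * card X \<le> card {i\<in>X. real (z i) \<le> s / (1/2)}"
    by (intro card_le_markov fin(1) s) auto
  define X' where "X' = {i\<in>X. real (z i) \<le> s / (1/2)}"
  have X': "X' \<subseteq> X" by (auto simp: X'_def)
  have "finite X'" using X' fin finite_subset by blast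
  define B' where "B' = (\<lambda>(j,i). B (i,j))"
  have "lowrank r Y X' B'" unfolding B'_def
    by (rule lowrank_transpose[OF lowrank_subset[OF lr X' order_refl]])
  then show thesis
  proof (rule lowrank_bounded_basis[OF \<open>finite X'\<close>])
    fix t g c assume t: "t \<le> r" and g: "\<And>q. q < t \<Longrightarrow> g q \<in> X'"
      and c: "\<And>j i. j \<in> Y \<Longrightarrow> i \<in> X' \<Longrightarrow> B' (j,i) = (\<Sum>q<t. c i q * B' (j, g q))"
    define bad where "bad = (\<Union>q<t. {j\<in>Y. B (g q, j) \<noteq> 0})"
    have "real (card bad) \<le> (\<Sum>q<t. real (z (g q)))"
      unfolding bad_def z_def using card_UN_le[of "{..<t}" "\<lambda>q. {j\<in>Y. B (g q, j) \<noteq> 0}"]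
      by (simp flip: of_nat_sum)
    also have "\<dots> \<le> (\<Sum>q<t. 2 * s)" by (intro sum_mono) (use g in \<open>auto simp: X'_def mult.commute\<close>)
    also have "\<dots> = t * (2 * s)" by simp
    also have "\<dots> \<le> r * (2 * s)" using t s by (intro mult_right_mono) auto
    also have "\<dots> = card Y / 2" using r by (simp add: s_def)
    finally have bad: "real (card bad) \<le> card Y / 2" .
    have badY: "bad \<subseteq> Y" by (auto simp: bad_def)
    show thesis
    proof (rule that[of X' "Y - bad"])
      show "X' \<subseteq> X" "Y - bad \<subseteq> Y" using X' by auto
      show "card X \<le> 2 * card X'" using mk by (simp add: X'_def)
      have "card (Y - bad) = card Y - card bad" using badY fin finite_subset by (intro card_Diff_subset) blast+
      then show "card Y \<le> 2 * card (Y - bad)" using bad by linarith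
      fix p assume "p \<in> X' \<times> (Y - bad)"
      then obtain i j where p: "p = (i,j)" "i \<in> X'" "j \<in> Y" "j \<notin> bad" by auto
      then have "B (g q, j) = 0" if "q < t" for q using that by (auto simp: bad_def)
      then show "B p = 0" using c[OF p(3,2)] p(1) by (simp add: B'_def)
    qed
  qed
qed

section \<open>Tilted distributions\<close>

definition avg :: "'p set \<Rightarrow> ('p \<Rightarrow> real) \<Rightarrow> real" where
  "avg S f = sum f S / card S"

definition avgvar :: "'p set \<Rightarrow> ('p \<Rightarrow> real) \<Rightarrow> real" where
  "avgvar S M = avg S (\<lambda>p. (M p - avg S M)\<^sup>2)"

definition potential :: "'p set \<Rightarrow> ('p \<Rightarrow> real) \<Rightarrow> real" where
  "potential S M = avg S M + sqrt (avgvar S M)"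

lemma avg_mono: "(\<And>p. p \<in> S \<Longrightarrow> f p \<le> g p) \<Longrightarrow> avg S f \<le> avg S g"
  unfolding avg_def by (intro divide_right_mono sum_mono) auto

lemma avg_nonneg: "(\<And>p. p \<in> S \<Longrightarrow> 0 \<le> f p) \<Longrightarrow> 0 \<le> avg S f"
  unfolding avg_def by (intro divide_nonneg_nonneg sum_nonneg) auto

lemma avg_add: "avg S (\<lambda>p. f p + g p) = avg S f + avg S g"
  by (simp add: avg_def sum.distrib add_divide_distrib)

lemma avg_diff: "avg S (\<lambda>p. f p - g p) = avg S f - avg S g"
  by (simp add: avg_def sum_subtractf diff_divide_distrib)

lemma avg_cmult: "avg S (\<lambda>p. c * f p) = c * avg S f"
  by (simp add: avg_def sum_distrib_left)

lemma avg_const: "finite S \<Longrightarrow> S \<noteq> {} \<Longrightarrow> avg S (\<lambda>p. c) = c"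
  by (simp add: avg_def)

lemma avgvar_nonneg: "0 \<le> avgvar S M"
  unfolding avgvar_def by (rule avg_nonneg) auto

lemma avg_square_shift:
  assumes "finite S" "S \<noteq> {}"
  shows "avg S (\<lambda>p. (M p - a)\<^sup>2) = avgvar S M + (avg S M - a)\<^sup>2"
proof -
  define m where "m = avg S M"
  have "avg S (\<lambda>p. (M p - a)\<^sup>2) = avg S (\<lambda>p. ((M p - m)\<^sup>2 + (2 * (m - a)) * M p) + (a\<^sup>2 - m\<^sup>2))"
    unfolding avg_def by (intro arg_cong2[where f = "(/)"] sum.cong refl) (simp add: power2_eq_square algebra_simps)
  also have "\<dots> = avgvar S M + 2 * (m - a) * m + (a\<^sup>2 - m\<^sup>2)"
    by (simp only: avg_add avg_cmult avg_const[OF assms] avgvar_def m_def)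
  finally show ?thesis by (simp add: m_def power2_eq_square algebra_simps)
qed

lemma avgvar_le: "finite S \<Longrightarrow> S \<noteq> {} \<Longrightarrow> avgvar S M \<le> avg S (\<lambda>p. (M p - a)\<^sup>2)"
  by (simp add: avg_square_shift)

lemma potential_nonneg: "(\<And>p. p \<in> S \<Longrightarrow> 0 \<le> M p) \<Longrightarrow> 0 \<le> potential S M"
  unfolding potential_def by (intro add_nonneg_nonneg avg_nonneg) (auto simp: avgvar_nonneg)

text \<open>\<open>E k\<close> below is the expectation under probabilities proportional to
  \<open>weight p ^ k\<close>, the factor in \<open>tiltable\<close> for \<open>M - c\<close>. The
  product structure is dropped: the evolution of mean and variance depends only on the entries lying
  within \<open>L\<close> of \<open>c\<close>.\<close>

locale tilting =
  fixes P :: "'p set" and M :: "'p \<Rightarrow> real" and c L :: real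
  assumes fin: "finite P" and ne: "P \<noteq> {}" and L: "L > 0"
    and bounded: "\<And>p. p \<in> P \<Longrightarrow> \<bar>M p - c\<bar> \<le> L"
begin

definition weight where "weight p = 1 - (M p - c) / (8 * L)"
definition total where "total k = (\<Sum>p\<in>P. weight p ^ k)"
definition E where "E k f = (\<Sum>p\<in>P. f p * weight p ^ k) / total k"
definition mean where "mean k = E k M"
definition var where "var k = E k (\<lambda>p. (M p - mean k)\<^sup>2)"

lemma weight_ge: "p \<in> P \<Longrightarrow> 7/8 \<le> weight p"
  using bounded[of p] L by (simp add: weight_def field_simps)

lemma weight_pos: "p \<in> P \<Longrightarrow> 0 < weight p"
  using weight_ge[of p] by linarith

lemma total_ge: "(7/8)^k * card P \<le> total k"
proof -
  have "(\<Sum>p\<in>P. (7/8)^k) \<le> total k"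
    unfolding total_def by (intro sum_mono power_mono weight_ge) auto
  then show ?thesis by (simp add: mult.commute)
qed

lemma total_pos: "0 < total k"
  unfolding total_def using fin ne weight_pos by (intro sum_pos) auto

lemma E_mono: "(\<And>p. p \<in> P \<Longrightarrow> f p \<le> g p) \<Longrightarrow> E k f \<le> E k g"
  unfolding E_def using total_pos[of k] weight_pos
  by (intro divide_right_mono sum_mono mult_right_mono) (auto intro: less_imp_le)

lemma E_add: "E k (\<lambda>p. f p + g p) = E k f + E k g"
  by (simp add: E_def sum.distrib add_divide_distrib algebra_simps)

lemma E_diff: "E k (\<lambda>p. f p - g p) = E k f - E k g"
  by (simp add: E_def sum_subtractf diff_divide_distrib algebra_simps)

lemma E_cmult: "E k (\<lambda>p. a * f p) = a * E k f"
  by (simp add: E_def sum_distrib_left mult_ac)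

lemma E_const: "E k (\<lambda>p. a) = a"
  using total_pos[of k] by (simp add: E_def total_def sum_distrib_left[symmetric])

lemma E_square_shift: "E k (\<lambda>p. (M p - a)\<^sup>2) = var k + (mean k - a)\<^sup>2"
proof -
  define m where "m = mean k"
  have "E k (\<lambda>p. (M p - a)\<^sup>2) = E k (\<lambda>p. ((M p - m)\<^sup>2 + (2 * (m - a)) * M p) + (a\<^sup>2 - m\<^sup>2))"
    unfolding E_def by (intro arg_cong2[where f = "(/)"] sum.cong refl) (simp add: power2_eq_square algebra_simps)
  also have "\<dots> = var k + 2 * (m - a) * m + (a\<^sup>2 - m\<^sup>2)"
    by (simp only: E_add E_cmult E_const var_def m_def mean_def)
  finally show ?thesis by (simp add: m_def power2_eq_square algebra_simps)
qed

lemma var_nonneg: "0 \<le> var k"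
  using E_mono[of "\<lambda>_. 0" "\<lambda>p. (M p - mean k)\<^sup>2" k] by (simp add: E_const var_def)

lemma mean_bounded: "\<bar>mean k - c\<bar> \<le> L"
proof -
  have "E k M \<le> E k (\<lambda>_. c + L)" "E k (\<lambda>_. c - L) \<le> E k M"
    using bounded by (auto intro!: E_mono simp: abs_le_iff algebra_simps)
  then show ?thesis by (simp add: E_const mean_def)
qed

lemma sqrt_var_le: "sqrt (var k) \<le> L"
proof -
  have "var k \<le> E k (\<lambda>p. (M p - c)\<^sup>2)" by (simp add: E_square_shift)
  also have "\<dots> \<le> E k (\<lambda>_. L\<^sup>2)" 
    using bounded L by (intro E_mono) (simp add: abs_le_square_iff[symmetric])
  finally show ?thesis using L by (simp add: E_const real_le_lsqrt var_nonneg)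
qed

text \<open>The weights are affine in the entries, so one more tilting step lowers the mean by
  exactly the variance divided by \<open>8 L\<close>, up to normalization.\<close>

lemma mean_drop: "var k / (9 * L) \<le> mean k - mean (Suc k)"
proof -
  define m where "m = mean k"
  \<comment> \<open>The average weight, equal to \<open>total (Suc k) / total k\<close>. Its bound
    \<open>9/8\<close> turns \<open>8 * L\<close> into the \<open>9 * L\<close> of the
    conclusion.\<close>
  define q where "q = 1 - (m - c) / (8 * L)"
  have q: "0 < q" "q \<le> 9/8" using mean_bounded[of k] L by (auto simp: q_def m_def field_simps abs_le_iff)
  have T: "total (Suc k) = total k * q"
  proof -
    have "total (Suc k) / total k = E k weight" by (simp add: total_def E_def)
    also have "\<dots> = E k (\<lambda>p. 1 + c / (8 * L) - (1 / (8 * L)) * M p)"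
      by (rule arg_cong[where f = "E k"]) (simp add: weight_def fun_eq_iff diff_divide_distrib)
    also have "\<dots> = q" unfolding E_diff E_const E_cmult by (simp add: q_def m_def mean_def diff_divide_distrib)
    finally show ?thesis using total_pos[of k] by (simp add: field_simps)
  qed
  have "mean (Suc k) = (\<Sum>p\<in>P. M p * weight p * weight p ^ k) / (total k * q)"
    by (simp add: mean_def E_def T mult.assoc)
  also have "\<dots> = E k (\<lambda>p. M p * weight p) / q" by (simp add: E_def)
  also have "E k (\<lambda>p. M p * weight p) = E k (\<lambda>p. q * M p + (m / (8 * L)) * M p - (1 / (8 * L)) * (M p - 0)\<^sup>2)"
    by (rule arg_cong[where f = "E k"]) (use L in \<open>auto simp: weight_def q_def field_simps power2_eq_square\<close>)
  also have "\<dots> = q * m + (m / (8 * L)) * m - (1 / (8 * L)) * (var k + (m - 0)\<^sup>2)"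
    unfolding E_diff E_add E_cmult E_square_shift by (simp add: m_def mean_def)
  also have "\<dots> = q * m - var k / (8 * L)" by (simp add: power2_eq_square algebra_simps)
  finally have "m - mean (Suc k) = var k / (8 * L * q)" using q L by (simp add: field_simps)
  moreover have "var k / (9 * L) \<le> var k / (8 * L * q)"
    using q L var_nonneg[of k] by (intro divide_left_mono) auto
  ultimately show ?thesis by (simp add: m_def)
qed

lemma mean_antimono: "mean (Suc k) \<le> mean k"
  using mean_drop[of k] var_nonneg[of k] L by (smt (verit) divide_nonneg_pos)

text \<open>A discrete Riccati inequality: as long as the conclusion fails, \<open>z = T - mean k\<close> satisfies
  \<open>z' \<ge> z + z\<^sup>2 / (9 L)\<close>, which blows up after about \<open>10 L / x\<close> steps.\<close>

lemma mean_plus_sd_decreases: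
  fixes K :: nat and x T :: real
  assumes x: "x > 0" "mean k0 + x \<le> T" and K: "10 * L \<le> K * x"
  obtains k where "k0 \<le> k" "k \<le> k0 + K" "mean k + sqrt (var k) \<le> T"
proof (rule ccontr)
  assume "\<not> thesis"
  then have big: "T - mean k < sqrt (var k)" if "k0 \<le> k" "k \<le> k0 + K" for k
    using that \<open>\<And>k. k0 \<le> k \<Longrightarrow> k \<le> k0 + K \<Longrightarrow> mean k + sqrt (var k) \<le> T \<Longrightarrow> thesis\<close> by force
  \<comment> \<open>The reciprocal linearizes the recursion:
    \<open>1 / (z + z^2 / (9 * L)) = 1 / z - 1 / (9 * L + z)\<close>, and
    \<open>z < sqrt (var k) \<le> L\<close>, so each step lowers it by at least
    \<open>1 / (10 * L)\<close>. After \<open>K\<close> steps it would be nonpositive.\<close>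
  have "x \<le> T - mean (k0 + i) \<and> 1 / (T - mean (k0 + i)) \<le> 1 / x - i / (10 * L)" if "i \<le> K" for i
    using that
  proof (induction i)
    case 0
    then show ?case using x by (auto intro: divide_left_mono)
  next
    case (Suc i)
    define z where "z = T - mean (k0 + i)"
    define z' where "z' = T - mean (k0 + Suc i)"
    have z: "x \<le> z" "1 / z \<le> 1 / x - i / (10 * L)" "z > 0" using Suc x by (auto simp: z_def)
    have zv: "z < sqrt (var (k0 + i))" using big[of "k0 + i"] Suc.prems by (simp add: z_def)
    then have zL: "z \<le> L" using sqrt_var_le[of "k0 + i"] by linarith
    have "z\<^sup>2 \<le> var (k0 + i)" using power_mono[of z "sqrt (var (k0 + i))" 2] zv z var_nonneg[of "k0 + i"] by simp
    then have "z\<^sup>2 / (9 * L) \<le> var (k0 + i) / (9 * L)" using L by (intro divide_right_mono) auto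
    with mean_drop[of "k0 + i"] have z': "z + z\<^sup>2 / (9 * L) \<le> z'" by (simp add: z_def z'_def)
    have zz: "0 < z + z\<^sup>2 / (9 * L)" using z L by (intro add_pos_nonneg) auto
    have "1 / z' \<le> 1 / (z + z\<^sup>2 / (9 * L))" using z' zz by (intro divide_left_mono) auto
    also have "\<dots> = 1 / z - 1 / (9 * L + z)" using z L by (simp add: field_simps power2_eq_square)
    also have "\<dots> \<le> 1 / z - 1 / (10 * L)" using zL z L by (intro diff_left_mono divide_left_mono) auto
    also have "\<dots> \<le> 1 / x - Suc i / (10 * L)" using z by (simp add: add_divide_distrib)
    finally have "1 / z' \<le> 1 / x - Suc i / (10 * L)" .
    moreover have "x \<le> z'" using z z' L by (smt (verit) divide_nonneg_pos zero_le_power2)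
    ultimately show ?case by (simp add: z'_def)
  qed
  from this[of K] have *: "x \<le> T - mean (k0 + K)" "1 / (T - mean (k0 + K)) \<le> 1 / x - K / (10 * L)" by auto
  moreover have "1 / x - K / (10 * L) \<le> 0" using K x L by (simp add: field_simps)
  moreover have "0 < 1 / (T - mean (k0 + K))" using * x by simp
  ultimately show False by linarith
qed

text \<open>The drops of the mean telescope and, since the entries are nonnegative, total at most
  \<open>mean 0\<close>; so among \<open>K\<close> steps one has at most the average drop.\<close>

lemma small_var_exists:
  fixes K :: nat
  assumes M: "\<And>p. p \<in> P \<Longrightarrow> 0 \<le> M p" and K: "K > 0"
  obtains k where "k < K" "var k \<le> 9 * L * mean 0 / K" "mean k \<le> mean 0"
proof -
  have drop: "(\<Sum>i<n. var i / (9 * L)) \<le> mean 0 - mean n" for n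
  proof (induction n)
    case (Suc n) then show ?case using mean_drop[of n] by simp
  qed simp
  have anti: "mean n \<le> mean 0" for n
  proof (induction n)
    case (Suc n) then show ?case using mean_antimono[of n] by simp
  qed simp
  have "0 \<le> mean K" using E_mono[of "\<lambda>_. 0" M K] M by (simp add: E_const mean_def)
  with drop[of K] have D: "(\<Sum>i<K. var i / (9 * L)) \<le> mean 0" by linarith
  have "\<exists>k<K. var k \<le> 9 * L * mean 0 / K"
  proof (rule ccontr)
    assume "\<not> ?thesis"
    then have "9 * L * mean 0 / K < var k" if "k < K" for k using that by force
    then have "(\<Sum>i<K. mean 0 / K) < (\<Sum>i<K. var i / (9 * L))"
      using K L by (intro sum_strict_mono) (auto simp: field_simps)
    then show False using D K by simp
  qed
  then show thesis using that anti by blast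
qed

end

text \<open>A functional with tilted expectation at least \<open>s\<close> has a large positive sum
  on some block. Since \<open>A\<close> is at most \<open>H\<close>, that sum also bounds the size
  of the block from below. Per step, the quarter from \<open>tiltable\<close> and the minimal weight
  \<open>7/8\<close> multiply to \<open>7/32\<close>, rounded down to \<open>1/5\<close>.\<close>

lemma tiltable_realize:
  fixes A :: "'a \<times> 'b \<Rightarrow> real"
  assumes XY: "finite X" "finite Y" "X \<noteq> {}" "Y \<noteq> {}" and tl: "tiltable X Y (\<lambda>p. M p - c) L"
  assumes s: "s > 0" "s \<le> tilting.E (X \<times> Y) M c L k A" and H: "\<And>p. p \<in> X \<times> Y \<Longrightarrow> A p \<le> H"
  obtains X' Y' where "X' \<subseteq> X" "Y' \<subseteq> Y" "X' \<noteq> {}" "Y' \<noteq> {}" "sum A (X' \<times> Y') > 0"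
    "s / H * (card X * card Y) / 5 ^ k \<le> card X' * card Y'"
proof -
  interpret tilting "X \<times> Y" M c L
    using XY tl by unfold_locales (auto simp: tiltable_def)
  obtain X' Y' where XY': "X' \<subseteq> X" "Y' \<subseteq> Y"
    and sm: "(\<Sum>p\<in>X\<times>Y. A p * (1 - (M p - c) / (8 * L)) ^ k) / 4 ^ k \<le> sum A (X' \<times> Y')"
    using tl unfolding tiltable_def by blast
  have N: "0 < card (X \<times> Y)" using XY by (simp add: card_gt_0_iff)
  have "(\<Sum>p\<in>X\<times>Y. A p * (1 - (M p - c) / (8 * L)) ^ k) = total k * E k A"
    using total_pos[of k] by (simp add: E_def weight_def)
  with sm have sm: "total k * E k A / 4 ^ k \<le> sum A (X' \<times> Y')" by simp
  have "(1/5)^k * card (X \<times> Y) * s \<le> (7/8)^k * card (X \<times> Y) * s / 4 ^ k"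
  proof -
    have "(1/5::real)^k \<le> (7/32)^k" by (intro power_mono) auto
    then have "(1/5::real)^k \<le> (7/8)^k / 4^k" by (simp add: power_divide[symmetric])
    then have "(1/5)^k * (card (X \<times> Y) * s) \<le> (7/8)^k / 4^k * (card (X \<times> Y) * s)"
      using s by (intro mult_right_mono) auto
    then show ?thesis by (simp add: mult_ac)
  qed
  also have "\<dots> \<le> total k * E k A / 4 ^ k"
    using total_ge[of k] total_pos[of k] s by (intro divide_right_mono mult_mono) auto
  finally have low: "(1/5)^k * card (X \<times> Y) * s \<le> sum A (X' \<times> Y')" using sm by linarith
  have pos: "0 < sum A (X' \<times> Y')" using low N s by (smt (verit) mult_pos_pos of_nat_0_less_iff zero_less_power divide_pos_pos)
  then have ne: "X' \<noteq> {}" "Y' \<noteq> {}" by auto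
  have up: "sum A (X' \<times> Y') \<le> card (X' \<times> Y') * H"
    using XY' by (intro sum_bounded_above H) auto
  have "finite X'" "finite Y'" using XY' XY finite_subset by blast+
  then have "H > 0" using up pos ne by (smt (verit) mult_nonneg_nonpos of_nat_0_le_iff)
  have "(1/5)^k * card (X \<times> Y) * s \<le> card (X' \<times> Y') * H" using low up by linarith
  then have "(1/5)^k * card (X \<times> Y) * s / H \<le> card (X' \<times> Y')" using \<open>H > 0\<close> by (simp add: field_simps)
  then have "s / H * (card X * card Y) / 5 ^ k \<le> card X' * card Y'"
    by (simp add: card_cartesian_product power_divide mult_ac)
  then show thesis using that XY' ne pos by blast
qed

text \<open>Mean plus standard deviation is not linear in the distribution, so it is replaced by a
  quadratic functional \<open>A\<close>: a positive sum of \<open>A\<close> over a block forces the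
  potential there below \<open>T\<close>.\<close>

lemma tiltable_realize_potential:
  fixes M :: "'a \<times> 'b \<Rightarrow> real"
  assumes XY: "finite X" "finite Y" "X \<noteq> {}" "Y \<noteq> {}" and tl: "tiltable X Y (\<lambda>p. M p - c) L"
  assumes s: "s > 0" "tilting.mean (X \<times> Y) M c L k + sqrt (tilting.var (X \<times> Y) M c L k) + s \<le> T"
    and H: "T - tilting.mean (X \<times> Y) M c L k \<le> H"
  obtains X' Y' where "X' \<subseteq> X" "Y' \<subseteq> Y" "X' \<noteq> {}" "Y' \<noteq> {}" "potential (X' \<times> Y') M \<le> T"
    "s / (2 * H) * (card X * card Y) / 5 ^ k \<le> card X' * card Y'"
proof -
  interpret tilting "X \<times> Y" M c L
    using XY tl by unfold_locales (auto simp: tiltable_def)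
  define a where "a = mean k"
  \<comment> \<open>Half of the slack \<open>s\<close> is added so that \<open>q\<close> is positive
    even when the tilted variance is zero.\<close>
  define q where "q = sqrt (var k) + s / 2"
  have q: "q > 0" "sqrt (var k) \<le> q" using s var_nonneg[of k] by (auto simp: q_def add_nonneg_pos)
  have amgm: "x / (2 * q) + q / 2 = (x + q\<^sup>2) / (2 * q)" for x
    using q by (simp add: field_simps power2_eq_square)
  define A where "A p = T - q / 2 - M p - 1 / (2 * q) * (M p - a)\<^sup>2" for p
  \<comment> \<open>The square root in the potential is linearized by \<open>sd \<le> sd\<^sup>2 / (2 q) + q / 2\<close>.\<close>
  have "var k \<le> q\<^sup>2" using power_mono[OF q(2), of 2] var_nonneg[of k] by simp
  then have "1 / (2 * q) * var k \<le> q / 2" using q by (simp add: field_simps power2_eq_square)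
  then have "s / 2 \<le> T - q / 2 - a - 1 / (2 * q) * var k"
    using s q_def a_def by linarith
  also have "\<dots> = E k A"
    unfolding A_def E_diff E_cmult E_const E_square_shift by (simp add: a_def mean_def)
  finally have EA: "s / 2 \<le> E k A" .
  have AH: "A p \<le> H" for p
  proof -
    \<comment> \<open>Completing the square, \<open>A p = T - a - (M p - a + q)^2 / (2 * q)\<close>,
      so \<open>A\<close> never exceeds \<open>T - a\<close>.\<close>
    have "0 \<le> (M p - a + q)\<^sup>2 / (2 * q)" using q by simp
    also have "\<dots> = (M p - a) + (1 / (2 * q) * (M p - a)\<^sup>2 + q / 2)"
      using q by (simp add: field_simps power2_eq_square)
    finally show ?thesis using H by (simp add: A_def a_def)
  qed
  show thesis
  proof (rule tiltable_realize[OF XY tl _ EA AH])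
    show "s / 2 > 0" using s by simp
    fix X' Y'
    assume *: "X' \<subseteq> X" "Y' \<subseteq> Y" "X' \<noteq> {}" "Y' \<noteq> {}" "sum A (X' \<times> Y') > 0"
      "s / 2 / H * (card X * card Y) / 5 ^ k \<le> card X' * card Y'"
    have fs: "finite (X' \<times> Y')" "X' \<times> Y' \<noteq> {}"
      using * finite_subset[OF *(1) XY(1)] finite_subset[OF *(2) XY(2)] by auto
    then have "0 \<le> avg (X' \<times> Y') A" using * by (simp add: avg_def)
    also have "\<dots> = T - q / 2 - avg (X' \<times> Y') M - 1 / (2 * q) * avg (X' \<times> Y') (\<lambda>p. (M p - a)\<^sup>2)"
      unfolding A_def avg_diff avg_cmult avg_const[OF fs] ..
    finally have 1: "avg (X' \<times> Y') M + (avg (X' \<times> Y') (\<lambda>p. (M p - a)\<^sup>2) / (2 * q) + q / 2) \<le> T" by simp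
    have "0 \<le> (sqrt (avgvar (X' \<times> Y') M) - q)\<^sup>2" by simp
    then have "2 * q * sqrt (avgvar (X' \<times> Y') M) \<le> avgvar (X' \<times> Y') M + q\<^sup>2"
      by (simp add: power2_diff avgvar_nonneg mult_ac)
    also have "\<dots> \<le> avg (X' \<times> Y') (\<lambda>p. (M p - a)\<^sup>2) + q\<^sup>2" using avgvar_le[OF fs] by simp
    finally have "sqrt (avgvar (X' \<times> Y') M) \<le> avg (X' \<times> Y') (\<lambda>p. (M p - a)\<^sup>2) / (2 * q) + q / 2"
      unfolding amgm using q by (simp add: field_simps)
    with 1 have "potential (X' \<times> Y') M \<le> T" by (simp add: potential_def)
    then show thesis using * that by (simp add: mult_ac)
  qed
qed

section \<open>Decreasing the potential\<close>

text \<open>\<open>\<kappa>\<close> counts the bits lost in area. The area is what tilting controls,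
  and losses in area add up under composition; the sides are recovered at the end.\<close>

definition large_block :: "real \<Rightarrow> 'a set \<Rightarrow> 'b set \<Rightarrow> 'a set \<Rightarrow> 'b set \<Rightarrow> bool" where
  "large_block \<kappa> X Y X' Y' \<longleftrightarrow> X' \<subseteq> X \<and> Y' \<subseteq> Y \<and> X' \<noteq> {} \<and> Y' \<noteq> {} \<and>
     2 powr (- \<kappa>) * (real (card X) * real (card Y)) \<le> real (card X') * real (card Y')"

lemma large_block_mono: "large_block \<kappa> X Y X' Y' \<Longrightarrow> \<kappa> \<le> \<kappa>' \<Longrightarrow> large_block \<kappa>' X Y X' Y'"
proof -
  assume a: "large_block \<kappa> X Y X' Y'" "\<kappa> \<le> \<kappa>'"
  have "2 powr (- \<kappa>') * (real (card X) * real (card Y)) \<le> 2 powr (- \<kappa>) * (real (card X) * real (card Y))"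
    using a by (intro mult_right_mono powr_mono) auto
  then show ?thesis using a unfolding large_block_def by linarith
qed

lemma large_block_trans:
  assumes "large_block \<kappa> X Y X1 Y1" "large_block \<kappa>' X1 Y1 X2 Y2"
  shows "large_block (\<kappa> + \<kappa>') X Y X2 Y2"
proof -
  have "2 powr (- (\<kappa> + \<kappa>')) * (real (card X) * real (card Y)) 
      = 2 powr (- \<kappa>') * (2 powr (- \<kappa>) * (real (card X) * real (card Y)))"
    by (simp add: powr_add[symmetric] mult.assoc[symmetric] add.commute)
  also have "\<dots> \<le> 2 powr (- \<kappa>') * (real (card X1) * real (card Y1))"
    using assms by (intro mult_left_mono) (auto simp: large_block_def)
  also have "\<dots> \<le> real (card X2) * real (card Y2)" using assms by (simp add: large_block_def)
  finally show ?thesis using assms unfolding large_block_def by blast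
qed

lemma large_block_refl: "X \<noteq> {} \<Longrightarrow> Y \<noteq> {} \<Longrightarrow> large_block 0 X Y X Y"
  by (simp add: large_block_def)

lemma le_two_powr: "x \<le> 2 powr x" for x :: real
proof (cases "x \<le> 0")
  case True
  then show ?thesis using powr_ge_zero[of 2 x] by linarith
next
  case False
  define n where "n = nat \<lfloor>x\<rfloor>"
  have n: "real n \<le> x" "x \<le> real (Suc n)" using False by (auto simp: n_def of_nat_nat, linarith)
  have "real (Suc n) \<le> 2 ^ n" using of_nat_mono[of "Suc n" "2 ^ n", where ?'a = real] less_exp[of n] by simp
  also have "\<dots> = 2 powr real n" by (simp add: powr_realpow)
  also have "\<dots> \<le> 2 powr x" using n by (intro powr_mono) auto
  finally show ?thesis using n by linarith
qed

text \<open>Common bookkeeping after a tilt: one bit for the restriction before it, \<open>h\<close>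
  bits for the realization factor \<open>1 / Q\<close>, and three bits per step because
  \<open>5 \<le> 8\<close>.\<close>

lemma large_blockI:
  assumes "X' \<subseteq> X" "Y' \<subseteq> Y" "X' \<noteq> {}" "Y' \<noteq> {}"
    and N1: "real (card X) * real (card Y) \<le> 2 * N1"
    and q: "1 / Q * N1 / 5 ^ k \<le> real (card X') * real (card Y')"
    and Q: "0 < Q" "Q \<le> 2 powr h"
  shows "large_block (1 + h + 3 * real k) X Y X' Y'"
proof -
  let ?N = "real (card X) * real (card Y)"
  have N1': "0 \<le> N1" using N1 by (smt (verit) mult_nonneg_nonneg of_nat_0_le_iff)
  have "2 powr (- (1 + h + 3 * real k)) = 1 / 2 * 2 powr (-h) * 2 powr (- (3 * real k))"
    by (simp add: powr_add[symmetric] powr_minus_divide powr_diff)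
  also have "2 powr (- (3 * real k)) = 1 / 8 ^ k"
    by (simp add: powr_minus_divide powr_powr[symmetric] powr_realpow)
  finally have e: "2 powr (- (1 + h + 3 * real k)) = 1 / 2 * 2 powr (-h) * (1 / 8 ^ k)" .
  have h: "2 powr (-h) \<le> 1 / Q" using Q by (simp add: powr_minus_divide field_simps)
  have "(1::real) / 8 ^ k \<le> 1 / 5 ^ k" by (intro divide_left_mono power_mono) auto
  then have "2 powr (-h) * (1 / 8 ^ k) * (?N / 2) \<le> 1 / Q * (1 / 5 ^ k) * N1"
    using h N1 Q by (intro mult_mono) auto
  then show ?thesis using assms(1-4) q unfolding large_block_def e by (simp add: mult_ac)
qed

section \<open>Decrease of the potential in proportion to the standard deviation\<close>

lemma restriction_99_percent:
  fixes B :: "'a \<times> 'b \<Rightarrow> real" and W :: real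
  assumes fin: "finite X" "finite Y" "X \<noteq> {}" "Y \<noteq> {}" and lr: "lowrank R X Y B" and r: "R \<ge> 1"
  assumes W: "W > 0" "avg (X \<times> Y) (\<lambda>p. (B p)\<^sup>2) \<le> W"
  obtains X1 Y1 where "X1 \<subseteq> X" "Y1 \<subseteq> Y" "X1 \<noteq> {}" "Y1 \<noteq> {}"
    "99/100 * (real (card X) * real (card Y)) \<le> real (card X1) * real (card Y1)"
    "tiltable X1 Y1 B (200 * sqrt (R * W))"
proof -
  have N: "0 < real (card X)" "0 < real (card Y)" using fin by (auto simp: card_gt_0_iff)
  have W': "(\<Sum>p\<in>X\<times>Y. (B p)\<^sup>2) \<le> W * (card X * card Y)"
    using W(2) N by (simp add: avg_def card_cartesian_product field_simps)
  show thesis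
  \<comment> \<open>Discarding a share \<open>1/200\<close> of rows and of columns leaves at least
    \<open>99/100\<close> of the area.\<close>
  proof (rule tiltable_restriction[OF fin lr r W(1) W', where \<delta> = "1/200"])
    fix X1 Y1 assume *: "X1 \<subseteq> X" "Y1 \<subseteq> Y" "(1 - 1/200) * real (card X) \<le> real (card X1)"
      "(1 - 1/200) * real (card Y) \<le> real (card Y1)" "tiltable X1 Y1 B (sqrt (R * W) / (1/200))"
    have "((1 - 1/200) * real (card X)) * ((1 - 1/200) * real (card Y)) \<le> real (card X1) * real (card Y1)"
      by (intro mult_mono *) auto
    moreover have "99/100 * (real (card X) * real (card Y)) \<le> ((1 - 1/200) * real (card X)) * ((1 - 1/200) * real (card Y))"
      by simp
    moreover have "X1 \<noteq> {}" "Y1 \<noteq> {}" using * N by auto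
    moreover have "tiltable X1 Y1 B (200 * sqrt (R * W))" using *(5) by (simp add: mult.commute)
    ultimately show thesis by (intro that[OF *(1,2)]) linarith+
  qed simp
qed

text \<open>The deviations from the mean sum to zero, so the sum over the kept entries is minus that
  over the removed ones, which is small because few are removed and their squares are bounded by the
  variance.\<close>

lemma avg_restriction_99_percent:
  fixes M :: "'p \<Rightarrow> real"
  assumes S: "finite S" "S1 \<subseteq> S" "S1 \<noteq> {}" and c: "99/100 * real (card S) \<le> real (card S1)"
    and v: "v = sqrt (avgvar S M)" "v > 0"
  shows "avg S1 M \<le> avg S M + v / 9"
proof -
  define m where "m = avg S M"
  have N: "0 < real (card S1)" "real (card S1) \<le> real (card S)" "0 < real (card S)"
    using S finite_subset[OF S(2,1)] by (auto simp: card_gt_0_iff intro: card_mono)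
  have tot: "(\<Sum>p\<in>S. M p - m) = 0" using N by (simp add: sum_subtractf m_def avg_def)
  have v2: "(\<Sum>p\<in>S. (M p - m)\<^sup>2) = card S * v\<^sup>2"
    using N avgvar_nonneg[of S M] v by (simp add: avgvar_def avg_def m_def)
  have "(\<Sum>p\<in>S. M p - m) = (\<Sum>p\<in>S1. M p - m) + (\<Sum>p\<in>S-S1. M p - m)"
    using S by (subst sum.subset_diff[OF S(2,1)]) simp
  then have "(\<Sum>p\<in>S1. M p - m) = (\<Sum>p\<in>S-S1. - (M p - m))" unfolding sum_negf using tot by linarith
  \<comment> \<open>Weighted AM-GM, with the weight chosen so that both parts contribute at most
    \<open>card S * v / 20\<close>: the squares sum to \<open>card S * v^2\<close>, and at most one
    percent of the entries are removed.\<close>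
  also have "\<dots> \<le> (\<Sum>p\<in>S-S1. (M p - m)\<^sup>2 / (20 * v) + 5 * v)"
  proof (rule sum_mono)
    fix p
    have "0 \<le> (M p - m + 10 * v)\<^sup>2 / (20 * v)" using v by simp
    then show "- (M p - m) \<le> (M p - m)\<^sup>2 / (20 * v) + 5 * v"
      using v(2) by (simp add: field_simps power2_eq_square)
  qed
  also have "\<dots> = (\<Sum>p\<in>S-S1. (M p - m)\<^sup>2 / (20 * v)) + real (card (S - S1)) * (5 * v)"
    by (simp add: sum.distrib)
  also have "\<dots> \<le> (\<Sum>p\<in>S. (M p - m)\<^sup>2 / (20 * v)) + real (card (S - S1)) * (5 * v)"
    using S v by (intro add_right_mono sum_mono2) auto
  also have "(\<Sum>p\<in>S. (M p - m)\<^sup>2 / (20 * v)) = card S * v / 20"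
    unfolding sum_divide_distrib[symmetric] v2 using v(2) by (simp add: power2_eq_square)
  also have "real (card (S - S1)) = card S - card S1"
    using S N finite_subset[OF S(2,1)] by (subst card_Diff_subset) auto
  also have "card S * v / 20 + (card S - card S1) * (5 * v) \<le> card S1 * (v / 9)"
  proof -
    have "real (card S - card S1) = real (card S) - real (card S1)" using N by (simp add: of_nat_diff)
    moreover have "99/100 * real (card S) * v \<le> card S1 * v"
      using c v by (intro mult_right_mono) auto
    moreover have "0 \<le> card S * v" using v by simp
    ultimately show ?thesis by (simp add: algebra_simps)
  qed
  finally have "(\<Sum>p\<in>S1. M p - m) \<le> card S1 * (v / 9)" .
  then have "sum M S1 \<le> card S1 * (m + v / 9)" by (simp add: sum_subtractf algebra_simps)
  then show ?thesis using N by (simp add: avg_def m_def field_simps)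
qed

text \<open>Tilt around the mean \<open>m\<close> with \<open>L\<close> of order
  \<open>sqrt (Suc r) * v\<close>. Restriction raises the mean by at most \<open>v / 9\<close>, so a
  gap of \<open>v / 2\<close> remains below the target \<open>m + v - v / 4\<close>, and the Riccati
  argument reaches it in \<open>O(L / v)\<close> steps. The remaining \<open>v / 8\<close> is slack
  for realizing a block.\<close>

lemma variance_phase:
  fixes M :: "'a \<times> 'b \<Rightarrow> real"
  assumes fin: "finite X" "finite Y" "X \<noteq> {}" "Y \<noteq> {}" and lr: "lowrank r X Y M"
    and v: "v = sqrt (avgvar (X \<times> Y) M)" "v > 0"
  obtains X' Y' where "large_block (12100 * sqrt (Suc r)) X Y X' Y'" 
    "potential (X' \<times> Y') M \<le> potential (X \<times> Y) M - v / 8"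
proof -
  define P where "P = X \<times> Y"
  define m where "m = avg P M"
  have P: "finite P" "P \<noteq> {}" using fin by (auto simp: P_def)
  have vv: "avg P (\<lambda>p. (M p - m)\<^sup>2) \<le> v\<^sup>2"
    using avgvar_nonneg[of P M] v by (simp add: P_def m_def avgvar_def)
  obtain X1 Y1 where XY1: "X1 \<subseteq> X" "Y1 \<subseteq> Y" "X1 \<noteq> {}" "Y1 \<noteq> {}"
    and c1: "99/100 * (real (card X) * real (card Y)) \<le> real (card X1) * real (card Y1)"
    and tl: "tiltable X1 Y1 (\<lambda>p. M p - m) (200 * sqrt (Suc r * v\<^sup>2))"
    by (rule restriction_99_percent[OF fin lowrank_minus_const[OF lr, of m], of "v\<^sup>2"])
       (use vv v in \<open>auto simp: P_def\<close>)
  define s where "s = sqrt (Suc r)"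
  have s1: "1 \<le> s" by (simp add: s_def)
  define L where "L = 200 * s * v"
  have L: "200 * sqrt (Suc r * v\<^sup>2) = L" using v by (simp add: L_def s_def real_sqrt_mult)
  have vL: "v \<le> L" using v s1 mult_mono[of 1 "200 * s" v v] by (simp add: L_def)
  note tl = tl[unfolded L]
  have f1: "finite X1" "finite Y1" using XY1 fin finite_subset by blast+
  interpret T: tilting "X1 \<times> Y1" M m L
    using f1 XY1 tl by unfold_locales (auto simp: tiltable_def)
  have "avg (X1 \<times> Y1) M \<le> m + v / 9" unfolding m_def P_def
    by (rule avg_restriction_99_percent) (use fin XY1 v c1 in \<open>auto simp: card_cartesian_product\<close>)
  then have m0: "T.mean 0 \<le> m + v / 9" by (simp add: T.mean_def T.E_def T.total_def avg_def)
  \<comment> \<open>The value \<open>20 * L / v\<close>, rounded up, as required for the gap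
    \<open>v / 2\<close>.\<close>
  define K where "K = nat \<lceil>4000 * s\<rceil>"
  have K: "4000 * s \<le> K" "K \<le> 4000 * s + 1" unfolding K_def using s1 by linarith+
  have xK: "10 * L \<le> K * (v / 2)" 
    using mult_right_mono[OF K(1), of "v / 2"] v by (simp add: L_def)
  have m0': "T.mean 0 + v / 2 \<le> m + v - v / 4" using m0 v(2) by linarith
  obtain k where k: "k \<le> 0 + K" "T.mean k + sqrt (T.var k) \<le> m + v - v / 4"
    by (rule T.mean_plus_sd_decreases[where x = "v / 2" and ?k0.0 = 0 and T = "m + v - v / 4" and K = K]) (use m0' v(2) xK in auto)
  have "\<bar>T.mean k - m\<bar> \<le> L" by (rule T.mean_bounded)
  then have H: "m + v - v / 8 - T.mean k \<le> 2 * L" using vL v by linarith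
  show thesis
  proof (rule tiltable_realize_potential[OF f1 XY1(3,4) tl, of "v / 8" k "m + v - v / 8" "2 * L"])
    fix X' Y' assume *: "X' \<subseteq> X1" "Y' \<subseteq> Y1" "X' \<noteq> {}" "Y' \<noteq> {}" "potential (X' \<times> Y') M \<le> m + v - v / 8"
      "v / 8 / (2 * (2 * L)) * real (card X1 * card Y1) / 5 ^ k \<le> real (card X' * card Y')"
    have e: "v / 8 / (2 * (2 * L)) = 1 / (6400 * s)" using v s1 by (simp add: L_def field_simps)
    have "6400 * s \<le> 2 powr 13 * 2 powr s"
      using le_two_powr[of s] s1 by (intro mult_mono) auto
    then have q: "6400 * s \<le> 2 powr (13 + s)" by (simp add: powr_add)
    have n1: "real (card X) * real (card Y) \<le> 2 * (real (card X1) * real (card Y1))"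
      using c1 mult_nonneg_nonneg[of "real (card X)" "real (card Y)"] by linarith
    have b5: "1 / (6400 * s) * (real (card X1) * real (card Y1)) / 5 ^ k \<le> real (card X') * real (card Y')"
      using *(6) unfolding e by simp
    have "large_block (1 + (13 + s) + 3 * real k) X Y X' Y'"
      by (rule large_blockI[OF order_trans[OF *(1) XY1(1)] order_trans[OF *(2) XY1(2)] *(3,4) n1 b5 _ q])
         (use s1 in simp)
    moreover have "1 + (13 + s) + 3 * real k \<le> 12100 * s" using k K s1 by linarith
    ultimately have "large_block (12100 * s) X Y X' Y'" by (rule large_block_mono)
    moreover have "potential (X \<times> Y) M = m + v" by (simp add: potential_def m_def P_def v)
    ultimately show thesis using that * by (simp add: s_def)
  qed (use v k H in auto)
qed

section \<open>Integer entries concentrated around a single value\<close>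

lemma tiltable_raw:
  fixes A :: "'a \<times> 'b \<Rightarrow> real"
  assumes tl: "tiltable X Y B L" and fin: "finite X" "finite Y"
    and pos: "0 < s" "s \<le> (\<Sum>p\<in>X\<times>Y. A p * (1 - B p / (8 * L)) ^ k)"
    and A: "\<And>p. p \<in> X \<times> Y \<Longrightarrow> A p \<le> 1"
  obtains X' Y' where "X' \<subseteq> X" "Y' \<subseteq> Y" "X' \<noteq> {}" "Y' \<noteq> {}" "0 < sum A (X' \<times> Y')"
    "s / 4 ^ k \<le> real (card X') * real (card Y')"
proof -
  obtain X' Y' where XY: "X' \<subseteq> X" "Y' \<subseteq> Y"
    and sm: "(\<Sum>p\<in>X\<times>Y. A p * (1 - B p / (8 * L)) ^ k) / 4 ^ k \<le> sum A (X' \<times> Y')"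
    using tl unfolding tiltable_def by blast
  have "0 < s / 4 ^ k" using pos by simp
  have le: "s / 4 ^ k \<le> sum A (X' \<times> Y')"
    using sm divide_right_mono[OF pos(2), of "4 ^ k"] by simp
  also have "\<dots> \<le> real (card (X' \<times> Y')) * 1"
    by (rule sum_bounded_above) (use XY A in auto)
  finally have "s / 4 ^ k \<le> real (card X') * real (card Y')" by (simp add: card_cartesian_product)
  moreover have "0 < sum A (X' \<times> Y')" using le \<open>0 < s / 4 ^ k\<close> by linarith
  moreover from this have "X' \<noteq> {}" "Y' \<noteq> {}" by auto
  ultimately show thesis using that XY by blast
qed

lemma one_minus_power_le:
  assumes "0 \<le> x" "x \<le> 1" shows "(1 - x) ^ k \<le> 1 / (1 + real k * x)"
proof -
  have "(1 - x) ^ k * (1 + real k * x) \<le> (1 - x) ^ k * (1 + x) ^ k"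
    using assms Bernoulli_inequality[of x k] by (intro mult_left_mono) auto
  also have "\<dots> = (1 - x\<^sup>2) ^ k" by (simp add: power_mult_distrib[symmetric] power2_eq_square algebra_simps)
  also have "\<dots> \<le> 1" using assms by (intro power_le_one) (auto simp: power_le_one)
  finally show ?thesis using assms by (simp add: field_simps add_pos_nonneg)
qed

lemma mult_le_one_plus_power:
  fixes x :: real
  assumes "0 \<le> x" shows "real n * x \<le> (1 + x) ^ n"
  using Bernoulli_inequality[of x n] assms by linarith

text \<open>The second alternative arises when the first tilt gives too much weight to entries below
  \<open>a\<close>; tilting further then makes these dominant.\<close>

lemma plateau_step:
  fixes M :: "'a \<times> 'b \<Rightarrow> real" and a \<epsilon> :: real
  assumes fin: "finite X" "finite Y" "X \<noteq> {}" "Y \<noteq> {}" and lr: "lowrank r X Y M"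
    and ints: "\<And>p. p \<in> X \<times> Y \<Longrightarrow> M p \<in> \<int>" and a: "a \<in> \<int>"
    and eps: "\<epsilon> > 0" "\<epsilon> \<le> 1/128" "1 < 4 * Suc r * \<epsilon>"
    and avg: "avg (X \<times> Y) (\<lambda>p. (M p - a)\<^sup>2) \<le> \<epsilon>"
  shows "(\<exists>X' Y'. large_block (150000 * sqrt (Suc r * \<epsilon>)) X Y X' Y' \<and> avg (X' \<times> Y') (\<lambda>p. (M p - a)\<^sup>2) \<le> \<epsilon> / 2)
     \<or> (\<exists>X' Y'. large_block (100000 * sqrt (Suc r)) X Y X' Y' \<and> potential (X' \<times> Y') M \<le> a - 1/8)"
proof -
  define R where "R = real (Suc r)"
  obtain X1 Y1 where XY1: "X1 \<subseteq> X" "Y1 \<subseteq> Y" "X1 \<noteq> {}" "Y1 \<noteq> {}"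
    and c1: "99/100 * (real (card X) * real (card Y)) \<le> real (card X1) * real (card Y1)"
    and tl: "tiltable X1 Y1 (\<lambda>p. M p - a) (200 * sqrt (Suc r * \<epsilon>))"
    by (rule restriction_99_percent[OF fin lowrank_minus_const[OF lr, of a], of \<epsilon>]) (use avg eps in auto)
  define x where "x = sqrt (R * \<epsilon>)"
  define L where "L = 200 * x"
  note tl = tl[folded R_def, folded x_def, folded L_def]
  \<comment> \<open>The rank argument is not yet available at this \<open>\<epsilon>\<close>; this
    makes \<open>L\<close> at least \<open>100\<close>, so that rounding step counts costs only a
    constant factor.\<close>
  have "(1/2)\<^sup>2 \<le> R * \<epsilon>" using eps(3) by (simp add: R_def power2_eq_square algebra_simps)
  then have x: "1/2 \<le> x" unfolding x_def by (rule real_le_rsqrt)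
  then have L: "100 \<le> L" by (simp add: L_def)
  have f1: "finite X1" "finite Y1" using XY1 fin finite_subset by blast+
  interpret T: tilting "X1 \<times> Y1" M a L
    using f1 XY1 tl by unfold_locales (auto simp: tiltable_def)
  define P where "P = X1 \<times> Y1"
  define N where "N = real (card X1) * real (card Y1)"
  have P: "finite P" "P \<noteq> {}" "real (card P) = N" using f1 XY1 by (auto simp: P_def N_def card_cartesian_product)
  have N: "0 < N" using f1 XY1 by (simp add: N_def card_gt_0_iff)
  have n1: "real (card X) * real (card Y) \<le> 2 * N"
    using c1 mult_nonneg_nonneg[of "real (card X)" "real (card Y)"] unfolding N_def by linarith
  define y where "y p = a - M p" for p
  define w where "w p = 1 + y p / (8 * L)" for p
  have ww: "1 - (M p - a) / (8 * L) = w p" for p by (simp add: w_def y_def diff_divide_distrib)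
  have y_cases: "y p = 0 \<or> 1 \<le> y p \<or> y p \<le> -1" if "p \<in> P" for p
  proof -
    have "y p \<in> \<int>" using that ints[of p] a XY1 by (auto simp: y_def P_def)
    then obtain z :: int where "y p = of_int z" by (auto elim: Ints_cases)
    moreover have "z = 0 \<or> 1 \<le> z \<or> z \<le> -1" by linarith
    ultimately show ?thesis using of_int_le_iff[of 1 z, where ?'a = real] of_int_le_iff[of z "-1", where ?'a = real]
      by auto
  qed
  have yL: "\<bar>y p\<bar> \<le> L" if "p \<in> P" for p using T.bounded[of p] that by (auto simp: P_def y_def abs_minus_commute)
  have w0: "0 \<le> w p" if "p \<in> P" for p using yL[OF that] L by (simp add: w_def field_simps abs_le_iff)
  have w_le1: "w p \<le> 1" if "y p \<le> 0" for p using that L by (simp add: w_def divide_nonpos_pos)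
  have sum_y2: "(\<Sum>p\<in>P. (y p)\<^sup>2) \<le> 2 * \<epsilon> * N"
  proof -
    have sub: "P \<subseteq> X \<times> Y" using XY1 by (auto simp: P_def)
    have "(\<Sum>p\<in>P. (y p)\<^sup>2) \<le> (\<Sum>p\<in>X\<times>Y. (y p)\<^sup>2)"
      using fin sub by (intro sum_mono2) auto
    also have "\<dots> = avg (X \<times> Y) (\<lambda>p. (M p - a)\<^sup>2) * (real (card X) * real (card Y))"
      using fin by (simp add: avg_def card_cartesian_product y_def power2_commute)
    also have "\<dots> \<le> \<epsilon> * (real (card X) * real (card Y))" using avg by (intro mult_right_mono) auto
    also have "\<dots> \<le> \<epsilon> * (2 * N)" using c1 eps N unfolding N_def by (intro mult_left_mono) auto
    finally show ?thesis by simp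
  qed
  \<comment> \<open>After this many steps, entries above \<open>a\<close> are suppressed: by
    integrality their weight is at most \<open>1 - 1 / (8 * L)\<close>, and its \<open>k\<close>-th
    power at most \<open>1 / (1 + 31)\<close>.\<close>
  define k where "k = nat \<lceil>248 * L\<rceil>"
  have k: "248 * L \<le> k" "k \<le> 248 * L + 1" unfolding k_def using L by linarith+
  have small: "w p ^ k \<le> 1/32" if "p \<in> P" "y p \<le> -1" for p
  proof -
    have "w p \<le> 1 - 1 / (8 * L)" using divide_right_mono[OF that(2), of "8 * L"] L by (simp add: w_def)
    then have "w p ^ k \<le> (1 - 1 / (8 * L)) ^ k" using w0[OF that(1)] by (intro power_mono)
    also have "\<dots> \<le> 1 / (1 + real k * (1 / (8 * L)))" using L by (intro one_minus_power_le) auto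
    also have "\<dots> \<le> 1 / 32"
    proof -
      have "31 \<le> real k * (1 / (8 * L))" using k L by (simp add: field_simps)
      then show ?thesis by (intro divide_left_mono) auto
    qed
    finally show ?thesis .
  qed
  \<comment> \<open>The weighted square deviation of the entries below \<open>a\<close>, which the
    tilt amplifies. Either its total is small and the mean square distance is halved, or these
    entries can be made dominant.\<close>
  define Q where "Q p = (if 1 \<le> y p then (y p)\<^sup>2 * w p ^ k else 0)" for p
  show ?thesis
  proof (cases "(\<Sum>p\<in>P. Q p) \<le> \<epsilon> / 16 * N")
    case True
    \<comment> \<open>A nonnegative sum of \<open>A\<close> over a block says exactly that the mean
      square distance to \<open>a\<close> there is at most \<open>\<epsilon> / 2\<close>.\<close>
    define A where "A p = 1 - 2 / \<epsilon> * (y p)\<^sup>2" for p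
    have "N / 2 \<le> N * (1 - 2 * \<epsilon> - 1/8 - 1/8)" using N eps by (simp add: field_simps)
    also have "\<dots> = N - (1 + 1 / (16 * \<epsilon>)) * (2 * \<epsilon> * N) - 2 / \<epsilon> * (\<epsilon> / 16 * N)"
      using eps by (simp add: field_simps)
    also have "\<dots> \<le> N - (1 + 1 / (16 * \<epsilon>)) * (\<Sum>p\<in>P. (y p)\<^sup>2) - 2 / \<epsilon> * (\<Sum>p\<in>P. Q p)"
      using sum_y2 True eps by (intro diff_mono mult_left_mono order_refl) auto
    also have "\<dots> = (\<Sum>p\<in>P. 1 - (1 + 1 / (16 * \<epsilon>)) * (y p)\<^sup>2 - 2 / \<epsilon> * Q p)"
      unfolding sum_subtractf sum_distrib_left[symmetric] using P by simp
    \<comment> \<open>Entries equal to \<open>a\<close> contribute \<open>1\<close>, entries below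
      lose at most \<open>2 / \<epsilon> * Q p\<close>, and entries above lose at most
      \<open>(y p)^2 / (16 * \<epsilon>)\<close> because their weight is at most
      \<open>1/32\<close>.\<close>
    also have "\<dots> \<le> (\<Sum>p\<in>P. A p * w p ^ k)"
    proof (rule sum_mono)
      fix p assume p: "p \<in> P"
      have wk: "0 \<le> w p ^ k" using w0[OF p] by simp
      from y_cases[OF p] show "1 - (1 + 1 / (16 * \<epsilon>)) * (y p)\<^sup>2 - 2 / \<epsilon> * Q p \<le> A p * w p ^ k"
      proof (elim disjE)
        assume "y p = 0"
        then show ?thesis by (simp add: A_def Q_def w_def)
      next
        assume y1: "1 \<le> y p"
        have "1 \<le> (y p)\<^sup>2" using y1 by simp
        moreover have "0 \<le> 1 / (16 * \<epsilon>) * (y p)\<^sup>2" using eps by simp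
        moreover have "A p * w p ^ k = w p ^ k - 2 / \<epsilon> * Q p" using y1 by (simp add: A_def Q_def algebra_simps)
        ultimately show ?thesis using wk by (simp add: algebra_simps)
      next
        assume y1: "y p \<le> -1"
        have "1 \<le> (y p)\<^sup>2" using y1 power2_le_imp_le[of 1 "- y p"] by (smt (verit) one_le_power power2_minus)
        moreover have "2 / \<epsilon> * (y p)\<^sup>2 * w p ^ k \<le> 2 / \<epsilon> * (y p)\<^sup>2 * (1/32)"
          using small[OF p y1] eps by (intro mult_left_mono) auto
        moreover have "Q p = 0" using y1 by (simp add: Q_def)
        ultimately show ?thesis using wk eps by (simp add: A_def algebra_simps)
      qed
    qed
    finally have sm: "N / 2 \<le> (\<Sum>p\<in>X1\<times>Y1. A p * (1 - (M p - a) / (8 * L)) ^ k)" by (simp add: P_def ww)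
    have "\<exists>X' Y'. large_block (150000 * x) X Y X' Y' \<and> avg (X' \<times> Y') (\<lambda>p. (M p - a)\<^sup>2) \<le> \<epsilon> / 2"
    proof (rule tiltable_raw[OF tl f1 _ sm])
      fix X' Y' assume *: "X' \<subseteq> X1" "Y' \<subseteq> Y1" "X' \<noteq> {}" "Y' \<noteq> {}" "0 < sum A (X' \<times> Y')"
         "N / 2 / 4 ^ k \<le> real (card X') * real (card Y')"
      have "(4::real) ^ k \<le> 5 ^ k" by (intro power_mono) auto
      then have "N / 2 / 5 ^ k \<le> N / 2 / 4 ^ k" using N by (intro divide_left_mono) auto
      with * have b5: "1 / 2 * N / 5 ^ k \<le> real (card X') * real (card Y')" by simp
      have "large_block (1 + 1 + 3 * real k) X Y X' Y'"
        by (rule large_blockI[OF order_trans[OF *(1) XY1(1)] order_trans[OF *(2) XY1(2)] *(3,4) n1 b5]) auto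
      then have lb: "large_block (150000 * x) X Y X' Y'"
        by (rule large_block_mono) (use k x in \<open>simp add: L_def\<close>)
      have fs: "finite (X' \<times> Y')" "X' \<times> Y' \<noteq> {}" 
        using * finite_subset[OF *(1) f1(1)] finite_subset[OF *(2) f1(2)] by auto
      then have "0 \<le> avg (X' \<times> Y') A" using * by (simp add: avg_def)
      also have "\<dots> = 1 - 2 / \<epsilon> * avg (X' \<times> Y') (\<lambda>p. (y p)\<^sup>2)"
        unfolding A_def avg_diff avg_cmult avg_const[OF fs] ..
      finally have "avg (X' \<times> Y') (\<lambda>p. (M p - a)\<^sup>2) \<le> \<epsilon> / 2"
        using eps by (simp add: y_def power2_commute field_simps)
      then show ?thesis using lb by blast
    qed (use N eps in \<open>auto simp: A_def\<close>)
    then show ?thesis by (simp add: x_def R_def)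
  next
    case False
    define se where "se = sqrt \<epsilon>"
    have se: "0 < se" "se \<le> 1/11" "se * se = \<epsilon>" "x = sqrt R * se"
    proof -
      show "se \<le> 1/11" unfolding se_def using eps by (intro real_le_lsqrt) (auto simp: power2_eq_square)
    qed (use eps in \<open>auto simp: se_def x_def real_sqrt_mult\<close>)
    define k1 where "k1 = nat \<lceil>8 * L\<rceil>"
    have k1: "8 * L \<le> k1" "k1 \<le> 8 * L + 1" unfolding k1_def using L by linarith+
    define q where "q = nat \<lceil>48 * L / se\<rceil>"
    have "0 \<le> 48 * L / se" using L se by simp
    then have q: "48 * L / se \<le> q" "q \<le> 48 * L / se + 1" unfolding q_def by linarith+
    \<comment> \<open>For entries below \<open>a\<close>, the \<open>k1\<close> steps contribute a
      factor at least \<open>y p\<close>, so that the squares in \<open>Q\<close> bound first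
      moments of sufficient size, and the \<open>2 * q\<close> steps a factor at least
      \<open>32 / \<epsilon>\<close>.\<close>
    define k' where "k' = k + k1 + 2 * q"
    \<comment> \<open>Bernoulli's inequality is applied to \<open>q\<close> steps and then squared.
      Thus \<open>q\<close> is of order \<open>L / sqrt \<epsilon>\<close>, which is
      \<open>O(sqrt (Suc r))\<close> for every \<open>\<epsilon>\<close>; a direct application would
      need order \<open>L / \<epsilon>\<close>.\<close>
    have grow: "32 / \<epsilon> \<le> (1 + 1 / (8 * L)) ^ (2 * q)"
    proof -
      have "6 / se \<le> q * (1 / (8 * L))" using q(1) L se by (simp add: field_simps)
      also have "\<dots> \<le> (1 + 1 / (8 * L)) ^ q" using L by (intro mult_le_one_plus_power) auto
      finally have "(6 / se)\<^sup>2 \<le> ((1 + 1 / (8 * L)) ^ q)\<^sup>2" using se by (intro power_mono) auto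
      moreover have "(6 / se)\<^sup>2 = 36 / \<epsilon>" using se by (simp add: power2_eq_square flip: se(3))
      moreover have "32 / \<epsilon> \<le> 36 / \<epsilon>" using eps by (intro divide_right_mono) auto
      ultimately show ?thesis by (simp add: power_mult[symmetric] mult.commute)
    qed
    have "0 \<le> (16 / \<epsilon>) * (\<epsilon> / 16 * N) - N / 2 - 2 * \<epsilon> * N" using N eps by (simp add: field_simps)
    also have "\<dots> \<le> (16 / \<epsilon>) * (\<Sum>p\<in>P. Q p) - N / 2 - (\<Sum>p\<in>P. (y p)\<^sup>2)"
      using sum_y2 False eps by (intro diff_mono mult_left_mono order_refl) auto
    also have "\<dots> = (\<Sum>p\<in>P. (16 / \<epsilon>) * Q p - 1 / 2 - (y p)\<^sup>2)"
      unfolding sum_subtractf sum_distrib_left[symmetric] using P by simp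
    also have "\<dots> \<le> (\<Sum>p\<in>P. (y p - 1/2) * w p ^ k')"
    proof (rule sum_mono)
      fix p assume p: "p \<in> P"
      have wk: "0 \<le> w p ^ k" for k using w0[OF p] by simp
      from y_cases[OF p] show "(16 / \<epsilon>) * Q p - 1 / 2 - (y p)\<^sup>2 \<le> (y p - 1/2) * w p ^ k'"
      proof (elim disjE)
        assume "y p = 0"
        then show ?thesis by (simp add: Q_def w_def)
      next
        assume y1: "1 \<le> y p"
        have y8: "1 / (8 * L) \<le> y p / (8 * L)" using y1 L by (intro divide_right_mono) auto
        have "y p \<le> k1 * (y p / (8 * L))" using mult_right_mono[OF k1(1), of "y p / (8 * L)"] L y1 by simp
        also have "\<dots> \<le> w p ^ k1" unfolding w_def using L y1 by (intro mult_le_one_plus_power) auto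
        finally have 1: "y p \<le> w p ^ k1" .
        have "(1 + 1 / (8 * L)) ^ (2 * q) \<le> w p ^ (2 * q)" unfolding w_def using y8 L by (intro power_mono) auto
        with grow have 2: "32 / \<epsilon> \<le> w p ^ (2 * q)" by linarith
        have "(16 / \<epsilon>) * Q p = (y p / 2) * (w p ^ k * y p * (32 / \<epsilon>))"
          using y1 by (simp add: Q_def power2_eq_square)
        also have "\<dots> \<le> (y p - 1/2) * (w p ^ k * w p ^ k1 * w p ^ (2 * q))"
          using y1 1 2 wk eps by (intro mult_mono mult_nonneg_nonneg order_refl) auto
        finally have "(16 / \<epsilon>) * Q p \<le> (y p - 1/2) * w p ^ k'" by (simp only: k'_def power_add)
        then show ?thesis using zero_le_power2[of "y p"] by linarith
      next
        assume y1: "y p \<le> -1"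
        have "(1/2 - y p) * w p ^ k' \<le> (1/2 - y p) * 1"
          using y1 w0[OF p] w_le1[of p] by (intro mult_left_mono power_le_one) auto
        moreover have "- y p \<le> (y p)\<^sup>2" using y1 mult_left_mono[of 1 "- y p" "- y p"] by (simp add: power2_eq_square)
        moreover have "Q p = 0" using y1 by (simp add: Q_def)
        ultimately show ?thesis by (simp add: algebra_simps)
      qed
    qed
    finally have "0 \<le> (\<Sum>p\<in>P. (y p - 1/2) * w p ^ k')" .
    then have "0 \<le> T.E k' (\<lambda>p. y p - 1/2)"
      using T.total_pos[of k'] by (simp add: T.E_def P_def T.weight_def ww)
    also have "\<dots> = a - T.mean k' - 1/2" unfolding y_def T.E_diff T.E_const by (simp add: T.mean_def)
    finally have mk: "T.mean k' + 1/4 \<le> a - 1/4" by simp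
    \<comment> \<open>The mean is now at most \<open>a - 1/2\<close>, a gap of \<open>1/4\<close>
      below the target \<open>a - 1/4\<close>, so \<open>40 * L\<close> Riccati steps bring the
      standard deviation under control as well.\<close>
    define K where "K = nat \<lceil>40 * L\<rceil>"
    have K: "40 * L \<le> K" "K \<le> 40 * L + 1" unfolding K_def using L by linarith+
    obtain j where j: "j \<le> k' + K" "T.mean j + sqrt (T.var j) \<le> a - 1/4"
      by (rule T.mean_plus_sd_decreases[where x = "1/4" and ?k0.0 = k' and T = "a - 1/4" and K = K]) (use mk K in auto)
    have "\<bar>T.mean j - a\<bar> \<le> L" by (rule T.mean_bounded)
    then have H: "a - 1/8 - T.mean j \<le> L" by linarith
    have "\<exists>X' Y'. large_block (100000 * sqrt R) X Y X' Y' \<and> potential (X' \<times> Y') M \<le> a - 1/8"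
    proof (rule tiltable_realize_potential[OF f1 XY1(3,4) tl, of "1/8" j "a - 1/8" L])
      fix X' Y' assume *: "X' \<subseteq> X1" "Y' \<subseteq> Y1" "X' \<noteq> {}" "Y' \<noteq> {}" "potential (X' \<times> Y') M \<le> a - 1/8"
        "1 / 8 / (2 * L) * real (card X1 * card Y1) / 5 ^ j \<le> real (card X' * card Y')"
      have e: "1 / 8 / (2 * L) = 1 / (16 * L)" by simp
      have "16 * L \<le> 2 powr 4 * 2 powr L"
        using le_two_powr[of L] L by (intro mult_mono) auto
      then have h: "16 * L \<le> 2 powr (4 + L)" by (simp add: powr_add)
      have lb: "large_block (1 + (4 + L) + 3 * real j) X Y X' Y'"
        by (rule large_blockI[OF order_trans[OF *(1) XY1(1)] order_trans[OF *(2) XY1(2)] *(3,4) n1 _ _ h])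
           (use *(6) L e in \<open>auto simp: N_def\<close>)
      have "x \<le> sqrt R * (1/11)" unfolding se(4) using se R_def by (intro mult_left_mono) auto
      then have "L \<le> 200 / 11 * sqrt R" by (simp add: L_def)
      moreover have "48 * L / se = 9600 * sqrt R" using se by (simp add: L_def)
      moreover have "1 \<le> sqrt R" by (simp add: R_def)
      moreover have "real j \<le> real k + real k1 + 2 * real q + real K" using j by (simp add: k'_def)
      ultimately have "1 + (4 + L) + 3 * real j \<le> 100000 * sqrt R"
        using k k1 q K by linarith
      then show ?thesis using lb large_block_mono * by blast
    qed (use j H in auto)
    then show ?thesis by (simp add: R_def)
  qed
qed

definition constant_on :: "'p set \<Rightarrow> ('p \<Rightarrow> real) \<Rightarrow> bool" where
  "constant_on S M \<longleftrightarrow> (\<exists>c. \<forall>p\<in>S. M p = c)"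

text \<open>By integrality, every entry different from \<open>a\<close> contributes at least
  \<open>1\<close> to the sum of squares, so these entries are few enough for the zero-block
  argument, applied to \<open>M - a\<close> with rank bound \<open>Suc r\<close>.\<close>

lemma nearly_constant_imp_block:
  fixes M :: "'a \<times> 'b \<Rightarrow> real" and a \<epsilon> :: real
  assumes fin: "finite X" "finite Y" "X \<noteq> {}" "Y \<noteq> {}" and lr: "lowrank r X Y M"
    and ints: "\<And>p. p \<in> X \<times> Y \<Longrightarrow> M p \<in> \<int>" and a: "a \<in> \<int>"
    and eps: "4 * real (Suc r) * \<epsilon> \<le> 1"
    and avg: "avg (X \<times> Y) (\<lambda>p. (M p - a)\<^sup>2) \<le> \<epsilon>"
  obtains X' Y' where "large_block 2 X Y X' Y'" "constant_on (X' \<times> Y') M"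
proof -
  define Z where "Z = {p \<in> X \<times> Y. M p - a \<noteq> 0}"
  have cN: "0 < real (card X)" "0 < real (card Y)" using fin by (auto simp: card_gt_0_iff)
  define N where "N = real (card X) * real (card Y)"
  have N: "0 < N" using cN by (simp add: N_def)
  have "real (card Z) = (\<Sum>p\<in>Z. 1)" by simp
  also have "\<dots> \<le> (\<Sum>p\<in>Z. (M p - a)\<^sup>2)"
  proof (rule sum_mono)
    fix p assume p: "p \<in> Z"
    have "M p - a \<in> \<int>" using p ints a by (auto simp: Z_def)
    then have "1 \<le> \<bar>M p - a\<bar>" using p by (intro Ints_nonzero_abs_ge1) (auto simp: Z_def)
    then have "1\<^sup>2 \<le> \<bar>M p - a\<bar>\<^sup>2" by (intro power_mono) auto
    then show "1 \<le> (M p - a)\<^sup>2" by simp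
  qed
  also have "\<dots> \<le> (\<Sum>p\<in>X\<times>Y. (M p - a)\<^sup>2)" using fin by (intro sum_mono2) (auto simp: Z_def)
  also have "\<dots> = avg (X \<times> Y) (\<lambda>p. (M p - a)\<^sup>2) * N"
    using cN by (simp add: avg_def N_def card_cartesian_product)
  also have "\<dots> \<le> \<epsilon> * N" using avg N by (intro mult_right_mono) auto
  finally have "4 * real (Suc r) * card Z \<le> 4 * real (Suc r) * (\<epsilon> * N)" by (intro mult_left_mono) auto
  also have "\<dots> \<le> 1 * N" unfolding mult.assoc[symmetric] using eps N by (intro mult_right_mono) auto
  finally have "4 * real (Suc r) * card Z \<le> real (card X * card Y)" by (simp add: N_def)
  then show thesis
  proof (rule lowrank_sparse_zero_block[OF fin(1,2,4) lowrank_minus_const[OF lr, of a], folded Z_def, rotated])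
    fix X' Y' assume *: "X' \<subseteq> X" "Y' \<subseteq> Y" "card X \<le> 2 * card X'" "card Y \<le> 2 * card Y'"
      "\<And>p. p \<in> X' \<times> Y' \<Longrightarrow> M p - a = 0"
    have "real (card X) * real (card Y) \<le> (2 * real (card X')) * (2 * real (card Y'))"
      using *(3,4) by (intro mult_mono) auto
    moreover have "X' \<noteq> {}" "Y' \<noteq> {}" using * cN by auto
    ultimately have "large_block 2 X Y X' Y'" using * by (simp add: large_block_def powr_minus_divide)
    moreover have "constant_on (X' \<times> Y') M" unfolding constant_on_def by (rule exI[of _ a]) (use *(5) in force)
    ultimately show thesis by (rule that)
  qed simp
qed

text \<open>\<open>n\<close> bounds the number of halvings of \<open>\<epsilon>\<close> before the
  rank argument applies. A halving costs in proportion to \<open>sqrt \<epsilon>\<close>, so the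
  costs form a geometric series; leaving through a potential drop or a constant block is paid
  once.\<close>

lemma plateau:
  fixes M :: "'a \<times> 'b \<Rightarrow> real" and a \<epsilon> :: real
  assumes "finite X" "finite Y" "X \<noteq> {}" "Y \<noteq> {}" "lowrank r X Y M"
    and "\<And>p. p \<in> X \<times> Y \<Longrightarrow> M p \<in> \<int>" and a: "a \<in> \<int>"
    and "\<epsilon> > 0" "\<epsilon> \<le> 1/128" "4 * real (Suc r) * \<epsilon> \<le> 2 ^ n"
    and "avg (X \<times> Y) (\<lambda>p. (M p - a)\<^sup>2) \<le> \<epsilon>"
  shows "\<exists>X' Y'. large_block (600000 * sqrt (Suc r * \<epsilon>) + 100000 * sqrt (Suc r) + 2) X Y X' Y' \<and>
     (constant_on (X' \<times> Y') M \<or> potential (X' \<times> Y') M \<le> a - 1/8)"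
  using assms(1-6,8-)
proof (induction n arbitrary: \<epsilon> X Y)
  case 0
  then have e: "4 * real (Suc r) * \<epsilon> \<le> 1" by simp
  obtain X' Y' where "large_block 2 X Y X' Y'" "constant_on (X' \<times> Y') M"
    by (rule nearly_constant_imp_block[OF 0(1-5) _ a e 0(10)]) (use 0(6) in auto)
  moreover have "2 \<le> 600000 * sqrt (Suc r * \<epsilon>) + 100000 * sqrt (Suc r) + 2" using 0(7) by simp
  ultimately show ?case using large_block_mono by blast
next
  case (Suc n)
  show ?case
  proof (cases "4 * real (Suc r) * \<epsilon> \<le> 1")
    case True
    obtain X' Y' where "large_block 2 X Y X' Y'" "constant_on (X' \<times> Y') M"
      by (rule nearly_constant_imp_block[OF Suc.prems(1-5) _ a True Suc.prems(10)]) (use Suc.prems(6) in auto)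
    moreover have "2 \<le> 600000 * sqrt (Suc r * \<epsilon>) + 100000 * sqrt (Suc r) + 2" using Suc.prems(7) by simp
    ultimately show ?thesis using large_block_mono by blast
  next
    case False
    then have e: "1 < 4 * Suc r * \<epsilon>" by simp
    have "(\<exists>X' Y'. large_block (150000 * sqrt (Suc r * \<epsilon>)) X Y X' Y' \<and> avg (X' \<times> Y') (\<lambda>p. (M p - a)\<^sup>2) \<le> \<epsilon> / 2)
       \<or> (\<exists>X' Y'. large_block (100000 * sqrt (Suc r)) X Y X' Y' \<and> potential (X' \<times> Y') M \<le> a - 1/8)"
      by (rule plateau_step[OF Suc.prems(1-5) _ a Suc.prems(7,8) e Suc.prems(10)]) (use Suc.prems(6) in auto)
    then show ?thesis
    proof (elim disjE exE conjE)
      fix X1 Y1 assume 1: "large_block (150000 * sqrt (Suc r * \<epsilon>)) X Y X1 Y1"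
        "avg (X1 \<times> Y1) (\<lambda>p. (M p - a)\<^sup>2) \<le> \<epsilon> / 2"
      have s: "X1 \<subseteq> X" "Y1 \<subseteq> Y" "X1 \<noteq> {}" "Y1 \<noteq> {}" using 1(1) by (auto simp: large_block_def)
      have "\<exists>X' Y'. large_block (600000 * sqrt (Suc r * (\<epsilon> / 2)) + 100000 * sqrt (Suc r) + 2) X1 Y1 X' Y' \<and>
          (constant_on (X' \<times> Y') M \<or> potential (X' \<times> Y') M \<le> a - 1/8)"
      proof (rule Suc.IH)
        show "finite X1" "finite Y1" using finite_subset s Suc.prems(1,2) by blast+
        show "lowrank r X1 Y1 M" by (rule lowrank_subset[OF Suc.prems(5) s(1,2)])
        show "M p \<in> \<int>" if "p \<in> X1 \<times> Y1" for p by (rule Suc.prems(6)) (use that s in auto)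
      qed (use s 1(2) Suc.prems in auto)
      then obtain X' Y' where 2: "large_block (600000 * sqrt (Suc r * (\<epsilon> / 2)) + 100000 * sqrt (Suc r) + 2) X1 Y1 X' Y'"
          "constant_on (X' \<times> Y') M \<or> potential (X' \<times> Y') M \<le> a - 1/8" by blast
      \<comment> \<open>The ratio \<open>1 / sqrt 2\<close> is rounded up to \<open>3/4\<close>, and
        \<open>150000 + 3/4 * 600000 = 600000\<close> closes the induction.\<close>
      have "sqrt (Suc r * (\<epsilon> / 2)) \<le> sqrt ((3/4)\<^sup>2 * (Suc r * \<epsilon>))"
        using Suc.prems(7) by (intro real_sqrt_le_mono) (simp add: power2_eq_square)
      also have "\<dots> = 3/4 * sqrt (Suc r * \<epsilon>)" by (simp add: real_sqrt_mult)
      finally have "sqrt (Suc r * (\<epsilon> / 2)) \<le> 3/4 * sqrt (Suc r * \<epsilon>)" .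
      then have "large_block (600000 * sqrt (Suc r * \<epsilon>) + 100000 * sqrt (Suc r) + 2) X Y X' Y'"
        by (intro large_block_mono[OF large_block_trans[OF 1(1) 2(1)]]) linarith
      then show ?thesis using 2(2) by blast
    next
      fix X' Y' assume 1: "large_block (100000 * sqrt (Suc r)) X Y X' Y'" "potential (X' \<times> Y') M \<le> a - 1/8"
      have "large_block (600000 * sqrt (Suc r * \<epsilon>) + 100000 * sqrt (Suc r) + 2) X Y X' Y'"
        by (rule large_block_mono[OF 1(1)]) (use Suc.prems(7) in simp)
      then show ?thesis using 1(2) by blast
    qed
  qed
qed

text \<open>If the standard deviation is at least \<open>1/16\<close>, the variance phase suffices.
  Otherwise the mean \<open>m\<close> is within \<open>1/16\<close> of an integer \<open>a\<close>,
  the mean square distance to \<open>a\<close> is at most \<open>1/128\<close>, and the plateau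
  argument applies.\<close>

lemma constant_or_potential_drop:
  fixes M :: "'a \<times> 'b \<Rightarrow> real"
  assumes fin: "finite X" "finite Y" "X \<noteq> {}" "Y \<noteq> {}" and lr: "lowrank r X Y M"
    and ints: "\<And>p. p \<in> X \<times> Y \<Longrightarrow> M p \<in> \<int>"
  shows "\<exists>X' Y'. large_block (160000 * sqrt (Suc r)) X Y X' Y' \<and>
     (constant_on (X' \<times> Y') M \<or> potential (X' \<times> Y') M \<le> potential (X \<times> Y) M - 1/128)"
proof (cases "avgvar (X \<times> Y) M \<ge> (1/16)\<^sup>2")
  case True
  then have v: "1/16 \<le> sqrt (avgvar (X \<times> Y) M)" by (rule real_le_rsqrt)
  then obtain X' Y' where 1: "large_block (12100 * sqrt (Suc r)) X Y X' Y'"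
      "potential (X' \<times> Y') M \<le> potential (X \<times> Y) M - sqrt (avgvar (X \<times> Y) M) / 8"
    by (elim variance_phase[OF fin lr refl, rotated]) linarith
  then have "potential (X' \<times> Y') M \<le> potential (X \<times> Y) M - 1/128" using v by linarith
  moreover have "large_block (160000 * sqrt (Suc r)) X Y X' Y'" by (rule large_block_mono[OF 1(1)]) simp
  ultimately show ?thesis by blast
next
  case False
  define m where "m = avg (X \<times> Y) M"
  define a where "a = real_of_int (round m)"
  have P: "finite (X \<times> Y)" "X \<times> Y \<noteq> {}" using fin by auto
  have a: "a \<in> \<int>" by (simp add: a_def)
  \<comment> \<open>No integer is closer to \<open>m\<close> than \<open>a\<close>, so every entry
    is at least as far from \<open>m\<close>, and the rounding error is bounded by the standard
    deviation.\<close>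
  have "(m - a)\<^sup>2 = avg (X \<times> Y) (\<lambda>p. (m - a)\<^sup>2)" by (rule avg_const[OF P, symmetric])
  also have "\<dots> \<le> avgvar (X \<times> Y) M" unfolding avgvar_def m_def[symmetric]
  proof (rule avg_mono)
    fix p assume "p \<in> X \<times> Y"
    then obtain z where z: "M p = of_int z" by (rule Ints_cases[OF ints])
    have "\<bar>m - a\<bar> \<le> \<bar>m - of_int z\<bar>" using round_diff_minimal[of m z] by (simp add: a_def abs_minus_commute)
    then show "(m - a)\<^sup>2 \<le> (M p - m)\<^sup>2" unfolding z by (simp add: abs_le_square_iff power2_commute)
  qed
  finally have ma: "(m - a)\<^sup>2 \<le> avgvar (X \<times> Y) M" .
  then have "(m - a)\<^sup>2 \<le> (1/16)\<^sup>2" using False by linarith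
  then have ma': "\<bar>m - a\<bar> \<le> 1/16" by (subst (asm) abs_le_square_iff[symmetric]) simp
  have "avg (X \<times> Y) (\<lambda>p. (M p - a)\<^sup>2) \<le> 1/128"
    unfolding avg_square_shift[OF P] m_def[symmetric] using ma False by (simp add: power_divide)
  moreover obtain n :: nat where n: "4 * real (Suc r) * (1/128) < 2 ^ n" using real_arch_pow[of 2 "4 * real (Suc r) * (1/128)"] by auto
  ultimately have "\<exists>X' Y'. large_block (600000 * sqrt (Suc r * (1/128)) + 100000 * sqrt (Suc r) + 2) X Y X' Y' \<and>
     (constant_on (X' \<times> Y') M \<or> potential (X' \<times> Y') M \<le> a - 1/8)"
    by (intro plateau[OF fin lr _ a, of "1/128" n]) (use ints in auto)
  then obtain X' Y' where 1: "large_block (600000 * sqrt (Suc r * (1/128)) + 100000 * sqrt (Suc r) + 2) X Y X' Y'"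
     "constant_on (X' \<times> Y') M \<or> potential (X' \<times> Y') M \<le> a - 1/8" by blast
  have "sqrt (Suc r * (1/128)) \<le> sqrt (Suc r * (1/11)\<^sup>2)"
    by (intro real_sqrt_le_mono mult_left_mono) (auto simp: power2_eq_square)
  also have "\<dots> = sqrt (Suc r) * (1/11)" unfolding real_sqrt_mult by simp
  finally have "600000 * sqrt (Suc r * (1/128)) + 100000 * sqrt (Suc r) + 2 \<le> 160000 * sqrt (Suc r)"
    using real_sqrt_ge_one[of "real (Suc r)"] by linarith
  then have "large_block (160000 * sqrt (Suc r)) X Y X' Y'" using large_block_mono 1(1) by blast
  moreover have "m \<le> potential (X \<times> Y) M" by (simp add: potential_def m_def avgvar_nonneg)
  then have "a - 1/8 \<le> potential (X \<times> Y) M - 1/128" using ma' by linarith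
  ultimately show ?thesis using 1(2) by (blast intro: order_trans)
qed

text \<open>Each round costs the same number of bits and either ends or lowers the potential by
  \<open>1/128\<close>. The case \<open>n = 0\<close> is impossible, because the potential of
  nonnegative entries is nonnegative.\<close>

lemma constant_block_by_potential:
  fixes M :: "'a \<times> 'b \<Rightarrow> real" and n :: nat
  assumes "finite X" "finite Y" "X \<noteq> {}" "Y \<noteq> {}" "lowrank r X Y M"
    and "\<And>p. p \<in> X \<times> Y \<Longrightarrow> M p \<in> \<int>" "\<And>p. p \<in> X \<times> Y \<Longrightarrow> 0 \<le> M p"
    and "potential (X \<times> Y) M < n / 128"
  shows "\<exists>X' Y'. large_block (160000 * sqrt (Suc r) * n) X Y X' Y' \<and> constant_on (X' \<times> Y') M"
  using assms
proof (induction n arbitrary: X Y)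
  case 0
  then show ?case using potential_nonneg[of "X \<times> Y" M] by force
next
  case (Suc n)
  define c where "c = 160000 * sqrt (Suc r)"
  have c: "0 \<le> c" by (simp add: c_def)
  obtain X1 Y1 where 1: "large_block c X Y X1 Y1"
     "constant_on (X1 \<times> Y1) M \<or> potential (X1 \<times> Y1) M \<le> potential (X \<times> Y) M - 1/128"
    using constant_or_potential_drop[OF Suc.prems(1-5)] Suc.prems(6) unfolding c_def by blast
  from 1(2) show ?case
  proof
    assume "constant_on (X1 \<times> Y1) M"
    moreover have "large_block (c * Suc n) X Y X1 Y1"
      by (rule large_block_mono[OF 1(1)]) (use c in \<open>simp add: algebra_simps\<close>)
    ultimately show ?thesis by (auto simp: c_def)
  next
    assume p: "potential (X1 \<times> Y1) M \<le> potential (X \<times> Y) M - 1/128"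
    have s: "X1 \<subseteq> X" "Y1 \<subseteq> Y" "X1 \<noteq> {}" "Y1 \<noteq> {}" using 1(1) by (auto simp: large_block_def)
    have "\<exists>X' Y'. large_block (160000 * sqrt (Suc r) * n) X1 Y1 X' Y' \<and> constant_on (X' \<times> Y') M"
    proof (rule Suc.IH)
      show "finite X1" "finite Y1" using finite_subset s Suc.prems(1,2) by blast+
      show "lowrank r X1 Y1 M" by (rule lowrank_subset[OF Suc.prems(5) s(1,2)])
      show "M p \<in> \<int>" if "p \<in> X1 \<times> Y1" for p by (rule Suc.prems(6)) (use that s in auto)
      show "0 \<le> M p" if "p \<in> X1 \<times> Y1" for p by (rule Suc.prems(7)) (use that s in auto)
      show "potential (X1 \<times> Y1) M < real n / 128" using p Suc.prems(8) by simp
    qed (use s in auto)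
    then obtain X' Y' where 2: "large_block (c * n) X1 Y1 X' Y'" "constant_on (X' \<times> Y') M"
      by (auto simp: c_def)
    have "large_block (c * Suc n) X Y X' Y'"
      by (rule large_block_mono[OF large_block_trans[OF 1(1) 2(1)]]) (simp add: algebra_simps)
    then show ?thesis using 2(2) by (auto simp: c_def)
  qed
qed

section \<open>Reduction to a bounded second moment\<close>

text \<open>Among the columns of sum at most twice the average, at most \<open>r\<close> generate
  the rest with coefficients in \<open>[-1, 1]\<close>. As the entries are nonnegative, each entry
  is at most the sum \<open>h i\<close> over these columns in its row, and Markov's inequality keeps
  the rows where \<open>h\<close> is small.\<close>

lemma mean_restriction_to_low_entries:
  fixes M :: "'a \<times> 'b \<Rightarrow> real" and t :: real
  assumes fin: "finite X" "finite Y" "X \<noteq> {}" "Y \<noteq> {}" and lr: "lowrank r X Y M" and r: "r \<ge> 1"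
    and nonneg: "\<And>p. p \<in> X \<times> Y \<Longrightarrow> 0 \<le> M p" and t: "t > 0" "avg (X \<times> Y) M \<le> t"
  obtains X' Y' where "large_block 2 X Y X' Y'" "\<And>p. p \<in> X' \<times> Y' \<Longrightarrow> M p \<le> 4 * real r * t"
    "avg (X' \<times> Y') M \<le> 4 * t"
proof -
  have cN: "0 < real (card X)" "0 < real (card Y)" using fin by (auto simp: card_gt_0_iff)
  define f where "f j = (\<Sum>i\<in>X. M (i,j))" for j
  have f0: "0 \<le> f j" if "j \<in> Y" for j unfolding f_def using that nonneg by (intro sum_nonneg) auto
  have "sum f Y = (\<Sum>i\<in>X. \<Sum>j\<in>Y. M (i,j))" unfolding f_def by (rule sum.swap)
  also have "\<dots> = sum M (X \<times> Y)" by (simp add: sum.cartesian_product case_prod_unfold)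
  also have "\<dots> = avg (X \<times> Y) M * (real (card X) * real (card Y))" using cN by (simp add: avg_def card_cartesian_product)
  also have "\<dots> \<le> t * (real (card X) * real (card Y))" using t cN by (intro mult_right_mono) auto
  finally have sf: "sum f Y \<le> card Y * (t * card X)" by (simp add: mult_ac)
  define Y1 where "Y1 = {j\<in>Y. f j \<le> (t * card X) / (1/2)}"
  have cY1: "(1 - 1/2) * real (card Y) \<le> card Y1" unfolding Y1_def
    by (rule card_le_markov[OF fin(2) f0 sf]) (use t cN in auto)
  have Y1: "Y1 \<subseteq> Y" by (auto simp: Y1_def)
  have fY1: "finite Y1" using finite_subset[OF Y1 fin(2)] .
  show thesis
  proof (rule lowrank_bounded_basis[OF fY1 lowrank_subset[OF lr order_refl Y1]])
    fix s g c
    assume s: "s \<le> r" and g: "\<And>q. q < s \<Longrightarrow> g q \<in> Y1"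
      and c: "\<And>j q. j \<in> Y1 \<Longrightarrow> q < s \<Longrightarrow> \<bar>c j q\<bar> \<le> 1"
      and rep: "\<And>i j. i \<in> X \<Longrightarrow> j \<in> Y1 \<Longrightarrow> M (i,j) = (\<Sum>q<s. c j q * M (i, g q))"
    define h where "h i = (\<Sum>q<s. M (i, g q))" for i
    have h0: "0 \<le> h i" if "i \<in> X" for i unfolding h_def using that g Y1 nonneg by (intro sum_nonneg) auto
    have "sum h X = (\<Sum>q<s. f (g q))" unfolding f_def h_def by (rule sum.swap)
    also have "\<dots> \<le> (\<Sum>q<s. 2 * t * card X)" using g by (intro sum_mono) (auto simp: Y1_def mult_ac)
    also have "\<dots> = real s * (2 * t * card X)" by simp
    also have "\<dots> \<le> real r * (2 * t * card X)" using s t by (intro mult_right_mono) auto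
    finally have sh: "sum h X \<le> card X * (2 * real r * t)" by (simp add: mult_ac)
    define X1 where "X1 = {i\<in>X. h i \<le> (2 * real r * t) / (1/2)}"
    have cX1: "(1 - 1/2) * real (card X) \<le> card X1" unfolding X1_def
      by (rule card_le_markov[OF fin(1) h0 sh]) (use t r in auto)
    have X1: "X1 \<subseteq> X" by (auto simp: X1_def)
    have cc: "0 < real (card X1)" "0 < real (card Y1)" using cX1 cY1 cN by auto
    show thesis
    proof (rule that[of X1 Y1])
      have "((1 - 1/2) * real (card X)) * ((1 - 1/2) * real (card Y)) \<le> real (card X1) * real (card Y1)"
        by (intro mult_mono cX1 cY1) auto
      then show "large_block 2 X Y X1 Y1"
        using X1 Y1 cc by (auto simp: large_block_def powr_minus_divide)
      fix p assume p: "p \<in> X1 \<times> Y1"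
      then obtain i j where ij: "p = (i,j)" "i \<in> X1" "j \<in> Y1" by auto
      then have iX: "i \<in> X" using X1 by auto
      have "M (i,j) = (\<Sum>q<s. c j q * M (i, g q))" by (rule rep[OF iX ij(3)])
      also have "\<dots> \<le> (\<Sum>q<s. 1 * M (i, g q))"
      proof (intro sum_mono mult_right_mono)
        fix q assume "q \<in> {..<s}"
        then have q: "q < s" by simp
        show "c j q \<le> 1" using c[OF ij(3) q] by simp
        show "0 \<le> M (i, g q)" using g[OF q] iX Y1 by (intro nonneg) auto
      qed
      also have "\<dots> = h i" by (simp add: h_def)
      also have "\<dots> \<le> 4 * real r * t" using ij(2) by (simp add: X1_def)
      finally show "M p \<le> 4 * real r * t" by (simp add: ij)
    next
      have "sum M (X1 \<times> Y1) = (\<Sum>i\<in>X1. \<Sum>j\<in>Y1. M (i,j))" by (simp add: sum.cartesian_product case_prod_unfold)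
      also have "\<dots> = (\<Sum>j\<in>Y1. \<Sum>i\<in>X1. M (i,j))" by (rule sum.swap)
      also have "\<dots> \<le> (\<Sum>j\<in>Y1. f j)" unfolding f_def
        using fin X1 Y1 nonneg by (intro sum_mono sum_mono2) auto
      also have "\<dots> \<le> (\<Sum>j\<in>Y1. 2 * t * card X)" by (intro sum_mono) (auto simp: Y1_def mult_ac)
      also have "\<dots> = card Y1 * (2 * t * card X)" by simp
      also have "\<dots> \<le> card Y1 * (2 * t * (2 * card X1))" using t cX1 by (intro mult_left_mono) auto
      finally show "avg (X1 \<times> Y1) M \<le> 4 * t"
        using cc by (simp add: avg_def card_cartesian_product field_simps)
    qed
  qed
qed

text \<open>The slack in the mean and the cost both decay geometrically in \<open>i\<close>, so that iterating the
  step from a large second moment costs only \<open>O(\<surd>r)\<close> in total.\<close>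

lemma second_moment_step:
  fixes M :: "'a \<times> 'b \<Rightarrow> real" and \<tau> :: real
  assumes fin: "finite X" "finite Y" "X \<noteq> {}" "Y \<noteq> {}" and lr: "lowrank r X Y M" and r: "r \<ge> 1"
    and nonneg: "\<And>p. p \<in> X \<times> Y \<Longrightarrow> 0 \<le> M p" and \<tau>: "\<tau> > 0"
    and m1: "avg (X \<times> Y) M \<le> \<tau> * (1 + 1 / 2 ^ Suc i)"
    and m2: "avg (X \<times> Y) (\<lambda>p. (M p)\<^sup>2) \<le> 4096 * \<tau>\<^sup>2 * 64 ^ Suc i"
    and ri: "8 ^ i \<le> sqrt r"
  obtains X' Y' where "large_block (166000 * sqrt r / 2 ^ Suc i) X Y X' Y'"
    "avg (X' \<times> Y') M \<le> \<tau> * (1 + 1 / 2 ^ i)"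
    "avg (X' \<times> Y') (\<lambda>p. (M p)\<^sup>2) \<le> 4096 * \<tau>\<^sup>2 * 64 ^ i"
proof -
  \<comment> \<open>\<open>e\<close> is the slack in the mean at level \<open>i + 1\<close>; the
    second-moment bound there is \<open>4096 * \<tau>^2 / e^6\<close>. The share
    \<open>\<eta>\<close> of discarded rows and columns is proportional to \<open>e\<close>, which
    makes \<open>L\<close> of order \<open>s * \<tau> / e^4\<close>.\<close>
  define e where "e = 1 / (2::real) ^ Suc i"
  have e: "0 < e" "e \<le> 1/2" by (auto simp: e_def)
  define \<eta> where "\<eta> = e / 16"
  have \<eta>: "0 < \<eta>" "\<eta> \<le> 1/32" using e by (auto simp: \<eta>_def)
  define s where "s = sqrt r"
  have s1: "1 \<le> s" using r by (simp add: s_def)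
  define W where "W = 4096 * \<tau>\<^sup>2 * 64 ^ Suc i"
  have W0: "0 < W" using \<tau> by (simp add: W_def)
  have "(64::real) ^ Suc i = ((2::real) ^ 6) ^ Suc i" by simp
  also have "\<dots> = ((2::real) ^ Suc i) ^ 6" by (simp only: power_mult[symmetric] mult.commute)
  also have "\<dots> = 1 / e ^ 6" by (simp add: e_def power_divide)
  finally have W: "W = 4096 * \<tau>\<^sup>2 / e ^ 6" by (simp add: W_def)
  also have "\<dots> = (64 * \<tau> / e ^ 3)\<^sup>2" by (simp add: power_divide power_mult_distrib flip: power_mult)
  finally have W2: "W = (64 * \<tau> / e ^ 3)\<^sup>2" .
  define L where "L = 1024 * s * \<tau> / e ^ 4"
  have L: "sqrt (r * W) / \<eta> = L"
  proof -
    have "sqrt W = 64 * \<tau> / e ^ 3" unfolding W2 using \<tau> e by (intro real_sqrt_unique) auto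
    then have "sqrt (r * W) = s * (64 * \<tau> / e ^ 3)" by (simp add: real_sqrt_mult s_def)
    then show ?thesis using e by (simp add: L_def \<eta>_def power_numeral_reduce)
  qed
  have cN: "0 < real (card X)" "0 < real (card Y)" using fin by (auto simp: card_gt_0_iff)
  define N where "N = real (card X) * real (card Y)"
  have N: "0 < N" using cN by (simp add: N_def)
  have W': "(\<Sum>p\<in>X\<times>Y. (M p)\<^sup>2) \<le> W * (card X * card Y)"
    using m2 cN by (simp add: avg_def card_cartesian_product W_def field_simps)
  show thesis
  proof (rule tiltable_restriction[OF fin lr r W0 W' \<eta>(1), unfolded L])
    fix X1 Y1 assume XY1: "X1 \<subseteq> X" "Y1 \<subseteq> Y" and cX: "(1 - \<eta>) * real (card X) \<le> real (card X1)"
      and cY: "(1 - \<eta>) * real (card Y) \<le> real (card Y1)" and tl: "tiltable X1 Y1 M L"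
    have nonneg1: "0 \<le> M p" if "p \<in> X1 \<times> Y1" for p by (rule nonneg) (use that XY1 in auto)
    define N1 where "N1 = real (card X1) * real (card Y1)"
    have "((1 - \<eta>) * real (card X)) * ((1 - \<eta>) * real (card Y)) \<le> N1"
      unfolding N1_def using \<eta> by (intro mult_mono cX cY) auto
    then have NN1: "(1 - \<eta>)\<^sup>2 * N \<le> N1" by (simp add: N_def power2_eq_square mult_ac)
    have eta2: "1 - 2 * \<eta> \<le> (1 - \<eta>)\<^sup>2" by (simp add: power2_eq_square algebra_simps)
    then have eta3: "1/2 \<le> (1 - \<eta>)\<^sup>2" using \<eta> by linarith
    have "1/2 * N \<le> (1 - \<eta>)\<^sup>2 * N" using eta3 N by (intro mult_right_mono) auto
    then have n1: "real (card X) * real (card Y) \<le> 2 * N1" using NN1 by (simp add: N_def)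
    have N1: "0 < N1" using n1 N by (simp add: N_def)
    then have ne1: "X1 \<noteq> {}" "Y1 \<noteq> {}" by (auto simp: N1_def)
    have f1: "finite X1" "finite Y1" using finite_subset[OF XY1(1) fin(1)] finite_subset[OF XY1(2) fin(2)] .
    have tl0: "tiltable X1 Y1 (\<lambda>p. M p - 0) L" using tl by simp
    interpret T: tilting "X1 \<times> Y1" M 0 L
      using f1 ne1 tl0 by unfold_locales (auto simp: tiltable_def)
    \<comment> \<open>Sums of nonnegative entries only shrink under restriction, so
      \<open>\<mu>\<close> bounds the mean afterwards. With the further factor
      \<open>1 + \<eta>\<close> from the realization it stays within the doubled slack of level
      \<open>i\<close>.\<close>
    define \<mu> where "\<mu> = \<tau> * (1 + e) / (1 - \<eta>)\<^sup>2"
    have \<mu>0: "0 < \<mu>" using \<tau> e \<eta> by (simp add: \<mu>_def)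
    have "sum M (X1 \<times> Y1) \<le> sum M (X \<times> Y)" using fin XY1 nonneg by (intro sum_mono2) auto
    also have "\<dots> = avg (X \<times> Y) M * N" using cN by (simp add: avg_def card_cartesian_product N_def)
    also have "\<dots> \<le> \<tau> * (1 + e) * N" using m1 N by (intro mult_right_mono) (auto simp: e_def)
    also have "\<dots> = \<mu> * ((1 - \<eta>)\<^sup>2 * N)" using \<eta> by (simp add: \<mu>_def)
    also have "\<dots> \<le> \<mu> * N1" using NN1 \<mu>0 by (intro mult_left_mono) auto
    finally have "avg (X1 \<times> Y1) M \<le> \<mu>" using N1 by (simp add: avg_def card_cartesian_product N1_def divide_le_eq)
    then have mean0: "T.mean 0 \<le> \<mu>" by (simp add: T.mean_def T.E_def T.total_def avg_def)
    have "(1 + \<eta>) \<le> (1 + 4 * \<eta>) * (1 - \<eta>)\<^sup>2"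
    proof -
      have "0 \<le> \<eta> * (1 - 7 * \<eta> + 4 * \<eta>\<^sup>2)" using \<eta> by (intro mult_nonneg_nonneg add_nonneg_nonneg) auto
      then show ?thesis by (simp add: power2_eq_square algebra_simps)
    qed
    then have "\<tau> * (1 + e) * (1 + \<eta>) \<le> \<tau> * (1 + e) * ((1 + 4 * \<eta>) * (1 - \<eta>)\<^sup>2)"
      using \<tau> e by (intro mult_left_mono) auto
    then have "\<mu> * (1 + \<eta>) \<le> \<tau> * (1 + e) * (1 + 4 * \<eta>)"
      using \<eta> by (simp add: \<mu>_def divide_le_eq mult_ac)
    also have "\<dots> = \<tau> * ((1 + e) * (1 + e / 4))" by (simp add: \<eta>_def)
    also have "\<dots> \<le> \<tau> * (1 + 2 * e)"
    proof -
      have "e * e \<le> e * 1" using e by (intro mult_left_mono) auto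
      then have "(1 + e) * (1 + e / 4) \<le> 1 + 2 * e" using e by (simp add: algebra_simps)
      then show ?thesis using \<tau> by (intro mult_left_mono) auto
    qed
    finally have \<mu>1: "\<mu> * (1 + \<eta>) \<le> \<tau> * (1 + 2 * e)" .
    have \<mu>2: "\<mu> \<le> 2 * \<tau>"
    proof -
      have "\<mu> * 1 \<le> \<mu> * (1 + \<eta>)" using \<mu>0 \<eta> by (intro mult_left_mono) auto
      also have "\<dots> \<le> \<tau> * 2" using \<mu>1 e \<tau> mult_left_mono[of "1 + 2 * e" 2 \<tau>] by linarith
      finally show ?thesis by simp
    qed
    \<comment> \<open>Chosen so that \<open>18 * L * \<tau> / K\<close> is at most
      \<open>\<tau>^2 / (3 * e^5)\<close>. The number of steps is proportional to
      \<open>s * e\<close>, hence geometric in \<open>i\<close>.\<close>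
    define K where "K = nat \<lceil>55296 * s * e\<rceil>"
    have se: "0 < 55296 * s * e" using s1 e by simp
    then have K: "55296 * s * e \<le> K" "K \<le> 55296 * s * e + 1" unfolding K_def by linarith+
    have K0: "K > 0" using K se by linarith
    obtain k where k: "k < K" "T.var k \<le> 9 * L * T.mean 0 / K" "T.mean k \<le> T.mean 0"
      by (rule T.small_var_exists[OF _ K0]) (use nonneg1 in auto)
    have "0 < L" using s1 \<tau> e by (simp add: L_def)
    then have "9 * L * T.mean 0 / K \<le> 9 * L * (2 * \<tau>) / (55296 * s * e)"
      using mean0 \<mu>2 K se \<tau> by (intro frac_le mult_left_mono mult_nonneg_nonneg) auto
    also have "\<dots> = (1/3) * (\<tau>\<^sup>2 / e ^ 5)"
      using s1 e by (simp add: L_def power_numeral_reduce)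
    finally have var: "T.var k \<le> (1/3) * (\<tau>\<^sup>2 / e ^ 5)" using k(2) by linarith
    have mk: "0 \<le> T.mean k" "T.mean k \<le> \<mu>"
      using k(3) mean0 T.E_mono[of "\<lambda>_. 0" M k] nonneg1 by (auto simp: T.mean_def T.E_const)
    have "(T.mean k)\<^sup>2 \<le> (2 * \<tau>)\<^sup>2" using mk \<mu>2 by (intro power_mono) auto
    also have "(2 * \<tau>)\<^sup>2 = (1/8) * (\<tau>\<^sup>2 / (1/2) ^ 5)" by (simp add: power2_eq_square power_numeral_reduce)
    also have "\<dots> \<le> (1/8) * (\<tau>\<^sup>2 / e ^ 5)"
      using e by (intro mult_left_mono divide_left_mono power_mono) auto
    finally have "(T.mean k)\<^sup>2 \<le> (1/8) * (\<tau>\<^sup>2 / e ^ 5)" .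
    moreover have "0 \<le> \<tau>\<^sup>2 / e ^ 5" using e by simp
    ultimately have "T.E k (\<lambda>p. (M p - 0)\<^sup>2) \<le> \<tau>\<^sup>2 / e ^ 5"
      unfolding T.E_square_shift using var by simp
    then have "128 / W * T.E k (\<lambda>p. (M p)\<^sup>2) \<le> 128 / W * (\<tau>\<^sup>2 / e ^ 5)"
      using W0 by (intro mult_left_mono) auto
    also have "\<dots> = \<eta> / 2" unfolding W \<eta>_def using e \<tau> by (simp add: power_numeral_reduce)
    finally have E2: "128 / W * T.E k (\<lambda>p. (M p)\<^sup>2) \<le> \<eta> / 2" .
    \<comment> \<open>One functional controls both moments: a nonnegative average of
      \<open>A\<close> forces the mean below \<open>\<mu> * (1 + \<eta>)\<close> and the second
      moment below \<open>W / 64\<close>, the bound of the next level.\<close>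
    define A where "A p = (1 + \<eta>) - 1 / \<mu> * M p - 128 / W * (M p)\<^sup>2" for p
    have "1 / \<mu> * T.mean k \<le> 1" using mk \<mu>0 by simp
    then have EA: "\<eta> / 2 \<le> T.E k A"
      unfolding A_def T.E_diff T.E_cmult T.E_const using E2 by (simp add: T.mean_def)
    have A2: "A p \<le> 2" if "p \<in> X1 \<times> Y1" for p
    proof -
      have "0 \<le> 1 / \<mu> * M p" using nonneg1[OF that] \<mu>0 by simp
      moreover have "0 \<le> 128 / W * (M p)\<^sup>2" using W0 by simp
      ultimately show ?thesis using \<eta> by (simp add: A_def)
    qed
    show thesis
    proof (rule tiltable_realize[OF f1 ne1 tl0 _ EA A2])
      show "0 < \<eta> / 2" using \<eta> by simp
      fix X' Y' assume *: "X' \<subseteq> X1" "Y' \<subseteq> Y1" "X' \<noteq> {}" "Y' \<noteq> {}" "0 < sum A (X' \<times> Y')"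
        "\<eta> / 2 / 2 * real (card X1 * card Y1) / 5 ^ k \<le> real (card X' * card Y')"
      have eq: "\<eta> / 2 / 2 = 1 / (64 / e)" by (simp add: \<eta>_def)
      have b5: "1 / (64 / e) * N1 / 5 ^ k \<le> real (card X') * real (card Y')"
        using *(6) unfolding eq N1_def of_nat_mult .
      have "64 / e = 2 ^ 6 * 2 ^ Suc i" by (simp add: e_def)
      also have "\<dots> = 2 powr (7 + real i)" by (simp add: powr_add powr_realpow)
      finally have Q: "64 / e \<le> 2 powr (7 + real i)" by simp
      have "large_block (1 + (7 + real i) + 3 * real k) X Y X' Y'"
        by (rule large_blockI[OF order_trans[OF *(1) XY1(1)] order_trans[OF *(2) XY1(2)] *(3,4) n1 b5 _ Q])
           (use e in simp)
      \<comment> \<open>The condition \<open>8 ^ i \<le> sqrt r\<close> makes \<open>s * e\<close>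
        at least \<open>4 ^ i / 2\<close>, which absorbs the bits independent of the number of
        tilting steps.\<close>
      moreover have "1 + (7 + real i) + 3 * real k \<le> 166000 * (s * e)"
      proof -
        have "8 ^ i * e \<le> s * e" using ri e by (intro mult_right_mono) (auto simp: s_def)
        moreover have "(8::real) ^ i * e = 4 ^ i / 2"
          unfolding e_def by (simp add: power_divide[symmetric])
        moreover have "1 + real i * 3 \<le> 4 ^ i" using Bernoulli_inequality[of 3 i] by simp
        moreover have "real k \<le> 55296 * (s * e) + 1" using k(1) K by simp
        ultimately show ?thesis by linarith
      qed
      ultimately have lb: "large_block (166000 * (s * e)) X Y X' Y'" by (rule large_block_mono)
      have fs: "finite (X' \<times> Y')" "X' \<times> Y' \<noteq> {}"
        using * finite_subset[OF *(1) f1(1)] finite_subset[OF *(2) f1(2)] by auto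
      then have "0 \<le> avg (X' \<times> Y') A" using * by (simp add: avg_def)
      also have "\<dots> = (1 + \<eta>) - 1 / \<mu> * avg (X' \<times> Y') M - 128 / W * avg (X' \<times> Y') (\<lambda>p. (M p)\<^sup>2)"
        unfolding A_def avg_diff avg_cmult avg_const[OF fs] ..
      finally have sum1: "1 / \<mu> * avg (X' \<times> Y') M + 128 / W * avg (X' \<times> Y') (\<lambda>p. (M p)\<^sup>2) \<le> 1 + \<eta>" by simp
      have "0 \<le> avg (X' \<times> Y') M" by (rule avg_nonneg, rule nonneg1) (use * in auto)
      then have p1: "0 \<le> 1 / \<mu> * avg (X' \<times> Y') M" using \<mu>0 by simp
      have "0 \<le> avg (X' \<times> Y') (\<lambda>p. (M p)\<^sup>2)" by (rule avg_nonneg) auto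
      then have p2: "0 \<le> 128 / W * avg (X' \<times> Y') (\<lambda>p. (M p)\<^sup>2)" using W0 by simp
      have "1 / \<mu> * avg (X' \<times> Y') M \<le> 1 + \<eta>" using sum1 p2 by linarith
      then have "avg (X' \<times> Y') M \<le> \<mu> * (1 + \<eta>)" using \<mu>0 by (simp add: field_simps)
      also note \<mu>1
      also have "\<tau> * (1 + 2 * e) = \<tau> * (1 + 1 / 2 ^ i)" by (simp add: e_def)
      finally have c1: "avg (X' \<times> Y') M \<le> \<tau> * (1 + 1 / 2 ^ i)" .
      have "128 / W * avg (X' \<times> Y') (\<lambda>p. (M p)\<^sup>2) \<le> 2" using sum1 p1 \<eta> by linarith
      then have "avg (X' \<times> Y') (\<lambda>p. (M p)\<^sup>2) \<le> W / 64" using W0 by (simp add: field_simps)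
      also have "W / 64 = 4096 * \<tau>\<^sup>2 * 64 ^ i" by (simp add: W_def)
      finally have c2: "avg (X' \<times> Y') (\<lambda>p. (M p)\<^sup>2) \<le> 4096 * \<tau>\<^sup>2 * 64 ^ i" .
      have "166000 * sqrt r / 2 ^ Suc i = 166000 * (s * e)" by (simp add: s_def e_def)
      then show thesis using that[OF _ c1 c2] lb by simp
    qed
  qed
qed

text \<open>The costs \<open>166000 * sqrt r / 2 ^ Suc i\<close> for \<open>i < j\<close> add up to
  the stated bound, and the slack in the mean ends at \<open>2 * \<tau>\<close>.\<close>

lemma second_moment_descent:
  fixes M :: "'a \<times> 'b \<Rightarrow> real" and \<tau> :: real
  assumes "finite X" "finite Y" "X \<noteq> {}" "Y \<noteq> {}" "lowrank r X Y M" and r: "r \<ge> 1"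
    and "\<And>p. p \<in> X \<times> Y \<Longrightarrow> 0 \<le> M p" and \<tau>: "\<tau> > 0"
    and "avg (X \<times> Y) M \<le> \<tau> * (1 + 1 / 2 ^ j)"
    and "avg (X \<times> Y) (\<lambda>p. (M p)\<^sup>2) \<le> 4096 * \<tau>\<^sup>2 * 64 ^ j"
    and "\<And>i. i < j \<Longrightarrow> 8 ^ i \<le> sqrt r"
  shows "\<exists>X' Y'. large_block (166000 * sqrt r * (1 - 1 / 2 ^ j)) X Y X' Y' \<and>
    avg (X' \<times> Y') M \<le> 2 * \<tau> \<and> avg (X' \<times> Y') (\<lambda>p. (M p)\<^sup>2) \<le> 4096 * \<tau>\<^sup>2"
  using assms(1-5,7,9-)
proof (induction j arbitrary: X Y)
  case 0
  then show ?case by (intro exI[of _ X] exI[of _ Y]) (auto simp: large_block_refl)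
next
  case (Suc j)
  obtain X1 Y1 where 1: "large_block (166000 * sqrt r / 2 ^ Suc j) X Y X1 Y1"
    "avg (X1 \<times> Y1) M \<le> \<tau> * (1 + 1 / 2 ^ j)"
    "avg (X1 \<times> Y1) (\<lambda>p. (M p)\<^sup>2) \<le> 4096 * \<tau>\<^sup>2 * 64 ^ j"
    by (rule second_moment_step[OF Suc.prems(1-5) r _ \<tau> Suc.prems(7,8)]) (use Suc.prems(6,9) in auto)
  have s: "X1 \<subseteq> X" "Y1 \<subseteq> Y" "X1 \<noteq> {}" "Y1 \<noteq> {}" using 1(1) by (auto simp: large_block_def)
  have "\<exists>X' Y'. large_block (166000 * sqrt r * (1 - 1 / 2 ^ j)) X1 Y1 X' Y' \<and>
    avg (X' \<times> Y') M \<le> 2 * \<tau> \<and> avg (X' \<times> Y') (\<lambda>p. (M p)\<^sup>2) \<le> 4096 * \<tau>\<^sup>2"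
  proof (rule Suc.IH)
    show "finite X1" "finite Y1" using finite_subset s Suc.prems(1,2) by blast+
    show "lowrank r X1 Y1 M" by (rule lowrank_subset[OF Suc.prems(5) s(1,2)])
    show "0 \<le> M p" if "p \<in> X1 \<times> Y1" for p by (rule Suc.prems(6)) (use that s in auto)
    show "8 ^ i \<le> sqrt r" if "i < j" for i by (rule Suc.prems(9)) (use that in auto)
  qed (use s 1 in auto)
  then obtain X' Y' where 2: "large_block (166000 * sqrt r * (1 - 1 / 2 ^ j)) X1 Y1 X' Y'"
    "avg (X' \<times> Y') M \<le> 2 * \<tau>" "avg (X' \<times> Y') (\<lambda>p. (M p)\<^sup>2) \<le> 4096 * \<tau>\<^sup>2" by blast
  have "166000 * sqrt r / 2 ^ Suc j + 166000 * sqrt r * (1 - 1 / 2 ^ j) = 166000 * sqrt r * (1 - 1 / 2 ^ Suc j)"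
    by (simp add: algebra_simps)
  then show ?case using large_block_trans[OF 1(1) 2(1)] 2(2,3) by auto
qed

section \<open>Real rank and submatrices\<close>

text \<open>A maximal independent set of columns has as many elements as the rank and spans all
  columns, so the expansion coefficients of the columns give the factorization.\<close>

lemma lowrank_real_rank:
  fixes M :: "nat mat"
  assumes M: "M \<in> carrier_mat m n"
  shows "lowrank (real_rank M) {..<m} {..<n} (\<lambda>(i,j). real (M $$ (i,j)))"
proof -
  define A where "A = map_mat real M"
  have A: "A \<in> carrier_mat m n" using M by (simp add: A_def)
  interpret vec_space "TYPE(real)" m .
  define C where "C = set (cols A)"
  have C: "finite C" "C \<subseteq> carrier_vec m" using cols_dim[of A] A by (auto simp: C_def)
  obtain S where "finite S" and mx: "maximal S (\<lambda>T. T \<subseteq> C \<and> lin_indpt T)"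
    using maximal_exists_superset[of C "\<lambda>T. T \<subseteq> C \<and> lin_indpt T" "{}"] C by (auto simp: lin_dep_def)
  have S: "S \<subseteq> C" "lin_indpt S" using mx by (auto simp: maximal_def)
  have SC: "S \<subseteq> carrier_vec m" using S C by auto
  have rk: "real_rank M = card S"
    using rank_card_indpt[OF A mx[unfolded C_def]] M by (simp add: real_rank_def A_def)
  have span: "v \<in> span S" if v: "v \<in> C" for v
  proof (rule ccontr)
    assume nv: "v \<notin> span S"
    have vS: "v \<notin> S" using nv span_mem[of S v] SC by auto
    have "lin_indpt (S \<union> {v})"
      using lin_dep_iff_in_span[OF SC S(2) _ vS] nv v C by auto
    then have "S \<union> {v} = S"
      using mx S v unfolding maximal_def by (metis (no_types, lifting) Un_insert_right insert_subset sup_bot_right subset_insertI)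
    then show False using vS by auto
  qed
  have "\<forall>v\<in>C. \<exists>a. lincomb a S = v"
    using finite_in_span[OF \<open>finite S\<close>] SC span by auto
  then obtain a where a: "\<And>v. v \<in> C \<Longrightarrow> lincomb (a v) S = v" by metis
  obtain h where h: "bij_betw h {..<card S} S"
    using ex_bij_betw_nat_finite[OF \<open>finite S\<close>] by (auto simp: atLeast0LessThan)
  show ?thesis unfolding lowrank_def rk
  proof (rule exI[of _ "\<lambda>i k. h k $ i"], rule exI[of _ "\<lambda>k j. a (col A j) (h k)"], intro ballI)
    fix i j assume ij: "i \<in> {..<m}" "j \<in> {..<n}"
    have cC: "col A j \<in> C" using ij A by (auto simp: C_def cols_def)
    have "real (M $$ (i,j)) = col A j $ i" using ij A M by (simp add: A_def)
    also have "\<dots> = lincomb (a (col A j)) S $ i" by (simp add: a[OF cC])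
    also have "\<dots> = (\<Sum>x\<in>S. a (col A j) x * x $ i)" using ij SC by (intro lincomb_index) auto
    also have "\<dots> = (\<Sum>k<card S. a (col A j) (h k) * h k $ i)" by (rule sum.reindex_bij_betw[OF h, symmetric])
    finally show "(case (i,j) of (i,j) \<Rightarrow> real (M $$ (i,j))) = (\<Sum>k<card S. h k $ i * a (col A j) (h k))"
      by (simp add: mult.commute)
  qed
qed

section \<open>Submatrices and composition of the phases\<close>

lemma constant_submatrix:
  fixes M :: "nat mat"
  assumes M: "M \<in> carrier_mat m n" and I: "I \<subseteq> {..<m}" and J: "J \<subseteq> {..<n}"
    and c: "\<And>i j. i \<in> I \<Longrightarrow> j \<in> J \<Longrightarrow> M $$ (i,j) = c"
  shows "constant_mat (submatrix M I J)" "dim_row (submatrix M I J) = card I" "dim_col (submatrix M I J) = card J"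
proof -
  have IJ: "{i. i < dim_row M \<and> i \<in> I} = I" "{j. j < dim_col M \<and> j \<in> J} = J" using M I J by auto
  then show d: "dim_row (submatrix M I J) = card I" "dim_col (submatrix M I J) = card J"
    by (simp_all add: dim_submatrix)
  show "constant_mat (submatrix M I J)" unfolding constant_mat_def d
  proof (intro exI allI impI)
    fix i j assume "i < card I" "j < card J"
    then show "submatrix M I J $$ (i,j) = c"
      by (simp add: submatrix_index IJ c pick_in_set_le)
  qed
qed

text \<open>Three phases: bounding the entries by \<open>O(r * t)\<close>, lowering the second
  moment to \<open>O(t^2)\<close>, and \<open>O(t)\<close> rounds of potential decrease. The last
  phase dominates the cost.\<close>

lemma constant_block_nat_matrix:
  fixes M :: "'a \<times> 'b \<Rightarrow> real" and t :: real
  assumes fin: "finite X" "finite Y" "X \<noteq> {}" "Y \<noteq> {}" and lr: "lowrank r X Y M" and r: "r \<ge> 1"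
    and nat: "\<And>p. p \<in> X \<times> Y \<Longrightarrow> M p \<in> \<nat>" and t: "t \<ge> 1" "avg (X \<times> Y) M \<le> t"
  obtains X' Y' where "large_block (10 ^ 10 * t * sqrt r) X Y X' Y'" "constant_on (X' \<times> Y') M"
proof -
  have nonneg: "0 \<le> M p" and ints: "M p \<in> \<int>" if "p \<in> X \<times> Y" for p
    using nat[OF that] by (auto simp: Nats_altdef2)
  obtain X1 Y1 where b1: "large_block 2 X Y X1 Y1"
    and up: "\<And>p. p \<in> X1 \<times> Y1 \<Longrightarrow> M p \<le> 4 * real r * t" and av1: "avg (X1 \<times> Y1) M \<le> 4 * t"
    using mean_restriction_to_low_entries[of X Y r M t] fin lr r nonneg t by (smt (verit))
  have s1: "X1 \<subseteq> X" "Y1 \<subseteq> Y" "X1 \<noteq> {}" "Y1 \<noteq> {}" using b1 by (auto simp: large_block_def)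
  have f1: "finite X1" "finite Y1" using finite_subset[OF s1(1) fin(1)] finite_subset[OF s1(2) fin(2)] .
  have nonneg1: "0 \<le> M p" if "p \<in> X1 \<times> Y1" for p by (rule nonneg) (use that s1 in auto)
  define \<tau> where "\<tau> = 4 * t"
  have \<tau>: "\<tau> > 0" using t by (simp add: \<tau>_def)
  have "avg (X1 \<times> Y1) (\<lambda>p. (M p)\<^sup>2) \<le> avg (X1 \<times> Y1) (\<lambda>p. (real r * \<tau>) * M p)"
    unfolding power2_eq_square using up nonneg1
    by (intro avg_mono mult_right_mono) (simp_all add: \<tau>_def mult_ac)
  also have "\<dots> \<le> (real r * \<tau>) * \<tau>"
    unfolding avg_cmult using av1 \<tau> by (intro mult_left_mono) (auto simp: \<tau>_def)
  finally have m2: "avg (X1 \<times> Y1) (\<lambda>p. (M p)\<^sup>2) \<le> real r * \<tau>\<^sup>2" by (simp add: power2_eq_square mult.assoc)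
  \<comment> \<open>Taking the least such exponent ensures \<open>8 ^ i \<le> sqrt r\<close> for all
    \<open>i < j\<close>, the condition for every step of the descent.\<close>
  define j where "j = (LEAST n. real r \<le> 64 ^ n)"
  have "\<exists>n. real r \<le> 64 ^ n" using real_arch_pow[of 64 "real r"] by (auto intro: less_imp_le)
  then have j: "real r \<le> 64 ^ j" unfolding j_def by (rule LeastI_ex)
  have jr: "8 ^ i \<le> sqrt r" if "i < j" for i
  proof (rule real_le_rsqrt)
    have "\<not> real r \<le> 64 ^ i" using not_less_Least[OF that[unfolded j_def]] .
    moreover have "((8::real) ^ i)\<^sup>2 = 64 ^ i" by (simp add: power2_eq_square flip: power_mult_distrib)
    ultimately show "((8::real) ^ i)\<^sup>2 \<le> real r" by simp
  qed
  have "real r * \<tau>\<^sup>2 \<le> 64 ^ j * (4096 * \<tau>\<^sup>2)" using j by (intro mult_mono) auto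
  then have m2': "avg (X1 \<times> Y1) (\<lambda>p. (M p)\<^sup>2) \<le> 4096 * \<tau>\<^sup>2 * 64 ^ j" using m2 by (simp add: mult_ac)
  have "avg (X1 \<times> Y1) M \<le> \<tau> * 1" using av1 by (simp add: \<tau>_def)
  also have "\<dots> \<le> \<tau> * (1 + 1 / 2 ^ j)" using \<tau> by (intro mult_left_mono) auto
  finally have m1': "avg (X1 \<times> Y1) M \<le> \<tau> * (1 + 1 / 2 ^ j)" .
  have "\<exists>X' Y'. large_block (166000 * sqrt r * (1 - 1 / 2 ^ j)) X1 Y1 X' Y' \<and>
    avg (X' \<times> Y') M \<le> 2 * \<tau> \<and> avg (X' \<times> Y') (\<lambda>p. (M p)\<^sup>2) \<le> 4096 * \<tau>\<^sup>2"
    by (rule second_moment_descent[OF f1 s1(3,4) lowrank_subset[OF lr s1(1,2)] r _ \<tau> m1' m2'])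
       (use nonneg1 jr in auto)
  then obtain X2 Y2 where b2: "large_block (166000 * sqrt r * (1 - 1 / 2 ^ j)) X1 Y1 X2 Y2"
    and av2: "avg (X2 \<times> Y2) M \<le> 2 * \<tau>" "avg (X2 \<times> Y2) (\<lambda>p. (M p)\<^sup>2) \<le> 4096 * \<tau>\<^sup>2" by blast
  have s2: "X2 \<subseteq> X1" "Y2 \<subseteq> Y1" "X2 \<noteq> {}" "Y2 \<noteq> {}" using b2 by (auto simp: large_block_def)
  have f2: "finite X2" "finite Y2" using finite_subset[OF s2(1) f1(1)] finite_subset[OF s2(2) f1(2)] .
  have sub2: "p \<in> X \<times> Y" if "p \<in> X2 \<times> Y2" for p using that s1 s2 by auto
  have "avgvar (X2 \<times> Y2) M \<le> avg (X2 \<times> Y2) (\<lambda>p. (M p - 0)\<^sup>2)"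
    by (rule avgvar_le) (use f2 s2 in auto)
  then have "sqrt (avgvar (X2 \<times> Y2) M) \<le> 64 * \<tau>"
    using av2(2) \<tau> by (intro real_le_lsqrt) (auto simp: power_mult_distrib avgvar_nonneg)
  then have pot: "potential (X2 \<times> Y2) M \<le> 264 * t" using av2(1) by (simp add: potential_def \<tau>_def)
  \<comment> \<open>\<open>33792 = 264 * 128\<close>: the potential bound \<open>264 * t\<close> in
    units of the drop \<open>1/128\<close> per round, with one added for strictness.\<close>
  define n where "n = nat \<lceil>33792 * t\<rceil> + 1"
  have n: "33792 * t < n" "n \<le> 33794 * t" using t unfolding n_def by linarith+
  have "\<exists>X' Y'. large_block (160000 * sqrt (Suc r) * n) X2 Y2 X' Y' \<and> constant_on (X' \<times> Y') M"
    by (rule constant_block_by_potential[OF f2 s2(3,4) lowrank_subset[OF lr]])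
       (use s1 s2 n pot nonneg[OF sub2] ints[OF sub2] in auto)
  then obtain X' Y' where b3: "large_block (160000 * sqrt (Suc r) * n) X2 Y2 X' Y'" "constant_on (X' \<times> Y') M"
    by blast
  have s: "1 \<le> sqrt r" using r by simp
  have "sqrt (Suc r) \<le> sqrt ((3/2)\<^sup>2 * r)" using r by (intro real_sqrt_le_mono) (simp add: power2_eq_square)
  then have "sqrt (Suc r) \<le> 3/2 * sqrt r" by (simp add: real_sqrt_mult)
  then have "160000 * sqrt (Suc r) * n \<le> 160000 * (3/2 * sqrt r) * (33794 * t)"
    using n by (intro mult_mono) auto
  then have c3: "160000 * sqrt (Suc r) * n \<le> 8110560000 * (t * sqrt r)" by (simp add: mult_ac)
  have c2: "166000 * sqrt r * (1 - 1 / 2 ^ j) \<le> 166000 * sqrt r * 1"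
    by (intro mult_left_mono) auto
  have c1: "1 * sqrt r \<le> t * sqrt r" using t by (intro mult_right_mono) auto
  have ten: "(10::real) ^ 10 = 10000000000" by simp
  have "2 + 166000 * sqrt r * (1 - 1 / 2 ^ j) + 160000 * sqrt (Suc r) * n
      \<le> 2 + 166000 * sqrt r + 8110560000 * (t * sqrt r)"
    using add_mono[OF c2 c3] by simp
  also have "\<dots> \<le> 10 ^ 10 * (t * sqrt r)" unfolding ten using s c1 by linarith
  finally have "2 + 166000 * sqrt r * (1 - 1 / 2 ^ j) + 160000 * sqrt (Suc r) * n \<le> 10 ^ 10 * t * sqrt r"
    by (simp only: mult.assoc)
  with large_block_trans[OF large_block_trans[OF b1 b2] b3(1)] b3(2) show thesis
    using that large_block_mono by blast
qed

text \<open>Neither side can grow, so each side loses at most the factor lost in area.\<close>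

lemma large_block_sides:
  assumes "large_block \<kappa> X Y X' Y'" "finite X" "finite Y"
  shows "2 powr (- \<kappa>) * card X \<le> card X'" "2 powr (- \<kappa>) * card Y \<le> card Y'"
proof -
  have b: "2 powr (- \<kappa>) * (real (card X) * real (card Y)) \<le> real (card X') * real (card Y')"
    and c: "card X' \<le> card X" "card Y' \<le> card Y" "0 < card X'" "0 < card Y'"
    using assms finite_subset by (auto simp: large_block_def card_gt_0_iff intro: card_mono)
  have "real (card X') * real (card Y') \<le> real (card X') * real (card Y)" using c by (intro mult_left_mono) auto
  with b have "(2 powr (- \<kappa>) * card X) * card Y \<le> card X' * card Y" by (simp add: mult.assoc)
  then show "2 powr (- \<kappa>) * card X \<le> card X'" using c by (simp add: mult_le_cancel_right)
  have "real (card X') * real (card Y') \<le> real (card X) * real (card Y')" using c by (intro mult_right_mono) auto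
  with b have "card X * (2 powr (- \<kappa>) * card Y) \<le> card X * card Y'" by (simp add: mult_ac)
  then show "2 powr (- \<kappa>) * card Y \<le> card Y'" using c by (simp add: mult_le_cancel_left)
qed

theorem theorem1p13:
  shows "\<exists>C::real. C > 0 \<and>
    (\<forall>(m::nat) (n::nat) (r::nat) (M::nat mat) (t::real).
       M \<in> carrier_mat m n \<longrightarrow> real_rank M = r \<longrightarrow> r \<ge> 1 \<longrightarrow>
       t \<ge> 1 \<longrightarrow> mat_average M \<le> t \<longrightarrow>
       (\<exists>I J. I \<subseteq> {..<m} \<and> J \<subseteq> {..<n} \<and>
          constant_mat (submatrix M I J) \<and>
          real (dim_row (submatrix M I J)) \<ge> 2 powr (- C * t * sqrt (real r)) * real m \<and>
          real (dim_col (submatrix M I J)) \<ge> 2 powr (- C * t * sqrt (real r)) * real n))"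
proof (rule exI[of _ "10 ^ 10"], intro conjI allI impI)
  show "(0::real) < 10 ^ 10" by simp
next
  fix m n r :: nat and M :: "nat mat" and t :: real
  assume M: "M \<in> carrier_mat m n" and rk: "real_rank M = r" and r: "r \<ge> 1" and t: "t \<ge> 1" "mat_average M \<le> t"
  let ?X = "{..<m}" and ?Y = "{..<n}"
  let ?c = "2 powr (- (10 ^ 10) * t * sqrt (real r))"
  show "\<exists>I J. I \<subseteq> ?X \<and> J \<subseteq> ?Y \<and> constant_mat (submatrix M I J) \<and>
      real (dim_row (submatrix M I J)) \<ge> ?c * real m \<and> real (dim_col (submatrix M I J)) \<ge> ?c * real n"
  proof (cases "m = 0 \<or> n = 0")
    \<comment> \<open>A matrix without entries is constant vacuously, so the whole matrix
      serves.\<close>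
    case True
    have "?c \<le> 2 powr 0" using t(1) by (intro powr_mono) auto
    then have "?c * real m \<le> 1 * real m" "?c * real n \<le> 1 * real n" by (intro mult_right_mono; simp)+
    moreover have "constant_mat (submatrix M ?X ?Y)" "dim_row (submatrix M ?X ?Y) = m" "dim_col (submatrix M ?X ?Y) = n"
      using constant_submatrix[OF M order_refl order_refl, of undefined] True by auto
    ultimately show ?thesis by (intro exI[of _ ?X] exI[of _ ?Y]) simp
  next
    case False
    then have ne: "?X \<noteq> {}" "?Y \<noteq> {}" by (auto simp: lessThan_empty_iff)
    define F where "F = (\<lambda>(i,j). real (M $$ (i,j)))"
    have lr: "lowrank r ?X ?Y F" using lowrank_real_rank[OF M] by (simp add: rk F_def)
    have av: "avg (?X \<times> ?Y) F \<le> t"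
      using t(2) M by (simp add: avg_def mat_average_def F_def card_cartesian_product sum.cartesian_product)
    obtain I J where IJ: "large_block (10 ^ 10 * t * sqrt r) ?X ?Y I J" "constant_on (I \<times> J) F"
      by (rule constant_block_nat_matrix[OF _ _ ne lr r _ t(1) av]) (auto simp: F_def)
    have sub: "I \<subseteq> ?X" "J \<subseteq> ?Y" "I \<noteq> {}" "J \<noteq> {}" using IJ(1) by (auto simp: large_block_def)
    obtain i0 j0 where ij0: "i0 \<in> I" "j0 \<in> J" using sub by blast
    have "M $$ (i,j) = M $$ (i0,j0)" if "i \<in> I" "j \<in> J" for i j
    proof -
      have "F (i,j) = F (i0,j0)" using IJ(2) that ij0 unfolding constant_on_def by fastforce
      then show ?thesis by (simp add: F_def)
    qed
    note cs = constant_submatrix[OF M sub(1,2) this]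
    have "2 powr (- (10 ^ 10 * t * sqrt r)) * m \<le> card I" "2 powr (- (10 ^ 10 * t * sqrt r)) * n \<le> card J"
      using large_block_sides[OF IJ(1)] by auto
    then show ?thesis
      using cs sub by (intro exI[of _ I] exI[of _ J]) simp
  qed
qed

end
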